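(* Any symmetric triple $(\mathfrak g,\theta,\langle\cdot,\cdot\rangle)$ without (non-zero) semi-simple ideals has the structure of a balanced, hence admissible, quadratic extension in a canonical way: namely, the canonical extension associated with $(\mathfrak g,\theta,\mathfrak i(\mathfrak g))$ is a balanced quadratic extension of $\mathfrak g/\mathfrak i(\mathfrak g)^\perp$ by $\mathfrak i(\mathfrak g)^\perp/\mathfrak i(\mathfrak g)$.
   Context: All Lie algebras and vector spaces are finite-dimensional over $\mathbb R$; a scalar product is a non-degenerate symmetric bilinear form, possibly indefinite. A Lie algebra with involution is a pair $(\mathfrak l,\theta_{\mathfrak l})$, $\theta_{\mathfrak l}\in\mathrm{Aut}(\mathfrak l)$, $\theta_{\mathfrak l}^2=\mathrm{Id}$; homomorphisms commute with the involutions. A metric Lie algebra with involution $(\mathfrak g,\theta,\langle\cdot,\cdot\rangle)$ is a Lie algebra with ad-invariant scalar product and an isometric involutive automorphism; with $\mathfrak g_\pm$ the $\pm1$-eigenspaces of $\theta$, it is a symmetric triple if $[\mathfrak g_-,\mathfrak g_-]=\mathfrak g_+$ (equivalently, $\mathfrak g_+$ acts faithfully on $\mathfrak g_-$). An orthogonal $(\mathfrak l,\theta_{\mathfrak l})$-module is $(\rho,\mathfrak a,\langle\cdot,\cdot\rangle_{\mathfrak a},\theta_{\mathfrak a})$ with $\rho$ a representation of $\mathfrak l$ on $\mathfrak a$ by skew-adjoint maps and $\theta_{\mathfrak a}$ an involutive isometry with $\theta_{\mathfrak a}\circ\rho(\theta_{\mathfrak l}(L))=\rho(L)\circ\theta_{\mathfrak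 a}$ for all $L\in\mathfrak l$. A quadratic extension of $(\mathfrak l,\theta_{\mathfrak l})$ by $\mathfrak a$ is a tuple $(\mathfrak g,\theta,\mathfrak i,i,p)$ where $(\mathfrak g,\theta)$ is a metric Lie algebra with involution, $\mathfrak i\subset\mathfrak g$ is a $\theta$-invariant isotropic ideal, and $0\to\mathfrak a\xrightarrow{i}\mathfrak g/\mathfrak i\xrightarrow{p}\mathfrak l\to0$ is an exact sequence of Lie algebras with involution ($\mathfrak a$ abelian) such that $i(\rho(L)A)=[\tilde L,i(A)]$ whenever $\tilde L\in\mathfrak g/\mathfrak i$, $p(\tilde L)=L$, and $i$ is an isometry from $\mathfrak a$ onto $\mathfrak i^\perp/\mathfrak i$. If $(\mathfrak g,\theta)$ is a metric Lie algebra with involution and $\mathfrak i\subset\mathfrak g$ an isotropic $\theta$-invariant ideal such that $\mathfrak i^\perp/\mathfrak i$ is abelian, the canonical extension associated with $(\mathfrak g,\theta,\mathfrak i)$ is given by the natural sequence $0\to\mathfrak i^\perp/\mathfrak i\to\mathfrak g/\mathfrak i\to\mathfrak g/\mathfrak i^\perp\to0$, with all induced involutions, the induced scalar product on $\mathfrak i^\perp/\mathfrak i$ and the induced action of $\mathfrak g/\mathfrak i^\perp$. For a Lie algebra $\mathfrak g$ put $S_0(\mathfrak g)=0$, $R_0(\mathfrak g)=\mathfrak g$; $S_k(\mathfrak g)$ is the largest ideal containing $S_{k-1}(\mathfrak g)$ such that the $\mathfrak g$-module $S_k(\mathfrak g)/S_{k-1}(\mathfrak g)$ is semi-simple; $R_k(\mathfrak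 g)$ is the smallest ideal contained in $R_{k-1}(\mathfrak g)$ such that $R_{k-1}(\mathfrak g)/R_k(\mathfrak g)$ is semi-simple. Put $\mathfrak i(\mathfrak g)=\sum_{k\ge1}S_k(\mathfrak g)\cap R_k(\mathfrak g)$. A quadratic extension $(\mathfrak g,\theta,\mathfrak i,i,p)$ is balanced if $\mathfrak i=\mathfrak i(\mathfrak g)$, and admissible if it is balanced and $(\mathfrak g,\theta,\langle\cdot,\cdot\rangle)$ is a symmetric triple. *)

theory Defs
  imports "HOL-Analysis.Analysis" "HOL-Algebra.Module" "HOL-Algebra.AbelCoset"
begin

section \<open>Real vector spaces and Lie algebras on carrier sets\<close>

text \<open>
  The Lie algebra \<open>\<gg>\<close> itself lives on a whole type of class \<open>real_vector\<close>. Its quotients live on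
  sets of cosets, which do not form a type. They are represented by the module records of
  HOL-Algebra, where \<open>mult\<close> is the Lie bracket (as \<open>mult\<close> is the product in the locale
  \<open>algebra\<close>). The field \<open>one\<close> of these records has no meaning and is never used.
\<close>

type_synonym 'a space = "(real, 'a) module"

definition real_ring :: "real ring" where
  "real_ring = \<lparr>carrier = UNIV, mult = (*), one = 1, zero = 0, add = (+)\<rparr>"

definition fd_space :: "'a space \<Rightarrow> bool" where
  "fd_space V \<longleftrightarrow> Module.module real_ring V \<and>
     (\<exists>B \<subseteq> carrier V. finite B \<and>
        (\<forall>v \<in> carrier V. \<exists>c. v = (\<Oplus>\<^bsub>V\<^esub>b\<in>B. c b \<odot>\<^bsub>V\<^esub> b)))"

definition lin_maps :: "'a space \<Rightarrow> 'b space \<Rightarrow> ('a \<Rightarrow> 'b) set" where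
  "lin_maps V W = {f \<in> carrier V \<rightarrow> carrier W.
     (\<forall>x\<in>carrier V. \<forall>y\<in>carrier V. f (x \<oplus>\<^bsub>V\<^esub> y) = f x \<oplus>\<^bsub>W\<^esub> f y) \<and>
     (\<forall>c. \<forall>x\<in>carrier V. f (c \<odot>\<^bsub>V\<^esub> x) = c \<odot>\<^bsub>W\<^esub> f x)}"

definition lie_alg :: "'a space \<Rightarrow> bool" where
  "lie_alg L \<longleftrightarrow> fd_space L \<and>
     (\<forall>x\<in>carrier L. (\<lambda>y. x \<otimes>\<^bsub>L\<^esub> y) \<in> lin_maps L L) \<and>
     (\<forall>y\<in>carrier L. (\<lambda>x. x \<otimes>\<^bsub>L\<^esub> y) \<in> lin_maps L L) \<and>
     (\<forall>x\<in>carrier L. x \<otimes>\<^bsub>L\<^esub> x = \<zero>\<^bsub>L\<^esub>) \<and>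
     (\<forall>x\<in>carrier L. \<forall>y\<in>carrier L. \<forall>z\<in>carrier L.
        x \<otimes>\<^bsub>L\<^esub> (y \<otimes>\<^bsub>L\<^esub> z) \<oplus>\<^bsub>L\<^esub> y \<otimes>\<^bsub>L\<^esub> (z \<otimes>\<^bsub>L\<^esub> x) \<oplus>\<^bsub>L\<^esub> z \<otimes>\<^bsub>L\<^esub> (x \<otimes>\<^bsub>L\<^esub> y) = \<zero>\<^bsub>L\<^esub>)"

definition abelian_lie_alg :: "'a space \<Rightarrow> bool" where
  "abelian_lie_alg L \<longleftrightarrow> lie_alg L \<and> (\<forall>x\<in>carrier L. \<forall>y\<in>carrier L. x \<otimes>\<^bsub>L\<^esub> y = \<zero>\<^bsub>L\<^esub>)"

definition lie_homs :: "'a space \<Rightarrow> 'b space \<Rightarrow> ('a \<Rightarrow> 'b) set" where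
  "lie_homs L M = {f \<in> lin_maps L M.
     \<forall>x\<in>carrier L. \<forall>y\<in>carrier L. f (x \<otimes>\<^bsub>L\<^esub> y) = f x \<otimes>\<^bsub>M\<^esub> f y}"

definition involutive_on :: "'a set \<Rightarrow> ('a \<Rightarrow> 'a) \<Rightarrow> bool" where
  "involutive_on X \<theta> \<longleftrightarrow> \<theta> \<in> X \<rightarrow> X \<and> (\<forall>x\<in>X. \<theta> (\<theta> x) = x)"

definition lie_alg_with_involution :: "'a space \<Rightarrow> ('a \<Rightarrow> 'a) \<Rightarrow> bool" where
  "lie_alg_with_involution L \<theta> \<longleftrightarrow>
     lie_alg L \<and> \<theta> \<in> lie_homs L L \<and> involutive_on (carrier L) \<theta>"

definition lie_inv_homs ::
  "'a space \<Rightarrow> ('a \<Rightarrow> 'a) \<Rightarrow> 'b space \<Rightarrow> ('b \<Rightarrow> 'b) \<Rightarrow> ('a \<Rightarrow> 'b) set" where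
  "lie_inv_homs L \<theta>L M \<theta>M = {f \<in> lie_homs L M. \<forall>x\<in>carrier L. f (\<theta>L x) = \<theta>M (f x)}"

definition scalar_product_on :: "'a space \<Rightarrow> ('a \<Rightarrow> 'a \<Rightarrow> real) \<Rightarrow> bool" where
  "scalar_product_on V ip \<longleftrightarrow>
     (\<forall>x\<in>carrier V. \<forall>y\<in>carrier V. ip x y = ip y x) \<and>
     (\<forall>x\<in>carrier V. \<forall>y\<in>carrier V. \<forall>z\<in>carrier V. ip (x \<oplus>\<^bsub>V\<^esub> y) z = ip x z + ip y z) \<and>
     (\<forall>c. \<forall>x\<in>carrier V. \<forall>y\<in>carrier V. ip (c \<odot>\<^bsub>V\<^esub> x) y = c * ip x y) \<and>
     (\<forall>x\<in>carrier V. (\<forall>y\<in>carrier V. ip x y = 0) \<longrightarrow> x = \<zero>\<^bsub>V\<^esub>)"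

definition representation_on :: "'l space \<Rightarrow> ('l \<Rightarrow> 'a \<Rightarrow> 'a) \<Rightarrow> 'a space \<Rightarrow> bool" where
  "representation_on L \<rho> V \<longleftrightarrow>
     (\<forall>x\<in>carrier L. \<rho> x \<in> lin_maps V V) \<and>
     (\<forall>v\<in>carrier V. (\<lambda>x. \<rho> x v) \<in> lin_maps L V) \<and>
     (\<forall>x\<in>carrier L. \<forall>y\<in>carrier L. \<forall>v\<in>carrier V.
        \<rho> (x \<otimes>\<^bsub>L\<^esub> y) v = \<rho> x (\<rho> y v) \<ominus>\<^bsub>V\<^esub> \<rho> y (\<rho> x v))"

definition orthogonal_module ::
  "'l space \<Rightarrow> ('l \<Rightarrow> 'l) \<Rightarrow> ('l \<Rightarrow> 'a \<Rightarrow> 'a) \<Rightarrow> 'a space \<Rightarrow> ('a \<Rightarrow> 'a \<Rightarrow> real) \<Rightarrow> ('a \<Rightarrow> 'a) \<Rightarrow> bool" where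
  "orthogonal_module L \<theta>L \<rho> A ipA \<theta>A \<longleftrightarrow>
     fd_space A \<and> scalar_product_on A ipA \<and> representation_on L \<rho> A \<and>
     (\<forall>x\<in>carrier L. \<forall>a\<in>carrier A. \<forall>b\<in>carrier A. ipA (\<rho> x a) b = - ipA a (\<rho> x b)) \<and>
     \<theta>A \<in> lin_maps A A \<and> involutive_on (carrier A) \<theta>A \<and>
     (\<forall>a\<in>carrier A. \<forall>b\<in>carrier A. ipA (\<theta>A a) (\<theta>A b) = ipA a b) \<and>
     (\<forall>x\<in>carrier L. \<forall>a\<in>carrier A. \<theta>A (\<rho> (\<theta>L x) a) = \<rho> x (\<theta>A a))"

text \<open>
  Semi-simplicity is complete reducibility: every invariant subspace has an invariant complement.
  Only the maps \<open>\<rho> x\<close> for \<open>x \<in> X\<close> matter.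
\<close>

definition invariant_submodule :: "'l set \<Rightarrow> ('l \<Rightarrow> 'a \<Rightarrow> 'a) \<Rightarrow> 'a space \<Rightarrow> 'a set \<Rightarrow> bool" where
  "invariant_submodule X \<rho> V W \<longleftrightarrow>
     submodule W real_ring V \<and> (\<forall>x\<in>X. \<forall>w\<in>W. \<rho> x w \<in> W)"

definition semisimple_module :: "'l set \<Rightarrow> ('l \<Rightarrow> 'a \<Rightarrow> 'a) \<Rightarrow> 'a space \<Rightarrow> bool" where
  "semisimple_module X \<rho> V \<longleftrightarrow>
     (\<forall>W. invariant_submodule X \<rho> V W \<longrightarrow>
        (\<exists>W'. invariant_submodule X \<rho> V W' \<and>
           W \<inter> W' = {\<zero>\<^bsub>V\<^esub>} \<and> W <+>\<^bsub>V\<^esub> W' = carrier V))"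


section \<open>Metric Lie algebras with involution\<close>

definition lie_bracket :: "('g::real_vector \<Rightarrow> 'g \<Rightarrow> 'g) \<Rightarrow> bool" where
  "lie_bracket br \<longleftrightarrow> bilinear br \<and> (\<forall>x. br x x = 0) \<and>
     (\<forall>x y z. br x (br y z) + br y (br z x) + br z (br x y) = 0)"

definition scalar_product :: "('g::real_vector \<Rightarrow> 'g \<Rightarrow> real) \<Rightarrow> bool" where
  "scalar_product ip \<longleftrightarrow> bilinear ip \<and> (\<forall>x y. ip x y = ip y x) \<and>
     (\<forall>x. (\<forall>y. ip x y = 0) \<longrightarrow> x = 0)"

definition metric_lie_alg_with_involution ::
  "('g::real_vector \<Rightarrow> 'g \<Rightarrow> 'g) \<Rightarrow> ('g \<Rightarrow> 'g) \<Rightarrow> ('g \<Rightarrow> 'g \<Rightarrow> real) \<Rightarrow> bool" where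
  "metric_lie_alg_with_involution br \<theta> ip \<longleftrightarrow>
     (\<exists>B::'g set. finite B \<and> span B = UNIV) \<and>
     lie_bracket br \<and> scalar_product ip \<and>
     (\<forall>x y z. ip (br x y) z = - ip y (br x z)) \<and>
     linear \<theta> \<and> (\<forall>x. \<theta> (\<theta> x) = x) \<and>
     (\<forall>x y. \<theta> (br x y) = br (\<theta> x) (\<theta> y)) \<and>
     (\<forall>x y. ip (\<theta> x) (\<theta> y) = ip x y)"

definition lie_prod :: "('g::real_vector \<Rightarrow> 'g \<Rightarrow> 'g) \<Rightarrow> 'g set \<Rightarrow> 'g set \<Rightarrow> 'g set" where
  "lie_prod br X Y = span {br x y | x y. x \<in> X \<and> y \<in> Y}"

definition symmetric_triple ::
  "('g::real_vector \<Rightarrow> 'g \<Rightarrow> 'g) \<Rightarrow> ('g \<Rightarrow> 'g) \<Rightarrow> ('g \<Rightarrow> 'g \<Rightarrow> real) \<Rightarrow> bool" where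
  "symmetric_triple br \<theta> ip \<longleftrightarrow>
     metric_lie_alg_with_involution br \<theta> ip \<and>
     lie_prod br {x. \<theta> x = - x} {x. \<theta> x = - x} = {x. \<theta> x = x}"

definition orth :: "('g \<Rightarrow> 'g \<Rightarrow> real) \<Rightarrow> 'g set \<Rightarrow> 'g set" where
  "orth ip W = {x. \<forall>w\<in>W. ip x w = 0}"

definition lie_ideal_in :: "('g::real_vector \<Rightarrow> 'g \<Rightarrow> 'g) \<Rightarrow> 'g set \<Rightarrow> 'g set \<Rightarrow> bool" where
  "lie_ideal_in br H J \<longleftrightarrow> subspace J \<and> J \<subseteq> H \<and> (\<forall>x\<in>H. \<forall>y\<in>J. br x y \<in> J)"

abbreviation lie_ideal :: "('g::real_vector \<Rightarrow> 'g \<Rightarrow> 'g) \<Rightarrow> 'g set \<Rightarrow> bool" where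
  "lie_ideal br \<equiv> lie_ideal_in br UNIV"

definition solvable_lie :: "('g::real_vector \<Rightarrow> 'g \<Rightarrow> 'g) \<Rightarrow> 'g set \<Rightarrow> bool" where
  "solvable_lie br H \<longleftrightarrow> (\<exists>n. ((\<lambda>D. lie_prod br D D) ^^ n) H = {0})"

text \<open>A subalgebra \<open>H\<close> is semi-simple as a Lie algebra if its radical is zero.\<close>

definition semisimple_lie :: "('g::real_vector \<Rightarrow> 'g \<Rightarrow> 'g) \<Rightarrow> 'g set \<Rightarrow> bool" where
  "semisimple_lie br H \<longleftrightarrow> (\<forall>J. lie_ideal_in br H J \<and> solvable_lie br J \<longrightarrow> J = {0})"


section \<open>Quotients\<close>

text \<open>
  Maps induced on cosets of a subspace \<open>K\<close>, in the style of \<open>rcoset_mult\<close>: the union over all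
  representatives, which is a single coset of \<open>K\<close> exactly if the induced map is well-defined there.
\<close>

definition ind1 :: "'g::real_vector set \<Rightarrow> ('g \<Rightarrow> 'g) \<Rightarrow> 'g set \<Rightarrow> 'g set" where
  "ind1 K f X = (\<Union>x\<in>X. (+) (f x) ` K)"

definition ind2 ::
  "'g::real_vector set \<Rightarrow> ('g \<Rightarrow> 'g \<Rightarrow> 'g) \<Rightarrow> 'g set \<Rightarrow> 'g set \<Rightarrow> 'g set" where
  "ind2 K f X Y = (\<Union>x\<in>X. \<Union>y\<in>Y. (+) (f x y) ` K)"

text \<open>\<open>J / K\<close> for subspaces \<open>K \<subseteq> J\<close>, with the induced bracket.\<close>

definition quot :: "('g::real_vector \<Rightarrow> 'g \<Rightarrow> 'g) \<Rightarrow> 'g set \<Rightarrow> 'g set \<Rightarrow> 'g set space" where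
  "quot br J K = \<lparr>carrier = (\<lambda>x. (+) x ` K) ` J, mult = ind2 K br, one = undefined,
     zero = K, add = ind2 K (+), smult = (\<lambda>c. ind1 K ((*\<^sub>R) c))\<rparr>"

definition ind_form :: "('g \<Rightarrow> 'g \<Rightarrow> real) \<Rightarrow> 'g set \<Rightarrow> 'g set \<Rightarrow> real" where
  "ind_form ip X Y = the_elem {ip x y | x y. x \<in> X \<and> y \<in> Y}"


section \<open>The canonical ideal\<close>

definition semisimple_quot :: "('g::real_vector \<Rightarrow> 'g \<Rightarrow> 'g) \<Rightarrow> 'g set \<Rightarrow> 'g set \<Rightarrow> bool" where
  "semisimple_quot br J K \<longleftrightarrow> semisimple_module UNIV (\<lambda>x. ind1 K (br x)) (quot br J K)"

text \<open>\<open>GREATEST\<close> and \<open>LEAST\<close> refer to inclusion of sets.\<close>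

primrec S_ideal :: "('g::real_vector \<Rightarrow> 'g \<Rightarrow> 'g) \<Rightarrow> nat \<Rightarrow> 'g set" where
  "S_ideal br 0 = {0}"
| "S_ideal br (Suc k) = (GREATEST J. lie_ideal br J \<and> S_ideal br k \<subseteq> J \<and>
     semisimple_quot br J (S_ideal br k))"

primrec R_ideal :: "('g::real_vector \<Rightarrow> 'g \<Rightarrow> 'g) \<Rightarrow> nat \<Rightarrow> 'g set" where
  "R_ideal br 0 = UNIV"
| "R_ideal br (Suc k) = (LEAST J. lie_ideal br J \<and> J \<subseteq> R_ideal br k \<and>
     semisimple_quot br (R_ideal br k) J)"

text \<open>The sum of the subspaces \<open>S\<^sub>k \<inter> R\<^sub>k\<close> is the span of their union.\<close>

definition canonical_ideal :: "('g::real_vector \<Rightarrow> 'g \<Rightarrow> 'g) \<Rightarrow> 'g set" where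
  "canonical_ideal br = span (\<Union>k\<in>{1..}. S_ideal br k \<inter> R_ideal br k)"


section \<open>Quadratic extensions\<close>

text \<open>
  In \<open>quadratic_extension L \<theta>L \<rho> A ipA \<theta>A br \<theta> ip I i p\<close>, the first six arguments are
  \<open>(\<ll>, \<theta>\<^sub>\<ll>)\<close> and the module \<open>\<aa>\<close>, the next three are the metric Lie algebra \<open>(\<gg>, \<theta>, \<langle>\<cdot>,\<cdot>\<rangle>)\<close>.
  Note that the carrier of \<open>quot br (orth ip I) I\<close> is a subset of that of \<open>quot br UNIV I\<close>.
\<close>

definition quadratic_extension ::
  "'l space \<Rightarrow> ('l \<Rightarrow> 'l) \<Rightarrow>
   ('l \<Rightarrow> 'a \<Rightarrow> 'a) \<Rightarrow> 'a space \<Rightarrow> ('a \<Rightarrow> 'a \<Rightarrow> real) \<Rightarrow> ('a \<Rightarrow> 'a) \<Rightarrow>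
   ('g::real_vector \<Rightarrow> 'g \<Rightarrow> 'g) \<Rightarrow> ('g \<Rightarrow> 'g) \<Rightarrow> ('g \<Rightarrow> 'g \<Rightarrow> real) \<Rightarrow>
   'g set \<Rightarrow> ('a \<Rightarrow> 'g set) \<Rightarrow> ('g set \<Rightarrow> 'l) \<Rightarrow> bool" where
  "quadratic_extension L \<theta>L \<rho> A ipA \<theta>A br \<theta> ip I i p \<longleftrightarrow>
     lie_alg_with_involution L \<theta>L \<and>
     orthogonal_module L \<theta>L \<rho> A ipA \<theta>A \<and> abelian_lie_alg A \<and>
     metric_lie_alg_with_involution br \<theta> ip \<and>
     lie_ideal br I \<and> \<theta> ` I \<subseteq> I \<and> I \<subseteq> orth ip I \<and>
     i \<in> lie_inv_homs A \<theta>A (quot br UNIV I) (ind1 I \<theta>) \<and>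
     p \<in> lie_inv_homs (quot br UNIV I) (ind1 I \<theta>) L \<theta>L \<and>
     inj_on i (carrier A) \<and>
     i ` carrier A = {X \<in> carrier (quot br UNIV I). p X = \<zero>\<^bsub>L\<^esub>} \<and>
     p ` carrier (quot br UNIV I) = carrier L \<and>
     (\<forall>X \<in> carrier (quot br UNIV I). \<forall>a \<in> carrier A. i (\<rho> (p X) a) = X \<otimes>\<^bsub>quot br UNIV I\<^esub> i a) \<and>
     i ` carrier A = carrier (quot br (orth ip I) I) \<and>
     (\<forall>a \<in> carrier A. \<forall>b \<in> carrier A. ind_form ip (i a) (i b) = ipA a b)"

definition balanced_quadratic_extension ::
  "'l space \<Rightarrow> ('l \<Rightarrow> 'l) \<Rightarrow>
   ('l \<Rightarrow> 'a \<Rightarrow> 'a) \<Rightarrow> 'a space \<Rightarrow> ('a \<Rightarrow> 'a \<Rightarrow> real) \<Rightarrow> ('a \<Rightarrow> 'a) \<Rightarrow>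
   ('g::real_vector \<Rightarrow> 'g \<Rightarrow> 'g) \<Rightarrow> ('g \<Rightarrow> 'g) \<Rightarrow> ('g \<Rightarrow> 'g \<Rightarrow> real) \<Rightarrow>
   'g set \<Rightarrow> ('a \<Rightarrow> 'g set) \<Rightarrow> ('g set \<Rightarrow> 'l) \<Rightarrow> bool" where
  "balanced_quadratic_extension L \<theta>L \<rho> A ipA \<theta>A br \<theta> ip I i p \<longleftrightarrow>
     quadratic_extension L \<theta>L \<rho> A ipA \<theta>A br \<theta> ip I i p \<and> I = canonical_ideal br"

definition admissible_quadratic_extension ::
  "'l space \<Rightarrow> ('l \<Rightarrow> 'l) \<Rightarrow>
   ('l \<Rightarrow> 'a \<Rightarrow> 'a) \<Rightarrow> 'a space \<Rightarrow> ('a \<Rightarrow> 'a \<Rightarrow> real) \<Rightarrow> ('a \<Rightarrow> 'a) \<Rightarrow>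
   ('g::real_vector \<Rightarrow> 'g \<Rightarrow> 'g) \<Rightarrow> ('g \<Rightarrow> 'g) \<Rightarrow> ('g \<Rightarrow> 'g \<Rightarrow> real) \<Rightarrow>
   'g set \<Rightarrow> ('a \<Rightarrow> 'g set) \<Rightarrow> ('g set \<Rightarrow> 'l) \<Rightarrow> bool" where
  "admissible_quadratic_extension L \<theta>L \<rho> A ipA \<theta>A br \<theta> ip I i p \<longleftrightarrow>
     balanced_quadratic_extension L \<theta>L \<rho> A ipA \<theta>A br \<theta> ip I i p \<and> symmetric_triple br \<theta> ip"

end

theory Submission
  imports Defs "HOL-Computational_Algebra.Fundamental_Theorem_Algebra"
begin

text \<open>
  Write \<open>S\<^sub>k\<close> and \<open>R\<^sub>k\<close> for the two chains of ideals and \<open>\<ii>\<close> for the canonical ideal. The scalar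
  product turns the defining property of \<open>S\<^sub>k\<close> into that of \<open>R\<^sub>k\<close>, so \<open>R\<^sub>k\<close> is the orthogonal
  complement of \<open>S\<^sub>k\<close>. It follows formally that \<open>\<ii>\<close> is isotropic and that its orthogonal complement
  is the intersection of the \<open>S\<^sub>k + R\<^sub>k\<close>; by the modular law this is the sum of the layers
  \<open>A\<^sub>k = S\<^bsub>k+1\<^esub> \<inter> R\<^sub>k\<close>, \<open>k \<ge> 0\<close>. What has to be shown is that brackets of layers lie in \<open>\<ii>\<close>; the
  remaining requirements on the canonical extension are verified directly on cosets.

  For \<open>k < l\<close> the bracket of \<open>A\<^sub>k\<close> and \<open>A\<^sub>l\<close> lies in \<open>S\<^bsub>k+1\<^esub> \<inter> R\<^bsub>k+1\<^esub>\<close> by construction. For \<open>k \<ge> 1\<close> the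
  layer \<open>A\<^sub>k\<close> is contained in \<open>R\<^sub>1\<close>, which is solvable (\<open>R1_solvable\<close>), and a solvable ideal has an
  abelian image in a semi-simple quotient (\<open>solvable_in_completely_reducible\<close>), whence
  \<open>[A\<^sub>k, A\<^sub>k] \<subseteq> S\<^sub>k \<inter> R\<^sub>k\<close>. The layer \<open>A\<^sub>0 = S\<^sub>1\<close> is the socle. Here the hypothesis on semi-simple ideals
  enters: a minimal ideal is abelian or semi-simple (\<open>minimal_ideal_abelian_or_semisimple\<close>), hence
  abelian, and therefore \<open>S\<^sub>1\<close> is abelian (\<open>S1_abelian\<close>).

  Characteristic zero is used through the Killing form \<open>\<kappa>\<close> of \<open>\<gg>\<close>. The key fact is
  \<open>perfect_ideal_killing_perp\<close>: a non-zero perfect ideal \<open>P\<close> is not contained in its \<open>\<kappa>\<close>-complement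
  \<open>C\<close>, and \<open>\<gg> = P + C\<close>. Its proof combines Cartan's criterion with Engel's theorem to see that
  \<open>P \<inter> C\<close> acts nilpotently on \<open>\<gg>\<close>. If \<open>P \<subseteq> R\<^sub>1\<close>, then a minimal ideal orthogonal to \<open>C\<close> lies in the
  socle, hence is also orthogonal to \<open>R\<^sub>1\<close> and so to \<open>\<gg>\<close>, which is absurd. Thus \<open>R\<^sub>1\<close> contains no
  perfect ideal except zero, and the derived series of \<open>R\<^sub>1\<close>, which becomes stationary at a
  perfect ideal, ends at zero.
\<close>

section \<open>Traces\<close>

locale trace_space = finite_dimensional_vector_space
begin

definition trace_on :: "'b set \<Rightarrow> ('b \<Rightarrow> 'b) \<Rightarrow> 'a" where
  "trace_on B f = (\<Sum>b\<in>B. representation B (f b) b)"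

abbreviation trace :: "('b \<Rightarrow> 'b) \<Rightarrow> 'a" where
  "trace \<equiv> trace_on Basis"

lemma expand_in_basis:
  assumes "independent B" "span B = UNIV"
  shows "(\<Sum>b\<in>B. scale (representation B v b) b) = v"
  using assms finiteI_independent by (intro sum_representation_eq) auto

lemma representation_linear_image:
  assumes "independent B" "span B = UNIV" "independent C" "span C = UNIV"
    and "Vector_Spaces.linear scale scale f"
  shows "representation C (f v) c = (\<Sum>b\<in>B. representation B v b * representation C (f b) c)"
proof -
  interpret f: Vector_Spaces.linear scale scale f by fact
  have "f v = (\<Sum>b\<in>B. scale (representation B v b) (f b))"
    by (subst expand_in_basis[OF assms(1,2), of v, symmetric]) (simp add: f.sum f.scale)
  then show ?thesis
    using assms by (simp add: representation_sum representation_scale)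
qed

lemma trace_on_comp:
  assumes "independent B" "span B = UNIV" "independent C" "span C = UNIV"
    and "Vector_Spaces.linear scale scale f" "Vector_Spaces.linear scale scale g"
  shows "trace_on B (f \<circ> g) = trace_on C (g \<circ> f)"
proof -
  have "trace_on B (f \<circ> g)
      = (\<Sum>b\<in>B. \<Sum>c\<in>C. representation C (g b) c * representation B (f c) b)"
    unfolding trace_on_def o_def
    by (intro sum.cong refl representation_linear_image assms)
  also have "\<dots> = (\<Sum>c\<in>C. \<Sum>b\<in>B. representation B (f c) b * representation C (g b) c)"
    by (subst sum.swap) (simp add: mult.commute)
  also have "\<dots> = trace_on C (g \<circ> f)"
    unfolding trace_on_def o_def
    by (intro sum.cong refl representation_linear_image[symmetric] assms)
  finally show ?thesis .
qed

lemma trace_on_eq_trace: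
  assumes "independent B" "span B = UNIV" "Vector_Spaces.linear scale scale f"
  shows "trace_on B f = trace f"
  using trace_on_comp[OF assms(1,2) independent_Basis span_Basis assms(3) linear_id]
  by (simp add: id_def o_def)

lemma trace_comp_commute:
  assumes "Vector_Spaces.linear scale scale f" "Vector_Spaces.linear scale scale g"
  shows "trace (\<lambda>v. f (g v)) = trace (\<lambda>v. g (f v))"
  using trace_on_comp[OF independent_Basis span_Basis independent_Basis span_Basis assms]
  by (simp add: o_def)

lemma trace_add: "trace (\<lambda>v. f v + g v) = trace f + trace g"
  by (simp add: trace_on_def representation_add independent_Basis span_Basis sum.distrib)

lemma trace_diff: "trace (\<lambda>v. f v - g v) = trace f - trace g"
  by (simp add: trace_on_def representation_diff independent_Basis span_Basis sum_subtractf)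

lemma trace_scale: "trace (\<lambda>v. scale c (f v)) = c * trace f"
  by (simp add: trace_on_def representation_scale independent_Basis span_Basis sum_distrib_left)

lemma trace_zero: "trace (\<lambda>v. 0) = 0"
  by (simp add: trace_on_def representation_zero)

lemma linear_funpow:
  assumes "Vector_Spaces.linear scale scale f"
  shows "Vector_Spaces.linear scale scale (f ^^ k)"
proof (induction k)
  case 0
  then show ?case using linear_id by (simp add: id_def)
next
  case (Suc k)
  then show ?case using Vector_Spaces.linear_compose[OF _ assms] by (simp only: funpow.simps)
qed

lemma subspace_funpow_kernel:
  assumes "Vector_Spaces.linear scale scale f"
  shows "subspace {v. (f ^^ k) v = 0}"
proof -
  interpret fk: Vector_Spaces.linear scale scale "f ^^ k" using linear_funpow[OF assms] .
  show ?thesis by (intro subspaceI) (auto simp: fk.zero fk.add fk.scale)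
qed

lemma funpow_kernel_mono:
  assumes "Vector_Spaces.linear scale scale f" "(f ^^ k) v = 0" "k \<le> m"
  shows "(f ^^ m) v = 0"
proof -
  interpret fk: Vector_Spaces.linear scale scale "f ^^ (m - k)" using linear_funpow[OF assms(1)] .
  have "(f ^^ m) v = (f ^^ (m - k)) ((f ^^ k) v)"
    using assms(3) by (metis comp_apply funpow_add le_add_diff_inverse2)
  then show ?thesis using assms(2) fk.zero by simp
qed

lemma pointwise_nilpotent_imp_nilpotent:
  assumes lin: "Vector_Spaces.linear scale scale f" and nil: "\<And>v. \<exists>k. (f ^^ k) v = 0"
  obtains n where "\<And>v. (f ^^ n) v = 0"
proof -
  obtain k where k: "(f ^^ k v) v = 0" for v using nil by metis
  define n where "n = (\<Sum>b\<in>Basis. k b)"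
  have "Basis \<subseteq> {v. (f ^^ n) v = 0}"
  proof
    fix b assume "b \<in> Basis"
    then have "k b \<le> n" by (auto simp: n_def intro: member_le_sum finite_Basis)
    then show "b \<in> {v. (f ^^ n) v = 0}" using funpow_kernel_mono[OF lin k] by blast
  qed
  then have "{v. (f ^^ n) v = 0} = UNIV"
    using span_minimal[OF _ subspace_funpow_kernel[OF lin], of Basis n] span_Basis by auto
  then show thesis using that by blast
qed

text \<open>
  A basis adapted to the flag of the kernels of the powers of \<open>f\<close>: the image of each basis
  vector lies in the span of vectors found earlier, so that \<open>f\<close> has a zero diagonal.
\<close>

lemma trace_nilpotent:
  assumes lin: "Vector_Spaces.linear scale scale f" and nil: "\<And>v. \<exists>k. (f ^^ k) v = 0"
  shows "trace f = 0"
proof -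
  obtain n where "\<And>v. (f ^^ n) v = 0"
    using pointwise_nilpotent_imp_nilpotent[OF lin nil] by blast
  then have top: "{v. (f ^^ n) v = 0} = UNIV" by auto
  note sub = subspace_funpow_kernel[OF lin]
  note mono = funpow_kernel_mono[OF lin]
  have "\<exists>B. independent B \<and> span B = {v. (f ^^ m) v = 0} \<and> (\<forall>b\<in>B. f b \<in> span (B - {b}))" for m
  proof (induction m)
    case 0
    then show ?case by (intro exI[of _ "{}"]) (auto simp: independent_empty)
  next
    case (Suc m)
    then obtain B where B: "independent B" "span B = {v. (f ^^ m) v = 0}"
      "\<forall>b\<in>B. f b \<in> span (B - {b})" by blast
    have "B \<subseteq> {v. (f ^^ Suc m) v = 0}"
      using span_superset[of B] B(2) mono[of m _ "Suc m"] by auto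
    then obtain C where C: "B \<subseteq> C" "C \<subseteq> {v. (f ^^ Suc m) v = 0}" "independent C"
      "{v. (f ^^ Suc m) v = 0} \<subseteq> span C"
      using maximal_independent_subset_extend[of B "{v. (f ^^ Suc m) v = 0}"] B(1) by blast
    have "f b \<in> span (C - {b})" if "b \<in> C" for b
    proof (cases "b \<in> B")
      case True
      have "span (B - {b}) \<subseteq> span (C - {b})" using C(1) by (intro span_mono) auto
      then show ?thesis using True B(3) by blast
    next
      case False
      have "(f ^^ m) (f b) = 0" using that C(2) by (auto simp: funpow_Suc_right simp del: funpow.simps)
      then have "f b \<in> span B" using B(2) by auto
      moreover have "span B \<subseteq> span (C - {b})" using C(1) False by (intro span_mono) auto
      ultimately show ?thesis by blast
    qed
    moreover have "span C = {v. (f ^^ Suc m) v = 0}"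
      using C(2,4) span_minimal[OF C(2) sub] by blast
    ultimately show ?case using C(3) by blast
  qed
  then obtain B where B: "independent B" "span B = UNIV" "\<And>b. b \<in> B \<Longrightarrow> f b \<in> span (B - {b})"
    using top by metis
  have "representation B (f b) b = 0" if "b \<in> B" for b
  proof -
    have "representation B (f b) = representation (B - {b}) (f b)"
      using B that by (intro representation_extend) auto
    then show ?thesis using representation_ne_zero[of "B - {b}" "f b" b] by auto
  qed
  then have "trace_on B f = 0" by (simp add: trace_on_def)
  then show ?thesis using trace_on_eq_trace[OF B(1,2) lin] by simp
qed

end

section \<open>Generalised eigenspaces\<close>

locale complex_space = trace_space scale Basis
  for scale :: "complex \<Rightarrow> 'b::ab_group_add \<Rightarrow> 'b" and Basis :: "'b set"
begin

text \<open>
  A vector is \<open>primary T A\<close> if a product of factors \<open>T - a\<close> with \<open>a \<in> A\<close> kills it, that is, if it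
  lies in the sum of the generalised eigenspaces of \<open>T\<close> for the eigenvalues in \<open>A\<close>. In the inductive
  form, induction removes one factor at a time, and no exponents have to be tracked.
\<close>

inductive primary :: "('b \<Rightarrow> 'b) \<Rightarrow> complex set \<Rightarrow> 'b \<Rightarrow> bool" for T A where
  zero: "primary T A 0"
| factor: "a \<in> A \<Longrightarrow> primary T A (T v - scale a v) \<Longrightarrow> primary T A v"

abbreviation gen_eigen :: "('b \<Rightarrow> 'b) \<Rightarrow> complex \<Rightarrow> 'b \<Rightarrow> bool" where
  "gen_eigen T a \<equiv> primary T {a}"

lemma primary_mono: "primary T A v \<Longrightarrow> A \<subseteq> B \<Longrightarrow> primary T B v"
  by (induction rule: primary.induct) (auto intro: primary.intros)

lemma gen_eigenI: "gen_eigen T a (T v - scale a v) \<Longrightarrow> gen_eigen T a v"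
  by (rule primary.factor) auto

lemma nilpotent_at_iff: "(\<exists>k. (T ^^ k) v = 0) \<longleftrightarrow> gen_eigen T 0 v"
proof
  assume "\<exists>k. (T ^^ k) v = 0"
  then obtain k where "(T ^^ k) v = 0" ..
  then show "gen_eigen T 0 v"
  proof (induction k arbitrary: v)
    case 0
    then show ?case by (simp add: primary.zero)
  next
    case (Suc k)
    have "(T ^^ k) (T v) = 0" using Suc.prems by (simp only: funpow_Suc_right o_apply)
    from Suc.IH[OF this] show ?case by - (rule gen_eigenI, simp)
  qed
next
  assume "gen_eigen T 0 v"
  then show "\<exists>k. (T ^^ k) v = 0"
  proof (induction rule: primary.induct)
    case zero
    show ?case by (intro exI[of _ 0]) simp
  next
    case (factor a v)
    then obtain k where "(T ^^ k) (T v) = 0" by auto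
    then show ?case by (intro exI[of _ "Suc k"]) (simp only: funpow_Suc_right o_apply)
  qed
qed

context
  fixes T assumes T: "Vector_Spaces.linear scale scale T"
begin

interpretation T: Vector_Spaces.linear scale scale T by (rule T)

lemma primary_image:
  assumes "primary T A v"
  shows "primary T A (T v - scale b v)"
  using assms
proof (induction rule: primary.induct)
  case zero
  then show ?case by (simp add: T.zero primary.zero)
next
  case (factor a v)
  have "T (T v - scale b v) - scale a (T v - scale b v)
      = T (T v - scale a v) - scale b (T v - scale a v)"
    by (simp add: T.diff T.scale scale_right_diff_distrib mult.commute)
  with factor show ?case by (metis primary.factor)
qed

lemma primary_add:
  assumes "primary T A u" "primary T A v"
  shows "primary T A (u + v)"
  using assms
proof (induction arbitrary: v rule: primary.induct)
  case zero
  then show ?case by simp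
next
  case (factor a u)
  have "primary T A ((T u - scale a u) + (T v - scale a v))"
    using factor.IH primary_image[OF factor.prems] by blast
  moreover have "(T u - scale a u) + (T v - scale a v) = T (u + v) - scale a (u + v)"
    by (simp add: T.add scale_right_distrib)
  ultimately show ?case using factor.hyps(1) primary.factor by metis
qed

lemma primary_scale:
  assumes "primary T A v"
  shows "primary T A (scale c v)"
  using assms
proof (induction rule: primary.induct)
  case zero
  then show ?case by (simp add: primary.zero)
next
  case (factor a v)
  have "scale c (T v - scale a v) = T (scale c v) - scale a (scale c v)"
    by (simp add: T.scale scale_right_diff_distrib mult.commute)
  with factor show ?case by (metis primary.factor)
qed

lemma subspace_primary: "subspace {v. primary T A v}"
  by (intro subspaceI) (auto intro: primary.zero primary_add primary_scale)

lemma primary_eigenvector_zero: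
  assumes "primary T A v" "T v = scale b v" "b \<notin> A"
  shows "v = 0"
  using assms
proof (induction rule: primary.induct)
  case (factor a v)
  have eq: "T v - scale a v = scale (b - a) v"
    using factor.prems by (simp add: scale_left_diff_distrib)
  then have "T (T v - scale a v) = scale b (T v - scale a v)"
    using factor.prems by (simp add: T.scale mult.commute)
  then have "scale (b - a) v = 0" using factor.IH factor.prems eq by simp
  then show ?case using factor.hyps factor.prems by auto
qed auto

text \<open>
  Independence of generalised eigenspaces: removing one factor \<open>T - a\<close> leaves, by induction, an
  eigenvector for \<open>a\<close>, and \<open>a\<close> is not among the eigenvalues in \<open>B\<close>.
\<close>

lemma primary_disjoint_zero:
  assumes "primary T A v" "primary T B v" "A \<inter> B = {}"
  shows "v = 0"
  using assms
proof (induction rule: primary.induct)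
  case (factor a v)
  then have "T v - scale a v = 0" using primary_image by blast
  then have "T v = scale a v" by simp
  moreover have "a \<notin> B" using factor by blast
  ultimately show ?case using primary_eigenvector_zero factor.prems by blast
qed auto

text \<open>
  On the generalised eigenspace for \<open>b \<noteq> a\<close> the operator \<open>T - a\<close> is the invertible scalar \<open>b - a\<close>
  plus a nilpotent operator. The induction sums the geometric series for its inverse.
\<close>

lemma gen_eigen_preimage:
  assumes "gen_eigen T b w" "b \<noteq> a" "subspace W" "w \<in> W" "\<And>v. v \<in> W \<Longrightarrow> T v \<in> W"
  shows "\<exists>u\<in>W. gen_eigen T b u \<and> T u - scale a u = w"
  using assms
proof (induction rule: primary.induct)
  case zero
  then show ?case
    by (intro bexI[of _ 0]) (auto simp: T.zero intro: primary.zero subspace_0)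
next
  case (factor c w)
  then have c: "c = b" by simp
  have inW: "T w - scale c w \<in> W" using factor.prems by (intro subspace_diff subspace_scale) auto
  from factor.IH[OF factor.prems(1,2) inW factor.prems(4)] obtain u where
    u: "u \<in> W" "gen_eigen T b u" "T u - scale a u = T w - scale c w" by blast
  have w: "gen_eigen T b w" using factor.hyps primary.factor by blast
  let ?u = "scale (1 / (b - a)) (w - u)"
  have "T (w - u) - scale a (w - u) = scale (b - a) w"
    using u(3) by (simp add: T.diff scale_right_diff_distrib scale_left_diff_distrib c algebra_simps)
  then have "T ?u - scale a ?u = scale (1 / (b - a)) (scale (b - a) w)"
    by (metis T.scale scale_left_commute scale_right_diff_distrib)
  then have "T ?u - scale a ?u = w" using factor.prems(1) by simp
  moreover have "?u \<in> W" using u(1) factor.prems by (intro subspace_scale subspace_diff) auto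
  moreover have "gen_eigen T b ?u"
    using subspace_primary[of "{b}"] u(2) w by (intro primary_scale) (metis mem_Collect_eq subspace_diff)
  ultimately show ?case by blast
qed

text \<open>
  Horner's scheme, because splitting off a linear factor of the polynomial is then a computation
  with \<open>pCons\<close>.
\<close>

definition poly_act :: "complex poly \<Rightarrow> 'b \<Rightarrow> 'b" where
  "poly_act p v = fold_coeffs (\<lambda>c w. scale c v + T w) p 0"

lemma poly_act_0 [simp]: "poly_act 0 v = 0"
  by (simp add: poly_act_def)

lemma poly_act_pCons [simp]: "poly_act (pCons c p) v = scale c v + T (poly_act p v)"
  by (cases "p = 0 \<and> c = 0") (auto simp: poly_act_def T.zero)

lemma poly_act_add: "poly_act (p + q) v = poly_act p v + poly_act q v"
  by (induction p q rule: poly_induct2) (simp_all add: T.add scale_left_distrib)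

lemma poly_act_smult: "poly_act (Polynomial.smult c p) v = scale c (poly_act p v)"
  by (induction p) (simp_all add: T.scale scale_right_distrib)

lemma poly_act_linear_factor:
  "poly_act ([:- a, 1:] * q) v = T (poly_act q v) - scale a (poly_act q v)"
proof -
  have "[:- a, 1:] * q = Polynomial.smult (- a) q + pCons 0 q" by simp
  then show ?thesis by (simp only: poly_act_add poly_act_smult poly_act_pCons) simp
qed

lemma poly_act_in:
  assumes "subspace W" "\<And>v. v \<in> W \<Longrightarrow> T v \<in> W" "v \<in> W"
  shows "poly_act p v \<in> W"
  using assms by (induction p) (auto intro!: subspace_add subspace_scale subspace_0)

lemma poly_act_monom: "poly_act (monom 1 k) v = (T ^^ k) v"
  by (induction k) (simp_all add: monom_Suc monom_0 T.zero one_pCons)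

text \<open>
  Some iterate \<open>T\<^sup>k v\<close> is a combination of the earlier ones, since otherwise the iterates would be
  linearly independent.
\<close>

lemma annihilating_polynomial: "\<exists>p. p \<noteq> 0 \<and> poly_act p v = 0"
proof -
  let ?K = "\<lambda>k. (\<lambda>i. (T ^^ i) v) ` {..<k}"
  have "\<exists>k. (T ^^ k) v \<in> span (?K k)"
  proof (rule ccontr)
    assume nex: "\<nexists>k. (T ^^ k) v \<in> span (?K k)"
    have no: "(T ^^ k) v \<notin> span (?K k)" for k
    proof
      assume "(T ^^ k) v \<in> span (?K k)"
      then have "\<exists>k. (T ^^ k) v \<in> span (?K k)" by (rule exI)
      with nex show False by (rule notE)
    qed
    have "independent (?K k) \<and> card (?K k) = k" for k
    proof (induction k)
      case 0
      then show ?case by (simp add: independent_empty)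
    next
      case (Suc k)
      have "(T ^^ k) v \<notin> ?K k" using no[of k] span_superset[of "?K k"] by (rule contra_subsetD[rotated])
      moreover note no[of k]
      moreover have "?K (Suc k) = insert ((T ^^ k) v) (?K k)" by (simp add: lessThan_Suc)
      ultimately show ?case using Suc.IH by (simp add: independent_insertI)
    qed
    then have "Suc (dim UNIV) \<le> dim (UNIV :: 'b set)"
      using independent_card_le_dim[OF subset_UNIV] by metis
    then show False by simp
  qed
  then obtain k where k: "(T ^^ k) v \<in> span (?K k)" ..
  have "\<exists>q. (\<forall>i\<ge>k. coeff q i = 0) \<and> poly_act q v = x" if "x \<in> span (?K k)" for x
    using that
  proof (induction rule: span_induct_alt)
    case base
    show ?case by (intro exI[of _ 0]) simp
  next
    case (step c x y)
    then obtain i q where "i < k" "x = (T ^^ i) v" "\<forall>i\<ge>k. coeff q i = 0" "poly_act q v = y"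
      by auto
    then show ?case
      by (intro exI[of _ "Polynomial.smult c (monom 1 i) + q"]) (auto simp: poly_act_add poly_act_smult poly_act_monom)
  qed
  then obtain q where q: "\<forall>i\<ge>k. coeff q i = 0" "poly_act q v = (T ^^ k) v" using k by blast
  let ?p = "monom 1 k + Polynomial.smult (-1) q"
  have "coeff ?p k = 1" using q(1) by simp
  then have "?p \<noteq> 0" by force
  moreover have "poly_act ?p v = 0"
    unfolding poly_act_add poly_act_smult poly_act_monom q(2) by simp
  ultimately show ?thesis by blast
qed

text \<open>
  The span \<open>?E\<close> of the generalised eigenvectors absorbs preimages under \<open>T - a\<close>, because each of its
  elements is \<open>(T - a) u\<close> with \<open>u\<close> in the span, up to a generalised eigenvector for \<open>a\<close>. Removing
  the linear factors of an annihilating polynomial one after the other therefore puts every vector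
  of \<open>W\<close> into the span. The invariant subspace \<open>W\<close> will be the complexification of an ideal.
\<close>

lemma generated_by_gen_eigen:
  assumes W: "subspace W" and inv: "\<And>v. v \<in> W \<Longrightarrow> T v \<in> W" and "v \<in> W"
  shows "v \<in> span {w \<in> W. \<exists>a. gen_eigen T a w}" (is "v \<in> ?E")
proof -
  have EW: "?E \<subseteq> W" using W by (intro span_minimal) auto
  have split: "\<exists>u w. u \<in> ?E \<and> w \<in> W \<and> gen_eigen T a w \<and> e = (T u - scale a u) + w"
    if "e \<in> ?E" for e a
    using that
  proof (induction rule: span_induct_alt)
    case base
    show ?case
      by (intro exI[of _ 0]) (auto simp: T.zero intro: primary.zero span_zero subspace_0[OF W])
  next
    case (step c x y)
    then obtain u w b where uw: "u \<in> ?E" "w \<in> W" "gen_eigen T a w" "y = (T u - scale a u) + w"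
      and x: "x \<in> W" "gen_eigen T b x" by auto
    show ?case
    proof (cases "a = b")
      case True
      have "scale c x + w \<in> W" using uw x W by (intro subspace_add subspace_scale)
      moreover have "gen_eigen T a (scale c x + w)" using uw x True by (auto intro: primary_add primary_scale)
      moreover have "scale c x + y = (T u - scale a u) + (scale c x + w)" using uw(4) by simp
      ultimately show ?thesis using uw(1) by blast
    next
      case False
      then obtain x' where x': "x' \<in> W" "gen_eigen T b x'" "T x' - scale a x' = x"
        using gen_eigen_preimage[OF x(2) _ W x(1) inv] by metis
      have "x' \<in> ?E" using x' by (intro span_base) auto
      then have "scale c x' + u \<in> ?E" using uw(1) by (intro span_add span_scale)
      moreover have "scale c x + y = (T (scale c x' + u) - scale a (scale c x' + u)) + w"
        unfolding uw(4) x'(3)[symmetric]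
        by (simp add: T.add T.scale scale_right_distrib scale_right_diff_distrib mult.commute)
      ultimately show ?thesis using uw by blast
    qed
  qed
  have step: "v \<in> ?E" if v: "v \<in> W" "T v - scale a v \<in> ?E" for a v
  proof -
    obtain u w where u: "u \<in> ?E" "w \<in> W" "gen_eigen T a w"
      "T v - scale a v = (T u - scale a u) + w" using split[OF v(2)] by blast
    then have "T (v - u) - scale a (v - u) = w" by (simp add: T.diff scale_right_diff_distrib algebra_simps)
    then have "gen_eigen T a (v - u)" using u(3) by - (rule gen_eigenI, simp)
    moreover have "v - u \<in> W" using v(1) u(1) EW W by (intro subspace_diff) auto
    ultimately have "v - u \<in> ?E" by (intro span_base) auto
    then have "(v - u) + u \<in> ?E" using u(1) by (rule span_add)
    then show ?thesis by simp
  qed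
  have "v \<in> ?E" if "p \<noteq> 0" "poly_act p v \<in> ?E" "v \<in> W" for p v
    using that
  proof (induction "degree p" arbitrary: p rule: less_induct)
    case less
    show ?case
    proof (cases "degree p = 0")
      case True
      then obtain c where c: "p = [:c:]" by (metis degree_eq_zeroE)
      with less have "c \<noteq> 0" "scale c v \<in> ?E" by (auto simp: T.zero)
      then have "scale (1 / c) (scale c v) \<in> ?E" by - (rule span_scale)
      then show ?thesis using \<open>c \<noteq> 0\<close> by simp
    next
      case False
      then obtain a where "poly p a = 0"
        using fundamental_theorem_of_algebra constant_degree by metis
      then obtain q where q: "p = [:- a, 1:] * q" by (metis poly_eq_0_iff_dvd dvdE)
      have "q \<noteq> 0" using q less.prems(1) by auto
      have "degree p = Suc (degree q)" unfolding q using \<open>q \<noteq> 0\<close> by (subst degree_mult_eq) auto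
      have "T (poly_act q v) - scale a (poly_act q v) \<in> ?E"
        using less.prems(2) unfolding q poly_act_linear_factor .
      moreover have "poly_act q v \<in> W" using inv less.prems(3) by (intro poly_act_in[OF W])
      ultimately have "poly_act q v \<in> ?E" by (rule step[rotated])
      then show ?thesis using less \<open>q \<noteq> 0\<close> \<open>degree p = _\<close> by auto
    qed
  qed
  then show ?thesis using annihilating_polynomial[of v] assms(3) span_zero[of "{w \<in> W. \<exists>a. gen_eigen T a w}"] by auto
qed

end

text \<open>
  The operator \<open>\<delta>\<close> is diagonal in a basis of generalised eigenvectors, with conjugate eigenvalues.
  Since \<open>T\<close> differs from its semi-simple part \<open>S\<close> by a nilpotent operator, which commutes with \<open>\<delta>\<close>, the
  trace of \<open>T \<circ> \<delta>\<close> is that of \<open>S \<circ> \<delta>\<close>, the sum of the \<open>\<bar>\<lambda>\<bar>\<^sup>2\<close> over the eigenvalues \<open>\<lambda>\<close>. It vanishes only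
  if all eigenvalues do.
\<close>

lemma conj_semisimple_part:
  assumes T: "Vector_Spaces.linear scale scale T"
  obtains \<delta> where "Vector_Spaces.linear scale scale \<delta>"
    and "\<And>a v. gen_eigen T a v \<Longrightarrow> \<delta> v = scale (cnj a) v"
    and "trace (\<lambda>v. T (\<delta> v)) = 0 \<Longrightarrow> \<forall>v. \<exists>k. (T ^^ k) v = 0"
proof -
  interpret T: Vector_Spaces.linear scale scale T by (rule T)
  interpret vs: vector_space_pair scale scale by unfold_locales
  define G where "G = {v. \<exists>a. gen_eigen T a v}"
  have "span G = UNIV"
    using generated_by_gen_eigen[OF T subspace_UNIV] by (auto simp: G_def)
  moreover obtain B where B: "B \<subseteq> G" "independent B" "G \<subseteq> span B"
    using maximal_independent_subset by metis
  ultimately have spanB: "span B = UNIV" using span_minimal[OF B(3) subspace_span] by auto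
  have finB: "finite B" using B(2) by (rule finiteI_independent)
  have "\<forall>b\<in>B. \<exists>a. gen_eigen T a b" using B(1) by (auto simp: G_def)
  from bchoice[OF this] obtain ev where ev: "\<And>b. b \<in> B \<Longrightarrow> gen_eigen T (ev b) b" by auto
  define D where "D \<phi> = vs.construct B (\<lambda>b. scale (\<phi> (ev b)) b)" for \<phi> :: "complex \<Rightarrow> complex"
  have Dlin: "Vector_Spaces.linear scale scale (D \<phi>)" for \<phi>
    unfolding D_def by (rule vs.linear_construct[OF B(2)])
  have Db: "D \<phi> b = scale (\<phi> (ev b)) b" if "b \<in> B" for b \<phi>
    unfolding D_def using vs.construct_basis[OF B(2) that] .
  have Dv: "D \<phi> v = scale (\<phi> a) v" if v: "gen_eigen T a v" for a v \<phi>
  proof -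
    interpret D: Vector_Spaces.linear scale scale "D \<phi>" by (rule Dlin)
    let ?B1 = "{b \<in> B. ev b = a}" and ?B2 = "{b \<in> B. ev b \<noteq> a}"
    have "B = ?B1 \<union> ?B2" by auto
    then have "v \<in> span (?B1 \<union> ?B2)" using spanB by auto
    then obtain x y where xy: "v = x + y" "x \<in> span ?B1" "y \<in> span ?B2"
      unfolding span_Un by auto
    have "span ?B1 \<subseteq> {v. gen_eigen T a v}"
      using ev by (intro span_minimal subspace_primary T) auto
    then have "gen_eigen T a x" using xy by auto
    moreover have "y = v + scale (-1) x" using xy by simp
    ultimately have "gen_eigen T a y" by (simp only: primary_add[OF T v primary_scale[OF T]])
    moreover have "span ?B2 \<subseteq> {v. primary T (- {a}) v}"
      using ev by (intro span_minimal subspace_primary T) (auto intro: primary_mono)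
    then have "primary T (- {a}) y" using xy by auto
    ultimately have "y = 0" using primary_disjoint_zero[OF T] by blast
    then have "v \<in> span ?B1" using xy by simp
    moreover have "subspace {v. D \<phi> v = scale (\<phi> a) v}"
      by (intro subspaceI) (auto simp: D.zero D.add D.scale scale_right_distrib mult.commute)
    then have "span ?B1 \<subseteq> {v. D \<phi> v = scale (\<phi> a) v}" using Db by (intro span_minimal) auto
    ultimately show ?thesis by auto
  qed
  let ?\<delta> = "D cnj" and ?S = "D (\<lambda>a. a)"
  let ?N = "\<lambda>v. T (?\<delta> v) - ?S (?\<delta> v)"
  interpret \<delta>: Vector_Spaces.linear scale scale ?\<delta> by (rule Dlin)
  interpret S: Vector_Spaces.linear scale scale ?S by (rule Dlin)
  have T\<delta>: "Vector_Spaces.linear scale scale (\<lambda>v. T (?\<delta> v))"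
    using Vector_Spaces.linear_compose[OF Dlin T] by (simp add: o_def)
  have S\<delta>: "Vector_Spaces.linear scale scale (\<lambda>v. ?S (?\<delta> v))"
    using Vector_Spaces.linear_compose[OF Dlin Dlin] by (simp add: o_def)
  have Nlin: "Vector_Spaces.linear scale scale ?N"
    by (rule vs.linear_compose_sub[OF T\<delta> S\<delta>])
  have N: "?N v = scale (cnj a) (T v - scale a v)" if "gen_eigen T a v" for a v
    unfolding Dv[OF that] S.scale T.scale by (simp add: Dv[OF that] scale_right_diff_distrib)
  have nilN: "gen_eigen ?N 0 v" if "gen_eigen T a v" for a v
    using that
  proof (induction rule: primary.induct)
    case (factor c v)
    then have "gen_eigen ?N 0 (scale (cnj a) (T v - scale a v))"
      using primary_scale[OF Nlin] by blast
    moreover have "gen_eigen T a v" using factor.hyps primary.factor by blast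
    ultimately show ?case using N by - (rule gen_eigenI, simp)
  qed (rule primary.zero)
  have "span G \<subseteq> {v. gen_eigen ?N 0 v}"
    using nilN by (intro span_minimal subspace_primary Nlin) (auto simp: G_def)
  then have "trace ?N = 0"
    using \<open>span G = UNIV\<close> by (intro trace_nilpotent[OF Nlin]) (auto simp: nilpotent_at_iff)
  then have tr: "trace (\<lambda>v. T (?\<delta> v)) = trace (\<lambda>v. ?S (?\<delta> v))" by (simp add: trace_diff)
  have "trace (\<lambda>v. ?S (?\<delta> v)) = trace_on B (\<lambda>v. ?S (?\<delta> v))"
    by (rule trace_on_eq_trace[OF B(2) spanB S\<delta>, symmetric])
  also have "\<dots> = (\<Sum>b\<in>B. of_real ((cmod (ev b))\<^sup>2))"
    unfolding trace_on_def
  proof (intro sum.cong refl)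
    fix b assume b: "b \<in> B"
    have "?S (?\<delta> b) = scale (cnj (ev b) * ev b) b" using b by (simp add: Db S.scale)
    then show "representation B (?S (?\<delta> b)) b = of_real ((cmod (ev b))\<^sup>2)"
      using b B(2) complex_norm_square[of "ev b"]
      by (simp add: representation_scale span_base representation_basis mult.commute)
  qed
  finally have tr: "trace (\<lambda>v. T (?\<delta> v)) = of_real (\<Sum>b\<in>B. (cmod (ev b))\<^sup>2)" using tr by simp
  have "\<exists>k. (T ^^ k) v = 0" if "trace (\<lambda>v. T (?\<delta> v)) = 0" for v
  proof -
    have "(\<Sum>b\<in>B. (cmod (ev b))\<^sup>2) = 0" using that tr by (metis of_real_eq_0_iff)
    then have "ev b = 0" if "b \<in> B" for b using that finB by (simp add: sum_nonneg_eq_0_iff)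
    then have "span B \<subseteq> {v. gen_eigen T 0 v}"
      using ev by (intro span_minimal subspace_primary T) force
    then show ?thesis using spanB nilpotent_at_iff by auto
  qed
  then show thesis using that[of ?\<delta>] Dlin Dv by blast
qed

text \<open>
  The Leibniz rule for \<open>T\<close> gives
  \<open>(T - a - b) [u, v] = [(T - a) u, v] + [u, (T - b) v]\<close>, and both terms are covered by induction.
\<close>

lemma gen_eigen_bracket:
  assumes T: "Vector_Spaces.linear scale scale T"
    and right: "\<And>x. Vector_Spaces.linear scale scale (\<lambda>y. br x y)"
    and left: "\<And>y. Vector_Spaces.linear scale scale (\<lambda>x. br x y)"
    and deriv: "\<And>x y. T (br x y) = br (T x) y + br x (T y)"
    and "gen_eigen T a u" "gen_eigen T b v"
  shows "gen_eigen T (a + b) (br u v)"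
proof -
  interpret T: Vector_Spaces.linear scale scale T by (rule T)
  interpret r: Vector_Spaces.linear scale scale "\<lambda>y. br x y" for x by (rule right)
  interpret l: Vector_Spaces.linear scale scale "\<lambda>x. br x y" for y by (rule left)
  have eq: "T (br u v) - scale (a + b) (br u v)
      = br (T u - scale a u) v + br u (T v - scale b v)" for u v
    by (simp add: deriv r.diff l.diff r.scale l.scale scale_left_distrib)
  show ?thesis
    using assms(5,6)
  proof (induction arbitrary: v rule: primary.induct)
    case zero
    then show ?case by (simp add: l.zero primary.zero)
  next
    case (factor c u)
    show ?case
      using factor.prems
    proof (induction rule: primary.induct)
      case zero
      then show ?case by (simp add: r.zero primary.zero)
    next
      case (factor d v)
      have "gen_eigen T b v" using factor.hyps primary.factor by blast
      then have "gen_eigen T (a + b) (br (T u - scale a u) v)"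
        using \<open>\<And>v. gen_eigen T b v \<Longrightarrow> gen_eigen T (a + b) (br (T u - scale c u) v)\<close> \<open>c \<in> {a}\<close>
        by simp
      then have "gen_eigen T (a + b) (br (T u - scale a u) v + br u (T v - scale b v))"
        using factor by (intro primary_add[OF T]) auto
      then show ?case using eq by - (rule gen_eigenI, simp)
    qed
  qed
qed

text \<open>
  Complex conjugation is additive, so an operator that multiplies each generalised eigenspace of a
  derivation by the conjugate of the eigenvalue is again a derivation.
\<close>

lemma conj_semisimple_part_derivation:
  assumes T: "Vector_Spaces.linear scale scale T"
    and right: "\<And>x. Vector_Spaces.linear scale scale (\<lambda>y. br x y)"
    and left: "\<And>y. Vector_Spaces.linear scale scale (\<lambda>x. br x y)"
    and deriv: "\<And>x y. T (br x y) = br (T x) y + br x (T y)"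
    and \<delta>: "Vector_Spaces.linear scale scale \<delta>"
    and eig: "\<And>a v. gen_eigen T a v \<Longrightarrow> \<delta> v = scale (cnj a) v"
  shows "\<delta> (br x y) = br (\<delta> x) y + br x (\<delta> y)"
proof -
  interpret \<delta>: Vector_Spaces.linear scale scale \<delta> by (rule \<delta>)
  interpret r: Vector_Spaces.linear scale scale "\<lambda>y. br x y" for x by (rule right)
  interpret l: Vector_Spaces.linear scale scale "\<lambda>x. br x y" for y by (rule left)
  let ?G = "{v. \<exists>a. gen_eigen T a v}"
  have G: "v \<in> span ?G" for v
    using generated_by_gen_eigen[OF T subspace_UNIV, of v] by simp
  have 1: "\<delta> (br x y) = br (\<delta> x) y + br x (\<delta> y)" if x: "gen_eigen T a x" for a x y
    using G[of y]
  proof (induction rule: span_induct_alt)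
    case base
    then show ?case by (simp add: \<delta>.zero r.zero)
  next
    case (step c u y)
    then obtain b where u: "gen_eigen T b u" by blast
    have "\<delta> (br x u) = br (\<delta> x) u + br x (\<delta> u)"
      using eig[OF gen_eigen_bracket[OF T right left deriv x u]] eig[OF x] eig[OF u]
      by (simp add: r.scale l.scale scale_left_distrib)
    then show ?case
      using step.IH by (simp add: r.add r.scale \<delta>.add \<delta>.scale scale_right_distrib)
  qed
  have "\<delta> (br x y) = br (\<delta> x) y + br x (\<delta> y)" if "x \<in> span ?G" for x y
    using that
  proof (induction rule: span_induct_alt)
    case base
    show ?case by (simp add: \<delta>.zero l.zero)
  next
    case (step c u x)
    then obtain b where "gen_eigen T b u" by blast
    then have "\<delta> (br u y) = br (\<delta> u) y + br u (\<delta> y)" by (rule 1)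
    then show ?case
      using step.IH by (simp add: l.add l.scale \<delta>.add \<delta>.scale scale_right_distrib)
  qed
  then show ?thesis using G .
qed

text \<open>
  A generalised eigenvector in \<open>W\<close> for a non-zero eigenvalue lies in \<open>T W\<close>, and \<open>\<delta>\<close> kills those for
  the eigenvalue zero.
\<close>

lemma conj_semisimple_part_image:
  assumes T: "Vector_Spaces.linear scale scale T"
    and \<delta>: "Vector_Spaces.linear scale scale \<delta>"
    and eig: "\<And>a v. gen_eigen T a v \<Longrightarrow> \<delta> v = scale (cnj a) v"
    and W: "subspace W" and U: "subspace U" "U \<subseteq> W" and TW: "\<And>v. v \<in> W \<Longrightarrow> T v \<in> U"
    and "v \<in> W"
  shows "\<delta> v \<in> U"
proof -
  interpret T: Vector_Spaces.linear scale scale T by (rule T)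
  interpret \<delta>: Vector_Spaces.linear scale scale \<delta> by (rule \<delta>)
  have inv: "\<And>v. v \<in> W \<Longrightarrow> T v \<in> W" using TW U by blast
  have "subspace {v. \<delta> v \<in> U}"
    using U(1) by (intro subspaceI) (auto simp: \<delta>.zero \<delta>.add \<delta>.scale subspace_0 subspace_add subspace_scale)
  moreover have "{w \<in> W. \<exists>a. gen_eigen T a w} \<subseteq> {v. \<delta> v \<in> U}"
  proof safe
    fix w a assume w: "w \<in> W" "gen_eigen T a w"
    show "\<delta> w \<in> U"
    proof (cases "a = 0")
      case True
      then show ?thesis using eig[OF w(2)] U(1) by (simp add: subspace_0)
    next
      case False
      then obtain u where "u \<in> W" "T u = w" using gen_eigen_preimage[OF T w(2) _ W w(1) inv, of 0] by auto
      then show ?thesis using eig[OF w(2)] TW U(1) by (auto intro: subspace_scale)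
    qed
  qed
  ultimately show ?thesis
    using span_minimal generated_by_gen_eigen[OF T W inv \<open>v \<in> W\<close>] by blast
qed

end

section \<open>Real Lie algebras and their complexification\<close>

locale real_space =
  fixes E :: "'g::real_vector set"
  assumes finite_E: "finite E" and independent_E: "independent E" and span_E: "span E = UNIV"

sublocale real_space \<subseteq> fd: trace_space "scaleR :: real \<Rightarrow> 'g \<Rightarrow> 'g" E
  rewrites "module.dependent (*\<^sub>R) = dependent"
    and "module.representation (*\<^sub>R) = representation"
    and "module.subspace (*\<^sub>R) = subspace"
    and "module.span (*\<^sub>R) = span"
    and "vector_space.extend_basis (*\<^sub>R) = extend_basis"
    and "vector_space.dim (*\<^sub>R) = dim"
    and "Vector_Spaces.linear (*\<^sub>R) (*\<^sub>R) = linear"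
    and "Vector_Spaces.linear (*) (*\<^sub>R) = linear"
proof -
  show "trace_space ((*\<^sub>R) :: real \<Rightarrow> 'g \<Rightarrow> 'g) E"
    using finite_E independent_E span_E unfolding dependent_raw_def span_raw_def
    by unfold_locales auto
qed (auto simp add: dependent_raw_def representation_raw_def
      subspace_raw_def span_raw_def extend_basis_raw_def dim_raw_def linear_def
      real_scaleR_def[abs_def])

text \<open>The complexification of \<open>'g\<close> consists of the pairs \<open>(u, w)\<close>, read as \<open>u + \<i>w\<close>.\<close>

definition complex_scale :: "complex \<Rightarrow> 'g::real_vector \<times> 'g \<Rightarrow> 'g \<times> 'g" where
  "complex_scale c v = (Re c *\<^sub>R fst v - Im c *\<^sub>R snd v, Re c *\<^sub>R snd v + Im c *\<^sub>R fst v)"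

context real_space
begin

abbreviation complex_basis :: "('g \<times> 'g) set" where
  "complex_basis \<equiv> (\<lambda>b. (b, 0)) ` E"

lemma sum_complex_basis:
  "(\<Sum>\<beta>\<in>complex_basis. complex_scale (c \<beta>) \<beta>)
     = (\<Sum>b\<in>E. Re (c (b, 0)) *\<^sub>R b, \<Sum>b\<in>E. Im (c (b, 0)) *\<^sub>R b)"
  by (subst sum.reindex) (auto simp: inj_on_def complex_scale_def prod_eq_iff fst_sum snd_sum)

end

sublocale real_space \<subseteq> C: complex_space "complex_scale :: complex \<Rightarrow> 'g \<times> 'g \<Rightarrow> 'g \<times> 'g" complex_basis
proof -
  interpret cv: vector_space "complex_scale :: complex \<Rightarrow> 'g \<times> 'g \<Rightarrow> 'g \<times> 'g"
    by unfold_locales (auto simp: complex_scale_def algebra_simps)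
  show "complex_space (complex_scale :: complex \<Rightarrow> 'g \<times> 'g \<Rightarrow> 'g \<times> 'g) complex_basis"
  proof unfold_locales
    show "finite complex_basis" using finite_E by simp
    show "cv.independent complex_basis"
    proof (rule cv.independent_if_scalars_zero)
      show "finite complex_basis" using finite_E by simp
      fix c \<beta> assume c: "(\<Sum>\<beta>\<in>complex_basis. complex_scale (c \<beta>) \<beta>) = 0" and "\<beta> \<in> complex_basis"
      then obtain b where b: "b \<in> E" "\<beta> = (b, 0)" by auto
      have "(\<Sum>b\<in>E. Re (c (b, 0)) *\<^sub>R b) = 0" "(\<Sum>b\<in>E. Im (c (b, 0)) *\<^sub>R b) = 0"
        using c unfolding sum_complex_basis by (auto simp: prod_eq_iff)
      then have "Re (c (b, 0)) = 0" "Im (c (b, 0)) = 0"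
        using real_vector.independentD[OF independent_E finite_E subset_refl _ b(1), of "\<lambda>b. Re (c (b, 0))"]
          real_vector.independentD[OF independent_E finite_E subset_refl _ b(1), of "\<lambda>b. Im (c (b, 0))"]
        by auto
      then show "c \<beta> = 0" using b(2) by (simp add: complex_eq_iff)
    qed
    have "v \<in> cv.span complex_basis" for v :: "'g \<times> 'g"
    proof -
      let ?c = "\<lambda>\<beta>. Complex (representation E (fst v) (fst \<beta>)) (representation E (snd v) (fst \<beta>))"
      have "v = (\<Sum>\<beta>\<in>complex_basis. complex_scale (?c \<beta>) \<beta>)"
        unfolding sum_complex_basis
        by (simp add: prod_eq_iff fd.expand_in_basis independent_E span_E)
      then show ?thesis by (metis (no_types, lifting) cv.span_base cv.span_scale cv.span_sum)
    qed
    then show "cv.span complex_basis = UNIV" by auto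
  qed
qed

definition complexify :: "('g \<Rightarrow> 'g) \<Rightarrow> 'g \<times> 'g \<Rightarrow> 'g::real_vector \<times> 'g" where
  "complexify f v = (f (fst v), f (snd v))"

context real_space
begin

lemma linear_complexify:
  fixes f :: "'g \<Rightarrow> 'g"
  assumes "linear f"
  shows "Vector_Spaces.linear complex_scale complex_scale (complexify f)"
proof -
  interpret f: linear f by fact
  show ?thesis
    using C.vector_space_axioms unfolding Vector_Spaces.linear_iff
    by (auto simp: complexify_def complex_scale_def f.add f.diff f.scaleR)
qed

lemma trace_complexify:
  assumes "linear f"
  shows "C.trace (complexify f) = of_real (fd.trace f)"
proof -
  have rep: "C.representation complex_basis (u, 0) (b, 0) = of_real (representation E u b)"
    if "b \<in> E" for u b
  proof -
    have "(u, 0) = (\<Sum>\<beta>\<in>complex_basis. complex_scale (of_real (representation E u (fst \<beta>))) \<beta>)"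
      unfolding sum_complex_basis by (simp add: fd.expand_in_basis independent_E span_E)
    then have "C.representation complex_basis (u, 0) (b, 0) = C.representation complex_basis
        (\<Sum>\<beta>\<in>complex_basis. complex_scale (of_real (representation E u (fst \<beta>))) \<beta>) (b, 0)"
      by simp
    also have "\<dots> = (\<Sum>\<beta>\<in>complex_basis. of_real (representation E u (fst \<beta>)) * (if (b, 0) = \<beta> then 1 else 0))"
      by (simp add: C.representation_sum C.representation_scale C.independent_Basis C.span_Basis
          C.representation_basis del: sum.reindex)
    also have "\<dots> = of_real (representation E u b)"
      using that finite_E by (subst sum.reindex) (auto simp: inj_on_def if_distrib cong: if_cong)
    finally show ?thesis .
  qed
  show ?thesis
    unfolding C.trace_on_def fd.trace_on_def
    by (subst sum.reindex) (auto simp: inj_on_def complexify_def rep linear_0[OF assms])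
qed

end

lemma lie_prod_mono: "X \<subseteq> X' \<Longrightarrow> Y \<subseteq> Y' \<Longrightarrow> lie_prod br X Y \<subseteq> lie_prod br X' Y'"
  unfolding lie_prod_def by (intro span_mono) blast

lemma subspace_lie_prod: "subspace (lie_prod br X Y)"
  unfolding lie_prod_def by (rule subspace_span)

lemma lie_prod_base: "x \<in> X \<Longrightarrow> y \<in> Y \<Longrightarrow> br x y \<in> lie_prod br X Y"
  unfolding lie_prod_def by (intro span_base) blast

lemma lie_prod_subsetI:
  "subspace W \<Longrightarrow> (\<And>x y. x \<in> X \<Longrightarrow> y \<in> Y \<Longrightarrow> br x y \<in> W) \<Longrightarrow> lie_prod br X Y \<subseteq> W"
  unfolding lie_prod_def by (intro span_minimal) auto

locale lie_algebra = real_space E for E :: "'g::real_vector set" +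
  fixes br :: "'g \<Rightarrow> 'g \<Rightarrow> 'g"
  assumes lie: "lie_bracket br"
begin

lemma bilinear_br: "bilinear br"
  using lie by (simp add: lie_bracket_def)

lemma linear_br_right: "linear (br x)" and linear_br_left: "linear (\<lambda>x. br x y)"
  using bilinear_br by (auto simp: bilinear_def)

lemmas br_simps = bilinear_ladd[OF bilinear_br] bilinear_radd[OF bilinear_br]
  bilinear_lsub[OF bilinear_br] bilinear_rsub[OF bilinear_br]
  bilinear_lmul[OF bilinear_br] bilinear_rmul[OF bilinear_br]
  bilinear_lneg[OF bilinear_br] bilinear_rneg[OF bilinear_br]
  bilinear_lzero[OF bilinear_br] bilinear_rzero[OF bilinear_br]

lemma br_self: "br x x = 0"
  using lie by (simp add: lie_bracket_def)

lemma br_antisym: "br x y = - br y x"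
proof -
  have "br (x + y) (x + y) = (br x x + br y y) + (br x y + br y x)" by (simp only: br_simps add_ac)
  then show ?thesis unfolding br_self by (simp add: eq_neg_iff_add_eq_0)
qed

lemma br_derivation: "br x (br y z) = br (br x y) z + br y (br x z)"
proof -
  have "br x (br y z) + br y (br z x) + br z (br x y) = 0"
    using lie by (simp add: lie_bracket_def)
  moreover have "br z (br x y) = - br (br x y) z" "br z x = - br x z" by (rule br_antisym)+
  ultimately show ?thesis by (simp add: br_simps algebra_simps)
qed

lemma br_br: "br (br x y) z = br x (br y z) - br y (br x z)"
  by (simp add: br_derivation[of x y z])

lemma ideal_subspace: "lie_ideal br J \<Longrightarrow> subspace J"
  by (simp add: lie_ideal_in_def)

lemma ideal_right: "lie_ideal br J \<Longrightarrow> y \<in> J \<Longrightarrow> br x y \<in> J"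
  by (simp add: lie_ideal_in_def)

lemma ideal_left: "lie_ideal br J \<Longrightarrow> y \<in> J \<Longrightarrow> br y x \<in> J"
  using br_antisym[of y x] ideal_right[of J y x] subspace_neg[OF ideal_subspace] by metis

lemma idealI: "subspace J \<Longrightarrow> (\<And>x y. y \<in> J \<Longrightarrow> br x y \<in> J) \<Longrightarrow> lie_ideal br J"
  by (simp add: lie_ideal_in_def)

lemma ideal_lie_prod:
  assumes "lie_ideal br I" "lie_ideal br J"
  shows "lie_ideal br (lie_prod br I J)"
proof (rule idealI[OF subspace_lie_prod])
  fix x y assume "y \<in> lie_prod br I J"
  then show "br x y \<in> lie_prod br I J"
    unfolding lie_prod_def
  proof (induction rule: span_induct_alt)
    case base
    then show ?case by (simp add: br_simps span_zero)
  next
    case (step c u y)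
    then obtain a b where ab: "u = br a b" "a \<in> I" "b \<in> J" by blast
    have "br x u \<in> lie_prod br I J"
      unfolding ab(1) br_derivation[of x a b]
      using assms ab by (intro subspace_add subspace_lie_prod lie_prod_base ideal_right)
    then show ?case using step.IH unfolding lie_prod_def by (simp add: br_simps span_add span_scale)
  qed
qed

lemma ideal_lie_power: "lie_ideal br U \<Longrightarrow> lie_ideal br ((lie_prod br U ^^ n) UNIV)"
  by (induction n) (auto intro: ideal_lie_prod idealI)

subsection \<open>The Killing form\<close>

definition killing :: "'g \<Rightarrow> 'g \<Rightarrow> real" where
  "killing x y = fd.trace (\<lambda>v. br x (br y v))"

lemma linear_ad_ad: "linear (\<lambda>v. br x (br y v))"
  using linear_compose[OF linear_br_right linear_br_right] by (simp add: o_def)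

lemma killing_commute: "killing x y = killing y x"
  unfolding killing_def by (rule fd.trace_comp_commute[OF linear_br_right linear_br_right])

lemma killing_add: "killing (x + y) z = killing x z + killing y z"
  unfolding killing_def by (simp add: br_simps fd.trace_add)

lemma killing_scale: "killing (c *\<^sub>R x) z = c * killing x z"
  unfolding killing_def by (simp add: br_simps fd.trace_scale)

lemma bilinear_killing: "bilinear killing"
proof -
  have "linear (\<lambda>x. killing x z)" for z
    by (intro linearI) (simp_all add: killing_add killing_scale)
  moreover from this have "linear (killing z)" for z
    using killing_commute[of z] by presburger
  ultimately show ?thesis by (simp add: bilinear_def)
qed

lemma killing_invariant: "killing (br x y) z = killing x (br y z)"
proof -
  let ?t = "\<lambda>x y z. fd.trace (\<lambda>v. br x (br y (br z v)))"
  have "killing (br x y) z = ?t x y z - ?t y x z"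
    unfolding killing_def by (simp add: br_br fd.trace_diff)
  moreover have "killing x (br y z) = ?t x y z - ?t x z y"
    unfolding killing_def by (simp add: br_br br_simps fd.trace_diff)
  moreover have "?t y x z = ?t x z y"
    by (rule fd.trace_comp_commute[OF linear_br_right linear_ad_ad])
  ultimately show ?thesis by simp
qed

text \<open>
  The terms of the series \<open>[U, [U, \<dots>]]\<close> are ideals, so \<open>ad z\<close> preserves each of them, while
  \<open>ad u\<close> moves each into the next. Hence \<open>ad u \<circ> ad z\<close> is nilpotent.
\<close>

lemma killing_nilpotent_ideal:
  assumes U: "lie_ideal br U" and nil: "(lie_prod br U ^^ n) UNIV = {0}" and "u \<in> U"
  shows "killing u z = 0"
proof -
  let ?N = "\<lambda>v. br u (br z v)"
  have "(?N ^^ i) v \<in> (lie_prod br U ^^ i) UNIV" for i v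
  proof (induction i)
    case (Suc i)
    then have "br z ((?N ^^ i) v) \<in> (lie_prod br U ^^ i) UNIV"
      using ideal_right[OF ideal_lie_power[OF U]] by blast
    then show ?case using \<open>u \<in> U\<close> by (auto intro: lie_prod_base)
  qed auto
  then have "(?N ^^ n) v = 0" for v using nil by blast
  then show ?thesis unfolding killing_def by (intro fd.trace_nilpotent linear_ad_ad) blast
qed

subsection \<open>Cartan's criterion\<close>

definition complex_br :: "'g \<times> 'g \<Rightarrow> 'g \<times> 'g \<Rightarrow> 'g \<times> 'g" where
  "complex_br x v = (br (fst x) (fst v) - br (snd x) (snd v), br (fst x) (snd v) + br (snd x) (fst v))"

lemma linear_complex_br:
  shows "Vector_Spaces.linear complex_scale complex_scale (\<lambda>y. complex_br x y)"
    and "Vector_Spaces.linear complex_scale complex_scale (\<lambda>x. complex_br x y)"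
  using C.vector_space_axioms unfolding Vector_Spaces.linear_iff
  by (auto simp: complex_br_def complex_scale_def br_simps algebra_simps)

lemma complex_br_real: "complex_br (x, 0) v = complexify (br x) v"
  by (simp add: complex_br_def complexify_def br_simps)

lemma complex_br_split:
  "complex_br x v = complexify (br (fst x)) v + complex_scale \<i> (complexify (br (snd x)) v)"
  by (simp add: complex_br_def complexify_def complex_scale_def)

lemma complexify_derivation:
  "complexify (br x) (complex_br y z) = complex_br (complexify (br x) y) z + complex_br y (complexify (br x) z)"
  by (simp add: complex_br_def complexify_def br_simps br_derivation[of x] algebra_simps)

text \<open>
  Let \<open>\<delta>\<close> be the operator of \<open>conj_semisimple_part\<close> for \<open>ad u\<close> on the complexification; it is a
  derivation. As \<open>\<delta>\<close> maps \<open>P\<close> to \<open>U\<close>, for \<open>y, z \<in> P\<close> cyclicity of the trace yields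
  \<open>tr (ad [y, z] \<circ> \<delta>) = tr (ad y \<circ> [ad z, \<delta>]) = - tr (ad y \<circ> ad (\<delta> z)) = 0\<close>. Since \<open>u\<close> is a sum of
  such brackets, \<open>tr (ad u \<circ> \<delta>) = 0\<close>, so all eigenvalues of \<open>ad u\<close> vanish. For \<open>U = P\<close> this is the
  classical criterion of Cartan; the form with a smaller ideal \<open>U\<close> is what makes the radical of the
  Killing form on \<open>P\<close> orthogonal to the whole Lie algebra.
\<close>

lemma ad_nilpotent_in_killing_radical:
  assumes P: "lie_ideal br P" and perfect: "P \<subseteq> lie_prod br P P"
    and U: "lie_ideal br U" "U \<subseteq> P" and orth: "\<And>p u. p \<in> P \<Longrightarrow> u \<in> U \<Longrightarrow> killing p u = 0"
    and "u \<in> U"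
  shows "\<exists>k. (br u ^^ k) v = 0"
proof -
  let ?T = "complexify (br u)"
  have T: "Vector_Spaces.linear complex_scale complex_scale ?T"
    by (intro linear_complexify linear_br_right)
  obtain \<delta> where \<delta>: "Vector_Spaces.linear complex_scale complex_scale \<delta>"
    and eig: "\<And>a v. C.gen_eigen ?T a v \<Longrightarrow> \<delta> v = complex_scale (cnj a) v"
    and nil: "C.trace (\<lambda>v. ?T (\<delta> v)) = 0 \<Longrightarrow> \<forall>v. \<exists>k. (?T ^^ k) v = 0"
    using C.conj_semisimple_part[OF T] by metis
  have deriv: "\<delta> (complex_br x y) = complex_br (\<delta> x) y + complex_br x (\<delta> y)" for x y
    using C.conj_semisimple_part_derivation[where br = complex_br, OF T _ _ _ \<delta>]
      linear_complex_br complexify_derivation eig by blast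
  have sub: "C.subspace (J \<times> J)" if "lie_ideal br J" for J
  proof -
    note s = ideal_subspace[OF that]
    note s' = subspace_0[OF s] subspace_add[OF s] subspace_diff[OF s] subspace_scale[OF s]
    show ?thesis by (intro C.subspaceI) (auto simp: complex_scale_def zero_prod_def intro!: s')
  qed
  have im: "\<delta> (z, 0) \<in> U \<times> U" if "z \<in> P" for z
  proof (rule C.conj_semisimple_part_image[OF T \<delta> eig sub[OF P] sub[OF U(1)]])
    show "U \<times> U \<subseteq> P \<times> P" using U(2) by auto
    show "?T v \<in> U \<times> U" for v using ideal_left[OF U(1) \<open>u \<in> U\<close>] by (simp add: complexify_def)
    show "(z, 0) \<in> P \<times> P" using that subspace_0[OF ideal_subspace[OF P]] by auto
  qed
  have comm: "C.trace (\<lambda>v. complexify (br (br y z)) (\<delta> v)) = 0" if yz: "y \<in> P" "z \<in> P" for y z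
  proof -
    let ?y = "complexify (br y)" and ?z = "complexify (br z)"
    have ly: "Vector_Spaces.linear complex_scale complex_scale ?y"
      and lz: "Vector_Spaces.linear complex_scale complex_scale ?z"
      by (intro linear_complexify linear_br_right)+
    interpret y: Vector_Spaces.linear complex_scale complex_scale ?y by (rule ly)
    obtain s t where st: "\<delta> (z, 0) = (s, t)" "s \<in> U" "t \<in> U" using im[OF yz(2)] by blast
    have zd: "?z (\<delta> v) - \<delta> (?z v) = - complex_br (s, t) v" for v
      using deriv[of "(z, 0)" v] unfolding complex_br_real st by simp
    have eq: "?y (?z (\<delta> v)) - ?y (\<delta> (?z v)) = - ?y (complex_br (s, t) v)" for v
      unfolding y.diff[symmetric] y.neg[symmetric] zd by (rule refl)
    have y\<delta>: "Vector_Spaces.linear complex_scale complex_scale (\<lambda>v. ?y (\<delta> v))"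
      using Vector_Spaces.linear_compose[OF \<delta> ly] by (simp add: o_def)
    have "C.trace (\<lambda>v. complexify (br (br y z)) (\<delta> v))
        = C.trace (\<lambda>v. ?y (?z (\<delta> v)) - ?z (?y (\<delta> v)))"
      by (simp add: complexify_def br_br)
    also have "\<dots> = C.trace (\<lambda>v. ?y (?z (\<delta> v))) - C.trace (\<lambda>v. ?y (\<delta> (?z v)))"
      using C.trace_comp_commute[OF lz y\<delta>] by (simp add: C.trace_diff)
    also have "\<dots> = C.trace (\<lambda>v. complex_scale (-1) (?y (complex_br (s, t) v)))"
      by (simp add: C.trace_diff[symmetric] eq)
    also have "\<dots> = - C.trace (\<lambda>v. ?y (complex_br (s, t) v))"
      by (subst C.trace_scale) simp
    also have "C.trace (\<lambda>v. ?y (complex_br (s, t) v))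
        = C.trace (\<lambda>v. complexify (\<lambda>v. br y (br s v)) v + complex_scale \<i> (complexify (\<lambda>v. br y (br t v)) v))"
      unfolding complex_br_split y.add y.scale by (simp add: complexify_def)
    also have "\<dots> = of_real (killing y s) + \<i> * of_real (killing y t)"
      by (simp add: C.trace_add C.trace_scale trace_complexify linear_ad_ad killing_def)
    also have "\<dots> = 0" using orth yz(1) st by simp
    finally show ?thesis by simp
  qed
  have "C.trace (\<lambda>v. complexify (br x) (\<delta> v)) = 0" if "x \<in> lie_prod br P P" for x
    using that unfolding lie_prod_def
  proof (induction rule: span_induct_alt)
    case base
    have "complexify (br 0) w = 0" for w by (simp add: complexify_def br_simps zero_prod_def)
    then show ?case by (simp add: C.trace_zero)
  next
    case (step c u x)
    have "complexify (br (c *\<^sub>R u + x)) w = complex_scale (of_real c) (complexify (br u) w) + complexify (br x) w" for w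
      by (simp add: complexify_def complex_scale_def br_simps)
    moreover have "C.trace (\<lambda>v. complexify (br u) (\<delta> v)) = 0" using step.hyps comm by blast
    ultimately show ?case using step.IH by (simp add: C.trace_add C.trace_scale)
  qed
  moreover have "u \<in> lie_prod br P P" using \<open>u \<in> U\<close> U(2) perfect by blast
  ultimately obtain k where "(?T ^^ k) (v, 0) = 0" using nil by blast
  moreover have "(?T ^^ k) (v, 0) = ((br u ^^ k) v, 0)" for k
    by (induction k) (auto simp: complexify_def br_simps)
  ultimately show ?thesis by (auto simp: zero_prod_def)
qed

end

context lie_algebra
begin

subsection \<open>Engel's theorem\<close>

text \<open>
  The series of \<open>H\<close> is preserved by \<open>y\<close>, which normalises \<open>H\<close>. Thus \<open>m\<close> steps with \<open>H'\<close> descend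
  at least one step in the series of \<open>H\<close>.
\<close>

lemma lie_power_extend:
  assumes H: "lie_prod br H H \<subseteq> H" and y: "\<And>h. h \<in> H \<Longrightarrow> br y h \<in> H"
    and nilH: "(lie_prod br H ^^ n) UNIV = {0}" and nily: "\<And>v. (br y ^^ m) v = 0"
    and H': "\<And>x. x \<in> H' \<Longrightarrow> \<exists>h\<in>H. \<exists>c. x = h + c *\<^sub>R y"
  shows "(lie_prod br H' ^^ (m * n)) UNIV \<subseteq> {0}"
proof -
  let ?F = "\<lambda>i. (lie_prod br H ^^ i) UNIV"
  have subF: "subspace (?F i)" for i by (cases i) (auto simp: subspace_lie_prod)
  have dec: "?F (Suc i) \<subseteq> ?F i" for i
  proof (induction i)
    case (Suc i)
    then show ?case using lie_prod_mono[OF order_refl] by simp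
  qed simp
  have yF: "br y v \<in> ?F i" if "v \<in> ?F i" for i v
    using that
  proof (induction i arbitrary: v)
    case (Suc i)
    have "subspace {v. br y v \<in> ?F (Suc i)}"
      using subF[of "Suc i"]
      by (intro subspaceI) (auto simp: br_simps simp del: funpow.simps intro: subspace_0 subspace_add subspace_scale)
    moreover have "br y (br h w) \<in> ?F (Suc i)" if "h \<in> H" "w \<in> ?F i" for h w
      unfolding br_derivation[of y h w]
      using that Suc.IH[of w] y[of h] by (auto intro!: subspace_add subspace_lie_prod lie_prod_base)
    ultimately have "lie_prod br H (?F i) \<subseteq> {v. br y v \<in> ?F (Suc i)}"
      by (intro lie_prod_subsetI) auto
    then show ?case using Suc.prems by auto
  qed simp
  have yF': "(br y ^^ j) v \<in> ?F i" if "v \<in> ?F i" for i j v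
    using that yF by (induction j) auto
  \<comment> \<open>On each quotient of consecutive terms, \<open>H\<close> acts by zero and \<open>H'\<close> only through \<open>y\<close>.\<close>
  let ?G = "\<lambda>i j. {a + (br y ^^ j) b | a b. a \<in> ?F (Suc i) \<and> b \<in> ?F i}"
  have subG: "subspace (?G i j)" for i j
  proof -
    have eq: "?G i j = {x + z | x z. x \<in> ?F (Suc i) \<and> z \<in> (br y ^^ j) ` ?F i}" by blast
    show ?thesis
      unfolding eq
      by (rule subspace_sums[OF subF linear_subspace_image[OF fd.linear_funpow[OF linear_br_right] subF]])
  qed
  have step: "lie_prod br H' (?G i j) \<subseteq> ?G i (Suc j)" for i j
  proof (rule lie_prod_subsetI[OF subG])
    fix x v assume "x \<in> H'" "v \<in> ?G i j"
    then obtain h c a b where x: "h \<in> H" "x = h + c *\<^sub>R y"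
      and v: "v = a + (br y ^^ j) b" "a \<in> ?F (Suc i)" "b \<in> ?F i" using H' by blast
    have "v \<in> ?F i" using v dec[of i] yF'[OF v(3)] subF[of i] by (auto simp del: funpow.simps intro!: subspace_add)
    then have "br h v \<in> ?F (Suc i)" using x(1) by (auto intro: lie_prod_base)
    then have "br h v + c *\<^sub>R br y a \<in> ?F (Suc i)"
      using yF[OF v(2)] subF[of "Suc i"] by (intro subspace_add subspace_scale)
    moreover have "c *\<^sub>R b \<in> ?F i" using v(3) subF[of i] by (intro subspace_scale)
    moreover have "br x v = (br h v + c *\<^sub>R br y a) + (br y ^^ Suc j) (c *\<^sub>R b)"
    proof -
      interpret yj: linear "br y ^^ Suc j" by (rule fd.linear_funpow[OF linear_br_right])
      have "br x v = br h v + c *\<^sub>R br y v" by (simp add: x br_simps)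
      also have "c *\<^sub>R br y v = c *\<^sub>R br y a + c *\<^sub>R (br y ^^ Suc j) b" by (simp add: v(1) br_simps scaleR_add_right)
      finally show ?thesis by (simp add: yj.scale del: funpow.simps)
    qed
    ultimately show "br x v \<in> ?G i (Suc j)" by blast
  qed
  have "(lie_prod br H' ^^ j) (?F i) \<subseteq> ?G i j" for i j
  proof (induction j)
    case 0
    show ?case using subspace_0[OF subF[of "Suc i"]] by force
  next
    case (Suc j)
    then show ?case using lie_prod_mono[OF order_refl Suc.IH, of br H'] step by (simp del: funpow.simps(2) add: funpow.simps(2)[of j "lie_prod br H'"]) blast
  qed
  moreover have "?G i m \<subseteq> ?F (Suc i)" for i using nily by auto
  ultimately have descend: "(lie_prod br H' ^^ m) (?F i) \<subseteq> ?F (Suc i)" for i by blast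
  have mono: "X \<subseteq> Y \<Longrightarrow> (lie_prod br H' ^^ j) X \<subseteq> (lie_prod br H' ^^ j) Y" for X Y j
    by (induction j) (auto dest: lie_prod_mono[OF order_refl, of _ _ br H'])
  have "(lie_prod br H' ^^ (m * i)) UNIV \<subseteq> ?F i" for i
  proof (induction i)
    case (Suc i)
    have "(lie_prod br H' ^^ (m * Suc i)) UNIV = (lie_prod br H' ^^ m) ((lie_prod br H' ^^ (m * i)) UNIV)"
      by (simp add: funpow_add)
    also have "\<dots> \<subseteq> ?F (Suc i)" using mono[OF Suc.IH] descend by blast
    finally show ?case .
  qed simp
  from this[of n] nilH show ?thesis by simp
qed

text \<open>
  A subalgebra of \<open>U\<close> that acts nilpotently and has maximal dimension is normalised by an
  element outside it, unless it is all of \<open>U\<close>; adjoining that element keeps the action nilpotent.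
\<close>

theorem engel:
  assumes U: "lie_ideal br U" and nil: "\<And>u v. u \<in> U \<Longrightarrow> \<exists>k. (br u ^^ k) v = 0"
  shows "\<exists>n. (lie_prod br U ^^ n) UNIV = {0}"
proof -
  define good where "good H \<longleftrightarrow> subspace H \<and> H \<subseteq> U \<and> lie_prod br H H \<subseteq> H \<and>
    (\<exists>n. (lie_prod br H ^^ n) UNIV = {0})" for H
  have zero: "lie_prod br {0} X = {0}" for X
  proof (rule antisym)
    show "lie_prod br {0} X \<subseteq> {0}"
      by (rule lie_prod_subsetI) (auto simp: br_simps)
    show "{0} \<subseteq> lie_prod br {0} X"
      using subspace_0[OF subspace_lie_prod, of br "{0}" X] by simp
  qed
  have "(lie_prod br {0} ^^ 1) UNIV = {0}" by (simp add: zero)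
  then have "good {0}"
    using subspace_0[OF ideal_subspace[OF U]] subspace_single_0 zero[of "{0}"]
    unfolding good_def by (intro conjI exI[of _ 1]) simp_all
  moreover have "dim H < Suc (dim (UNIV :: 'g set))" for H :: "'g set"
    using fd.dim_subset[of H UNIV] by simp
  ultimately obtain H where H: "good H" and max: "\<And>H'. good H' \<Longrightarrow> dim H' \<le> dim H"
    using ex_has_greatest_nat[of good "{0}" dim "Suc (dim (UNIV :: 'g set))"] by (metis less_imp_le)
  then obtain n where n: "subspace H" "H \<subseteq> U" "lie_prod br H H \<subseteq> H" "(lie_prod br H ^^ n) UNIV = {0}"
    unfolding good_def by blast
  have "H = U"
  proof (rule ccontr)
    assume "H \<noteq> U"
    let ?M = "\<lambda>k. (lie_prod br H ^^ k) U"
    have MF: "?M k \<subseteq> (lie_prod br H ^^ k) UNIV" for k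
      by (induction k) (auto dest: lie_prod_mono[OF order_refl, of _ _ br H])
    then have "?M n \<subseteq> H" using MF[of n] n(4) subspace_0[OF n(1)] by auto
    moreover have "\<not> ?M 0 \<subseteq> H" using \<open>H \<noteq> U\<close> n(2) by auto
    then have "\<not> ?M k \<subseteq> H" if "\<And>j. \<not> ?M j \<subseteq> H \<Longrightarrow> \<not> ?M (Suc j) \<subseteq> H" for k
      using that by (induction k) (blast+)
    ultimately obtain j where j: "\<not> ?M j \<subseteq> H" "?M (Suc j) \<subseteq> H" by blast
    then obtain y where y: "y \<in> ?M j" "y \<notin> H" by blast
    have "?M k \<subseteq> U" for k
    proof (induction k)
      case (Suc k)
      then have "lie_prod br H (?M k) \<subseteq> U"
        using ideal_right[OF U] by (intro lie_prod_subsetI[OF ideal_subspace[OF U]]) blast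
      then show ?case by simp
    qed simp
    then have yU: "y \<in> U" using y by blast
    have hy: "br h y \<in> H" if "h \<in> H" for h
      using j(2) that y(1) by (auto intro: lie_prod_base)
    then have yh: "br y h \<in> H" if "h \<in> H" for h
      using that n(1) br_antisym[of y h] subspace_neg by metis
    have hh: "br h h' \<in> H" if "h \<in> H" "h' \<in> H" for h h' using that n(3) lie_prod_base by blast
    let ?H' = "span (insert y H)"
    have H': "\<exists>h\<in>H. \<exists>c. x = h + c *\<^sub>R y" if "x \<in> ?H'" for x
    proof -
      have "\<exists>c. x - c *\<^sub>R y \<in> span H" using that unfolding span_insert by blast
      then obtain c where "x - c *\<^sub>R y \<in> span H" ..
      then have "x - c *\<^sub>R y \<in> H" using n(1) by (simp add: span_eq_iff[THEN iffD2])
      then show ?thesis by (intro bexI[of _ "x - c *\<^sub>R y"] exI[of _ c]) auto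
    qed
    obtain m where m: "\<And>v. (br y ^^ m) v = 0"
      using fd.pointwise_nilpotent_imp_nilpotent[OF linear_br_right nil[OF yU]] by blast
    have HH': "H \<subseteq> ?H'" using span_superset by blast
    have "good ?H'"
      unfolding good_def
    proof (intro conjI exI)
      show "?H' \<subseteq> U" using yU n(2) ideal_subspace[OF U] by (intro span_minimal) auto
      show "lie_prod br ?H' ?H' \<subseteq> ?H'"
      proof (rule lie_prod_subsetI[OF subspace_span])
        fix x x' assume "x \<in> ?H'" "x' \<in> ?H'"
        then obtain h c h' c' where "h \<in> H" "h' \<in> H" "x = h + c *\<^sub>R y" "x' = h' + c' *\<^sub>R y"
          using H' by metis
        then have "br x x' \<in> H"
          using hy yh hh n(1) by (auto simp: br_simps br_self intro!: subspace_add subspace_scale)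
        then show "br x x' \<in> ?H'" using HH' by blast
      qed
      show "(lie_prod br ?H' ^^ (m * n)) UNIV = {0}"
      proof -
        have "0 \<in> (lie_prod br ?H' ^^ k) UNIV" for k
          by (cases k) (auto intro: subspace_0 subspace_lie_prod)
        then show ?thesis using lie_power_extend[OF n(3) yh n(4) m H'] by blast
      qed
    qed (rule subspace_span)
    then have "dim ?H' \<le> dim H" by (rule max)
    then have "H = ?H'" using fd.subspace_dim_equal[OF n(1) subspace_span HH'] by blast
    then show False using y(2) span_base[of y "insert y H"] by blast
  qed
  then show ?thesis using n(4) by blast
qed

end

section \<open>Complements of perfect ideals\<close>

text \<open>
  A functional that vanishes on the common kernel of finitely many functionals is a combination of
  them; here these are the functionals \<open>\<beta> b\<close> with \<open>b \<in> F\<close>, restricted to \<open>Q\<close>. In the induction \<open>Q\<close>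
  shrinks to the kernel of the functional that is added.
\<close>

lemma bilinear_represents:
  fixes \<beta> :: "'a::real_vector \<Rightarrow> 'b::real_vector \<Rightarrow> real"
  assumes "bilinear \<beta>" "finite F" "subspace Q" "linear f"
    and "\<And>q. q \<in> Q \<Longrightarrow> (\<And>b. b \<in> F \<Longrightarrow> \<beta> b q = 0) \<Longrightarrow> f q = 0"
  shows "\<exists>p\<in>span F. \<forall>q\<in>Q. f q = \<beta> p q"
  using assms(2-)
proof (induction F arbitrary: Q rule: finite_induct)
  case empty
  then show ?case using bilinear_lzero[OF assms(1)] by auto
next
  case (insert b F)
  interpret f: linear f by fact
  note \<beta> = bilinear_ladd[OF assms(1)] bilinear_radd[OF assms(1)] bilinear_lmul[OF assms(1)]
    bilinear_rmul[OF assms(1)] bilinear_rzero[OF assms(1)] bilinear_rsub[OF assms(1)]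
  let ?Q = "{q \<in> Q. \<beta> b q = 0}"
  have "subspace ?Q"
    using insert.prems(1) by (intro subspaceI) (auto simp: \<beta> subspace_0 subspace_add subspace_scale)
  then obtain p where p: "p \<in> span F" "\<forall>q\<in>?Q. f q = \<beta> p q"
    using insert.IH[of ?Q] insert.prems(2,3) by auto
  show ?case
  proof (cases "\<exists>q0\<in>Q. \<beta> b q0 \<noteq> 0")
    case False
    then show ?thesis using p span_mono[of F "insert b F"] by (intro bexI[of _ p]) auto
  next
    case True
    then obtain q0 where q0: "q0 \<in> Q" "\<beta> b q0 \<noteq> 0" by blast
    define c where "c = (f q0 - \<beta> p q0) / \<beta> b q0"
    have "f q = \<beta> (p + c *\<^sub>R b) q" if "q \<in> Q" for q
    proof -
      define t where "t = \<beta> b q / \<beta> b q0"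
      have "q - t *\<^sub>R q0 \<in> ?Q"
        using that q0 insert.prems(1) by (auto simp: \<beta> t_def intro: subspace_diff subspace_scale)
      then have "f (q - t *\<^sub>R q0) = \<beta> p (q - t *\<^sub>R q0)" using p by blast
      then have "f q = \<beta> p q + t * (f q0 - \<beta> p q0)"
        by (simp add: \<beta> f.diff f.scale algebra_simps)
      also have "t * (f q0 - \<beta> p q0) = c * \<beta> b q" using q0 by (simp add: t_def c_def)
      finally show ?thesis by (simp add: \<beta>)
    qed
    moreover have "p + c *\<^sub>R b \<in> span (insert b F)"
      using p(1) span_mono[of F "insert b F"] by (intro span_add span_scale) (auto intro: span_base)
    ultimately show ?thesis by blast
  qed
qed

lemma (in real_space) bilinear_represents_on:
  fixes \<beta> :: "'g \<Rightarrow> 'g \<Rightarrow> real"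
  assumes "bilinear \<beta>" "subspace P" "subspace Q" "linear f"
    and "\<And>q. q \<in> Q \<Longrightarrow> (\<And>b. b \<in> P \<Longrightarrow> \<beta> b q = 0) \<Longrightarrow> f q = 0"
  shows "\<exists>p\<in>P. \<forall>q\<in>Q. f q = \<beta> p q"
proof -
  obtain B where B: "B \<subseteq> P" "independent B" "P \<subseteq> span B"
    using maximal_independent_subset by metis
  have PB: "P = span B" using B assms(2) span_minimal by blast
  have "\<beta> b q = 0" if "\<And>b. b \<in> B \<Longrightarrow> \<beta> b q = 0" "b \<in> P" for b q
  proof -
    have "subspace {b. \<beta> b q = 0}"
      using assms(1) by (intro subspaceI) (auto simp: bilinear_lzero bilinear_ladd bilinear_lmul)
    then show ?thesis using that PB span_minimal[of B "{b. \<beta> b q = 0}"] by auto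
  qed
  then show ?thesis
    using bilinear_represents[OF assms(1) fd.finiteI_independent[OF B(2)] assms(3,4)] assms(5) PB by metis
qed

context lie_algebra
begin

definition killing_perp :: "'g set \<Rightarrow> 'g set" where
  "killing_perp P = {z. \<forall>p\<in>P. killing z p = 0}"

lemma ideal_killing_perp:
  assumes "lie_ideal br P"
  shows "lie_ideal br (killing_perp P)"
proof (rule idealI)
  show "subspace (killing_perp P)"
    unfolding killing_perp_def
    by (intro subspaceI) (auto simp: killing_add killing_scale bilinear_lzero[OF bilinear_killing])
  fix x y assume "y \<in> killing_perp P"
  then have "killing (br y x) p = 0" if "p \<in> P" for p
    using that ideal_right[OF assms] by (simp add: killing_invariant killing_perp_def)
  then show "br x y \<in> killing_perp P"
    unfolding killing_perp_def br_antisym[of x y] by (simp add: bilinear_lneg[OF bilinear_killing])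
qed

lemma ideal_Int: "lie_ideal br I \<Longrightarrow> lie_ideal br J \<Longrightarrow> lie_ideal br (I \<inter> J)"
  by (auto simp: lie_ideal_in_def subspace_inter)

text \<open>
  The radical \<open>U\<close> of the Killing form on \<open>P\<close> acts nilpotently, by \<open>ad_nilpotent_in_killing_radical\<close>
  and Engel's theorem. If \<open>U\<close> were \<open>P\<close>, then \<open>P\<close> would be nilpotent as well as perfect. Moreover \<open>U\<close> is
  orthogonal to the whole Lie algebra, so the functional \<open>killing x\<close> on \<open>P\<close> vanishes on \<open>U\<close> and is
  represented by an element of \<open>P\<close>.
\<close>

lemma perfect_ideal_killing_perp:
  assumes P: "lie_ideal br P" and perfect: "P \<subseteq> lie_prod br P P" and "P \<noteq> {0}"
  shows "\<not> P \<subseteq> killing_perp P" and "\<exists>p\<in>P. x - p \<in> killing_perp P"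
proof -
  let ?U = "P \<inter> killing_perp P"
  have U: "lie_ideal br ?U" by (intro ideal_Int ideal_killing_perp P)
  have "\<exists>k. (br u ^^ k) v = 0" if "u \<in> ?U" for u v
  proof (rule ad_nilpotent_in_killing_radical[OF P perfect U _ _ that])
    show "killing p u = 0" if "p \<in> P" "u \<in> ?U" for p u
      using that killing_commute[of p u] by (simp add: killing_perp_def)
  qed auto
  then obtain n where n: "(lie_prod br ?U ^^ n) UNIV = {0}" using engel[OF U] by blast
  show "\<not> P \<subseteq> killing_perp P"
  proof
    assume "P \<subseteq> killing_perp P"
    then have eq: "?U = P" by auto
    have "P \<subseteq> (lie_prod br P ^^ i) UNIV" for i
    proof (induction i)
      case (Suc i)
      then show ?case using perfect lie_prod_mono[OF order_refl Suc.IH, of br P] by simp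
    qed auto
    then show False using n \<open>P \<noteq> {0}\<close> subspace_0[OF ideal_subspace[OF P]] unfolding eq by blast
  qed
  have "\<exists>p\<in>P. \<forall>q\<in>P. killing x q = killing p q"
  proof (rule bilinear_represents_on[OF bilinear_killing])
    show "linear (killing x)" using bilinear_killing by (simp add: bilinear_def)
    show "killing x q = 0" if "q \<in> P" "\<And>b. b \<in> P \<Longrightarrow> killing b q = 0" for q
    proof -
      have "q \<in> ?U" using that killing_commute[of q] by (auto simp: killing_perp_def)
      then show ?thesis using killing_nilpotent_ideal[OF U n] killing_commute by metis
    qed
  qed (intro ideal_subspace P)+
  then show "\<exists>p\<in>P. x - p \<in> killing_perp P"
    by (auto simp: killing_perp_def bilinear_lsub[OF bilinear_killing])
qed

subsection \<open>Solvability and minimal ideals\<close>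

definition derived :: "nat \<Rightarrow> 'g set \<Rightarrow> 'g set" where
  "derived n D = ((\<lambda>D. lie_prod br D D) ^^ n) D"

lemma derived_0 [simp]: "derived 0 D = D"
  and derived_Suc [simp]: "derived (Suc n) D = lie_prod br (derived n D) (derived n D)"
  by (simp_all add: derived_def)

lemma ideal_derived: "lie_ideal br D \<Longrightarrow> lie_ideal br (derived n D)"
  by (induction n) (auto intro: ideal_lie_prod)

lemma derived_decreasing: "lie_ideal br D \<Longrightarrow> derived (Suc n) D \<subseteq> derived n D"
  unfolding derived_Suc
  using ideal_right[OF ideal_derived] by (intro lie_prod_subsetI ideal_subspace[OF ideal_derived])

lemma derived_subset: "lie_ideal br D \<Longrightarrow> derived n D \<subseteq> D"
  using derived_decreasing by (induction n) auto

text \<open>By dimension, the derived series of an ideal becomes stationary, at a perfect ideal.\<close>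

lemma derived_stationary:
  assumes D: "lie_ideal br D"
  obtains n where "derived n D \<subseteq> lie_prod br (derived n D) (derived n D)"
proof -
  obtain n where n: "\<And>m. dim (derived n D) \<le> dim (derived m D)"
    using ex_has_least_nat[of "\<lambda>_. True" 0 "\<lambda>m. dim (derived m D)"] by auto
  have "derived (Suc n) D = derived n D"
    using fd.subspace_dim_equal[OF ideal_subspace[OF ideal_derived[OF D]] ideal_subspace[OF ideal_derived[OF D]]
        derived_decreasing[OF D] n] by blast
  then show thesis using that[of n] by simp
qed

definition minimal_ideal :: "'g set \<Rightarrow> bool" where
  "minimal_ideal N \<longleftrightarrow> lie_ideal br N \<and> N \<noteq> {0} \<and> (\<forall>J. lie_ideal br J \<and> J \<subseteq> N \<longrightarrow> J = {0} \<or> J = N)"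

text \<open>
  A non-zero ideal of least dimension inside \<open>I\<close>.
\<close>

lemma minimal_ideal_exists:
  assumes "lie_ideal br I" "I \<noteq> {0}"
  obtains N where "minimal_ideal N" "N \<subseteq> I"
proof -
  let ?P = "\<lambda>N. lie_ideal br N \<and> N \<noteq> {0} \<and> N \<subseteq> I"
  obtain N where N: "?P N" "\<And>J. ?P J \<Longrightarrow> dim N \<le> dim J"
    using ex_has_least_nat[of ?P I dim] assms by auto
  have "J = {0} \<or> J = N" if "lie_ideal br J" "J \<subseteq> N" for J
    using N that fd.subspace_dim_equal[OF ideal_subspace ideal_subspace, of J N] by (metis subset_trans)
  then show thesis using N that[of N] by (auto simp: minimal_ideal_def)
qed

text \<open>
  The map \<open>ad x \<circ> ad y\<close> sends everything to \<open>J\<close> and kills \<open>J\<close>, so its square is zero.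
\<close>

lemma killing_abelian_ideal_in:
  assumes N: "lie_ideal br N" and J: "lie_ideal_in br N J" and "\<And>x y. x \<in> J \<Longrightarrow> y \<in> J \<Longrightarrow> br x y = 0"
    and x: "x \<in> J" and y: "y \<in> N"
  shows "killing x y = 0"
proof -
  let ?N = "\<lambda>v. br x (br y v)"
  have "x \<in> N" using J x by (auto simp: lie_ideal_in_def)
  have "?N v \<in> J" for v
    using ideal_left[OF N y, of v] J x br_antisym[of x "br y v"] by (auto simp: lie_ideal_in_def subspace_neg)
  moreover have "?N w = 0" if "w \<in> J" for w
    using that J y assms(3)[OF x] by (auto simp: lie_ideal_in_def)
  ultimately have "(?N ^^ 2) v = 0" for v by (simp add: numeral_2_eq_2)
  then show ?thesis unfolding killing_def by (intro fd.trace_nilpotent linear_ad_ad) blast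
qed

text \<open>
  A non-abelian minimal ideal \<open>N\<close> is perfect, and by minimality the Killing form of the whole Lie
  algebra is non-degenerate on it. The last non-zero term of the derived series of a solvable ideal
  of \<open>N\<close> would be abelian and hence lie in the radical of this form.
\<close>

lemma minimal_ideal_abelian_or_semisimple:
  assumes N: "minimal_ideal N" and na: "\<not> (\<forall>x\<in>N. \<forall>y\<in>N. br x y = 0)"
  shows "semisimple_lie br N"
proof -
  have I: "lie_ideal br N" "N \<noteq> {0}" and min: "\<And>J. lie_ideal br J \<Longrightarrow> J \<subseteq> N \<Longrightarrow> J = {0} \<or> J = N"
    using N by (auto simp: minimal_ideal_def)
  have "lie_prod br N N \<subseteq> N" using derived_decreasing[OF I(1), of 0] by simp
  moreover have "lie_prod br N N \<noteq> {0}" using na lie_prod_base by blast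
  ultimately have "lie_prod br N N = N" using min ideal_lie_prod I by blast
  then have "\<not> N \<subseteq> killing_perp N" using perfect_ideal_killing_perp(1)[OF I(1) _ I(2)] by simp
  then have nondeg: "N \<inter> killing_perp N = {0}"
    using min[OF ideal_Int[OF I(1) ideal_killing_perp[OF I(1)]]] by blast
  show ?thesis
    unfolding semisimple_lie_def solvable_lie_def
  proof (intro allI impI)
    fix J assume asm: "lie_ideal_in br N J \<and> (\<exists>n. ((\<lambda>D. lie_prod br D D) ^^ n) J = {0})"
    then obtain n where n: "derived n J = {0}" and J: "lie_ideal_in br N J" by (auto simp: derived_def)
    have DJ: "lie_ideal_in br N (derived m J)" for m
    proof (induction m)
      case (Suc m)
      then have s: "subspace (derived m J)" "derived m J \<subseteq> N"
        and d: "\<And>x y. x \<in> N \<Longrightarrow> y \<in> derived m J \<Longrightarrow> br x y \<in> derived m J"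
        by (auto simp: lie_ideal_in_def)
      have "derived (Suc m) J \<subseteq> derived m J"
        unfolding derived_Suc using d s by (intro lie_prod_subsetI) auto
      moreover have "br x y \<in> derived (Suc m) J" if "x \<in> N" "y \<in> derived (Suc m) J" for x y
      proof -
        have "subspace {y. br x y \<in> derived (Suc m) J}"
          by (intro subspaceI) (auto simp: br_simps intro: subspace_0 subspace_add subspace_scale subspace_lie_prod)
        moreover have "br x (br a b) \<in> derived (Suc m) J" if "a \<in> derived m J" "b \<in> derived m J" for a b
          unfolding br_derivation[of x a b]
          using d[OF \<open>x \<in> N\<close>] that by (auto intro!: subspace_add subspace_lie_prod lie_prod_base)
        ultimately have "derived (Suc m) J \<subseteq> {y. br x y \<in> derived (Suc m) J}"
          unfolding derived_Suc[of m] by (intro lie_prod_subsetI) auto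
        then show ?thesis using that by blast
      qed
      ultimately show ?case using s subspace_lie_prod by (auto simp: lie_ideal_in_def)
    qed (use J in simp)
    show "J = {0}"
    proof (rule ccontr)
      assume "J \<noteq> {0}"
      then have "\<exists>m. derived m J \<noteq> {0} \<and> derived (Suc m) J = {0}"
        using n
      proof (induction n)
        case 0
        then show ?case using \<open>J \<noteq> {0}\<close> by (metis derived_0)
      next
        case (Suc n)
        then show ?case by (cases "derived n J = {0}") (assumption, blast)+
      qed
      then obtain m where m: "derived m J \<noteq> {0}" "derived (Suc m) J = {0}" by blast
      have ab: "br x y = 0" if "x \<in> derived m J" "y \<in> derived m J" for x y
        using lie_prod_base[OF that, of br] m(2) by simp
      have "killing x y = 0" if "x \<in> derived m J" "y \<in> N" for x y
        by (rule killing_abelian_ideal_in[OF I(1) DJ ab that])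
      then have "derived m J \<subseteq> N \<inter> killing_perp N"
        using DJ[of m] by (auto simp: killing_perp_def lie_ideal_in_def)
      then show False using nondeg m(1) DJ[of m] by (auto simp: lie_ideal_in_def dest: subspace_0)
    qed
  qed
qed

end

section \<open>Complete reducibility of ideal quotients\<close>

definition ssum :: "'g::real_vector set \<Rightarrow> 'g set \<Rightarrow> 'g set" (infixl "+\<^sub>s" 65) where
  "A +\<^sub>s B = {a + b | a b. a \<in> A \<and> b \<in> B}"

lemma ssum_mem: "a \<in> A \<Longrightarrow> b \<in> B \<Longrightarrow> a + b \<in> A +\<^sub>s B"
  by (auto simp: ssum_def)

lemma subspace_ssum: "subspace A \<Longrightarrow> subspace B \<Longrightarrow> subspace (A +\<^sub>s B)"
  unfolding ssum_def by (rule subspace_sums)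

lemma ssum_left: "subspace B \<Longrightarrow> A \<subseteq> A +\<^sub>s B"
  unfolding ssum_def using subspace_0 by force

lemma ssum_right: "subspace A \<Longrightarrow> B \<subseteq> A +\<^sub>s B"
  unfolding ssum_def using subspace_0 by force

lemma ssum_least: "subspace C \<Longrightarrow> A \<subseteq> C \<Longrightarrow> B \<subseteq> C \<Longrightarrow> A +\<^sub>s B \<subseteq> C"
  unfolding ssum_def by (auto intro: subspace_add)

lemma ssum_mono: "A \<subseteq> A' \<Longrightarrow> B \<subseteq> B' \<Longrightarrow> A +\<^sub>s B \<subseteq> A' +\<^sub>s B'"
  unfolding ssum_def by blast

context lie_algebra
begin

lemma ideal_ssum:
  assumes "lie_ideal br I" "lie_ideal br J"
  shows "lie_ideal br (I +\<^sub>s J)"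
proof (rule idealI)
  show "subspace (I +\<^sub>s J)" using assms by (intro subspace_ssum ideal_subspace)
  fix x y assume "y \<in> I +\<^sub>s J"
  then obtain a b where "y = a + b" "a \<in> I" "b \<in> J" by (auto simp: ssum_def)
  then show "br x y \<in> I +\<^sub>s J"
    using ideal_right[OF assms(1)] ideal_right[OF assms(2)] by (simp add: br_simps ssum_mem)
qed

text \<open>Complete reducibility of the module \<open>J / K\<close>, in terms of ideals between \<open>K\<close> and \<open>J\<close>.\<close>

definition completely_reducible :: "'g set \<Rightarrow> 'g set \<Rightarrow> bool" where
  "completely_reducible J K \<longleftrightarrow> (\<forall>W. lie_ideal br W \<and> K \<subseteq> W \<and> W \<subseteq> J \<longrightarrow>
     (\<exists>W'. lie_ideal br W' \<and> K \<subseteq> W' \<and> W' \<subseteq> J \<and> W \<inter> W' = K \<and> W +\<^sub>s W' = J))"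

lemma completely_reducibleD:
  assumes "completely_reducible J K" "lie_ideal br W" "K \<subseteq> W" "W \<subseteq> J"
  obtains W' where "lie_ideal br W'" "K \<subseteq> W'" "W' \<subseteq> J" "W \<inter> W' = K" "W +\<^sub>s W' = J"
  using assms unfolding completely_reducible_def by blast

lemma completely_reducible_refl: "lie_ideal br K \<Longrightarrow> completely_reducible K K"
  unfolding completely_reducible_def
proof (intro allI impI)
  fix W assume K: "lie_ideal br K" and "lie_ideal br W \<and> K \<subseteq> W \<and> W \<subseteq> K"
  then have "W = K" by auto
  moreover have "K +\<^sub>s K = K"
    using ssum_least[OF ideal_subspace[OF K], of K K] ssum_left[OF ideal_subspace[OF K], of K] by auto
  ultimately show "\<exists>W'. lie_ideal br W' \<and> K \<subseteq> W' \<and> W' \<subseteq> K \<and> W \<inter> W' = K \<and> W +\<^sub>s W' = K"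
    using K by (intro exI[of _ K]) auto
qed

lemma completely_reducible_simple:
  assumes K: "lie_ideal br K" and J: "lie_ideal br J" "K \<subseteq> J"
    and min: "\<And>W. lie_ideal br W \<Longrightarrow> K \<subseteq> W \<Longrightarrow> W \<subseteq> J \<Longrightarrow> W = K \<or> W = J"
  shows "completely_reducible J K"
  unfolding completely_reducible_def
proof (intro allI impI)
  fix W assume W: "lie_ideal br W \<and> K \<subseteq> W \<and> W \<subseteq> J"
  have sum: "K +\<^sub>s J = J" "J +\<^sub>s K = J"
    using ssum_least[OF ideal_subspace[OF J(1)]] J ssum_left[OF ideal_subspace[OF K], of J]
      ssum_right[OF ideal_subspace[OF K], of J] by auto
  from min W consider "W = K" | "W = J" by blast
  then show "\<exists>W'. lie_ideal br W' \<and> K \<subseteq> W' \<and> W' \<subseteq> J \<and> W \<inter> W' = K \<and> W +\<^sub>s W' = J"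
  proof cases
    case 1
    then show ?thesis using sum J by (intro exI[of _ J]) auto
  next
    case 2
    then show ?thesis using sum J K by (intro exI[of _ K]) auto
  qed
qed

text \<open>
  A complement of \<open>W\<close> is built in two steps: \<open>C1\<close> completes \<open>W\<close> inside \<open>J1\<close>, and then \<open>C2\<close> completes
  \<open>W + C1\<close> inside \<open>J2\<close>.
\<close>

lemma completely_reducible_ssum:
  assumes K: "lie_ideal br K"
    and J1: "lie_ideal br J1" "K \<subseteq> J1" "completely_reducible J1 K"
    and J2: "lie_ideal br J2" "K \<subseteq> J2" "completely_reducible J2 K"
  shows "completely_reducible (J1 +\<^sub>s J2) K"
  unfolding completely_reducible_def
proof (intro allI impI)
  fix W assume "lie_ideal br W \<and> K \<subseteq> W \<and> W \<subseteq> J1 +\<^sub>s J2"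
  then have W: "lie_ideal br W" "K \<subseteq> W" "W \<subseteq> J1 +\<^sub>s J2" by auto
  note sub = ideal_subspace
  obtain C1 where C1: "lie_ideal br C1" "K \<subseteq> C1" "C1 \<subseteq> J1" "(W \<inter> J1) \<inter> C1 = K" "(W \<inter> J1) +\<^sub>s C1 = J1"
    by (rule completely_reducibleD[OF J1(3), of "W \<inter> J1"]) (use W J1 in \<open>auto intro: ideal_Int\<close>)
  let ?X = "W +\<^sub>s C1"
  have X: "lie_ideal br ?X" "K \<subseteq> ?X"
    using W C1 ssum_left[OF sub[OF C1(1)], of W] by (auto intro: ideal_ssum)
  obtain C2 where C2: "lie_ideal br C2" "K \<subseteq> C2" "C2 \<subseteq> J2" "(?X \<inter> J2) \<inter> C2 = K" "(?X \<inter> J2) +\<^sub>s C2 = J2"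
    by (rule completely_reducibleD[OF J2(3), of "?X \<inter> J2"]) (use X J2 in \<open>auto intro: ideal_Int\<close>)
  have XC2: "?X \<inter> C2 = K" using C2(3,4) by auto
  let ?C = "C1 +\<^sub>s C2"
  have C: "lie_ideal br ?C" using C1 C2 by (intro ideal_ssum)
  have "W \<inter> ?C \<subseteq> K"
  proof
    fix w assume "w \<in> W \<inter> ?C"
    then obtain c1 c2 where w: "w = c1 + c2" "c1 \<in> C1" "c2 \<in> C2" "w \<in> W" by (auto simp: ssum_def)
    have "c2 = w + (- c1)" using w by simp
    then have "c2 \<in> ?X" using w(2,4) subspace_neg[OF sub[OF C1(1)]] ssum_mem by metis
    then have "c2 \<in> C1" using XC2 w(3) C1(2) by auto
    then have "w \<in> C1" using w sub[OF C1(1)] by (auto intro: subspace_add)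
    then show "w \<in> K" using C1(3,4) w(4) by auto
  qed
  moreover have KC: "K \<subseteq> ?C" using C1(2) ssum_left[OF sub[OF C2(1)], of C1] by auto
  moreover have "?C \<subseteq> J1 +\<^sub>s J2" using C1 C2 by (intro ssum_mono)
  moreover have "W +\<^sub>s ?C = J1 +\<^sub>s J2"
  proof
    show "W +\<^sub>s ?C \<subseteq> J1 +\<^sub>s J2"
      by (rule ssum_least[OF subspace_ssum[OF sub[OF J1(1)] sub[OF J2(1)]] W(3) \<open>?C \<subseteq> J1 +\<^sub>s J2\<close>])
    have WC: "subspace (W +\<^sub>s ?C)" using W C by (intro subspace_ssum sub)
    have "W \<subseteq> W +\<^sub>s ?C" "C1 \<subseteq> W +\<^sub>s ?C" "C2 \<subseteq> W +\<^sub>s ?C"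
      using ssum_left[OF sub[OF C], of W] ssum_right[OF sub[OF W(1)], of ?C]
        ssum_left[OF sub[OF C2(1)], of C1] ssum_right[OF sub[OF C1(1)], of C2] by auto
    then have "?X \<subseteq> W +\<^sub>s ?C" "C2 \<subseteq> W +\<^sub>s ?C" "J1 \<subseteq> W +\<^sub>s ?C"
      using ssum_least[OF WC, of W C1] ssum_least[OF WC, of "W \<inter> J1" C1] C1(5) by auto
    then show "J1 +\<^sub>s J2 \<subseteq> W +\<^sub>s ?C"
      using ssum_least[OF WC, of "?X \<inter> J2" C2] ssum_least[OF WC, of J1 J2] C2(5) by auto
  qed
  ultimately show "\<exists>W'. lie_ideal br W' \<and> K \<subseteq> W' \<and> W' \<subseteq> J1 +\<^sub>s J2 \<and> W \<inter> W' = K \<and> W +\<^sub>s W' = J1 +\<^sub>s J2"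
    using C W(2) by (intro exI[of _ ?C]) auto
qed

definition socle_over :: "'g set \<Rightarrow> 'g set \<Rightarrow> bool" where
  "socle_over K J \<longleftrightarrow> lie_ideal br J \<and> K \<subseteq> J \<and> completely_reducible J K"

text \<open>
  By \<open>completely_reducible_ssum\<close> the candidates are closed under sums, so one of maximal dimension
  contains all others.
\<close>

lemma greatest_socle_over:
  assumes K: "lie_ideal br K"
  obtains J where "socle_over K J" "\<And>J'. socle_over K J' \<Longrightarrow> J' \<subseteq> J"
proof -
  have "socle_over K K" using K completely_reducible_refl by (auto simp: socle_over_def)
  moreover have "dim H < Suc (dim (UNIV :: 'g set))" for H :: "'g set"
    using fd.dim_subset[of H UNIV] by simp
  ultimately obtain J where J: "socle_over K J" and max: "\<And>J'. socle_over K J' \<Longrightarrow> dim J' \<le> dim J"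
    using ex_has_greatest_nat[of "socle_over K" K dim "Suc (dim (UNIV :: 'g set))"] by (metis less_imp_le)
  have "J' \<subseteq> J" if J': "socle_over K J'" for J'
  proof -
    have s: "subspace J" "subspace J'" using J J' by (auto simp: socle_over_def ideal_subspace)
    have "socle_over K (J +\<^sub>s J')"
      using J J' completely_reducible_ssum[OF K] ssum_left[OF s(2), of J]
      unfolding socle_over_def by (blast intro: ideal_ssum)
    then have "dim (J +\<^sub>s J') \<le> dim J" by (rule max)
    then have "J = J +\<^sub>s J'"
      using fd.subspace_dim_equal[OF s(1) subspace_ssum[OF s] ssum_left[OF s(2)]] by blast
    then show ?thesis using ssum_right[OF s(1), of J'] by simp
  qed
  then show thesis using that J by blast
qed

end

section \<open>Duality\<close>

locale metric_lie_algebra = lie_algebra E br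
  for E :: "'g::real_vector set" and br :: "'g \<Rightarrow> 'g \<Rightarrow> 'g" +
  fixes ip :: "'g \<Rightarrow> 'g \<Rightarrow> real"
  assumes scalar_product: "scalar_product ip"
    and invariant: "ip (br x y) z = - ip y (br x z)"
begin

lemma bilinear_ip: "bilinear ip"
  using scalar_product by (simp add: scalar_product_def)

lemma ip_commute: "ip x y = ip y x"
  using scalar_product by (simp add: scalar_product_def)

lemma ip_nondegenerate: "(\<And>y. ip x y = 0) \<Longrightarrow> x = 0"
  using scalar_product by (simp add: scalar_product_def)

lemmas ip_simps = bilinear_ladd[OF bilinear_ip] bilinear_radd[OF bilinear_ip]
  bilinear_lsub[OF bilinear_ip] bilinear_rsub[OF bilinear_ip]
  bilinear_lmul[OF bilinear_ip] bilinear_rmul[OF bilinear_ip]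
  bilinear_lneg[OF bilinear_ip] bilinear_rneg[OF bilinear_ip]
  bilinear_lzero[OF bilinear_ip] bilinear_rzero[OF bilinear_ip]

lemma orthD: "x \<in> orth ip W \<Longrightarrow> w \<in> W \<Longrightarrow> ip x w = 0"
  by (simp add: orth_def)

lemma subspace_orth: "subspace (orth ip W)"
  by (intro subspaceI) (auto simp: orth_def ip_simps)

lemma orth_antimono: "V \<subseteq> W \<Longrightarrow> orth ip W \<subseteq> orth ip V"
  by (auto simp: orth_def)

lemma orth_orth:
  assumes W: "subspace W"
  shows "orth ip (orth ip W) = W"
proof
  show "W \<subseteq> orth ip (orth ip W)" using ip_commute by (auto simp: orth_def)
  show "orth ip (orth ip W) \<subseteq> W"
  proof
    fix z assume z: "z \<in> orth ip (orth ip W)"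
    have "\<exists>p\<in>W. \<forall>q\<in>UNIV. ip z q = ip p q"
    proof (rule bilinear_represents_on[OF bilinear_ip W subspace_UNIV])
      show "linear (ip z)" using bilinear_ip by (simp add: bilinear_def)
      show "ip z q = 0" if "\<And>b. b \<in> W \<Longrightarrow> ip b q = 0" for q
        using that z ip_commute by (auto simp: orth_def)
    qed
    then obtain p where "p \<in> W" "\<And>q. ip (z - p) q = 0" by (auto simp: ip_simps)
    then show "z \<in> W" using ip_nondegenerate[of "z - p"] by simp
  qed
qed

lemma orth_zero: "orth ip {0} = UNIV" and orth_UNIV: "orth ip UNIV = {0}"
  using ip_nondegenerate by (auto simp: orth_def ip_simps)

lemma ideal_orth: "lie_ideal br J \<Longrightarrow> lie_ideal br (orth ip J)"
  using invariant ideal_right by (intro idealI subspace_orth) (auto simp: orth_def)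

lemma orth_ssum: "subspace V \<Longrightarrow> subspace W \<Longrightarrow> orth ip (V +\<^sub>s W) = orth ip V \<inter> orth ip W"
proof
  assume V: "subspace V" and W: "subspace W"
  show "orth ip (V +\<^sub>s W) \<subseteq> orth ip V \<inter> orth ip W"
    using orth_antimono[OF ssum_left[OF W, of V]] orth_antimono[OF ssum_right[OF V, of W]] by simp
  show "orth ip V \<inter> orth ip W \<subseteq> orth ip (V +\<^sub>s W)"
    by (auto simp: orth_def ssum_def ip_simps)
qed

lemma orth_Int: "subspace V \<Longrightarrow> subspace W \<Longrightarrow> orth ip (V \<inter> W) = orth ip V +\<^sub>s orth ip W"
  using orth_ssum[OF subspace_orth subspace_orth, of V W] orth_orth[OF subspace_ssum[OF subspace_orth subspace_orth], of V W]
  by (simp add: orth_orth)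

text \<open>
  Orthogonal complements reverse the lattice of ideals and exchange sums and intersections.
\<close>

lemma completely_reducible_orth:
  assumes J: "lie_ideal br J" and K: "lie_ideal br K" and cr: "completely_reducible J K"
  shows "completely_reducible (orth ip K) (orth ip J)"
  unfolding completely_reducible_def
proof (intro allI impI)
  fix W assume "lie_ideal br W \<and> orth ip J \<subseteq> W \<and> W \<subseteq> orth ip K"
  then have W: "lie_ideal br W" "orth ip J \<subseteq> W" "W \<subseteq> orth ip K" by auto
  have "K \<subseteq> orth ip W" "orth ip W \<subseteq> J"
    using orth_antimono[OF W(2)] orth_antimono[OF W(3)] orth_orth ideal_subspace J K by auto
  then obtain V where V: "lie_ideal br V" "K \<subseteq> V" "V \<subseteq> J" "orth ip W \<inter> V = K" "orth ip W +\<^sub>s V = J"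
    using completely_reducibleD[OF cr ideal_orth[OF W(1)]] by metis
  have "W \<inter> orth ip V = orth ip J"
    using V(5) orth_ssum[OF subspace_orth ideal_subspace[OF V(1)]] orth_orth[OF ideal_subspace[OF W(1)]] by metis
  moreover have "W +\<^sub>s orth ip V = orth ip K"
    using V(4) orth_Int[OF subspace_orth ideal_subspace[OF V(1)]] orth_orth[OF ideal_subspace[OF W(1)]] by metis
  ultimately show "\<exists>W'. lie_ideal br W' \<and> orth ip J \<subseteq> W' \<and> W' \<subseteq> orth ip K \<and> W \<inter> W' = orth ip J \<and> W +\<^sub>s W' = orth ip K"
    using V orth_antimono ideal_orth by (intro exI[of _ "orth ip V"]) auto
qed

end

section \<open>Quotient spaces\<close>

definition coset :: "'g::real_vector set \<Rightarrow> 'g \<Rightarrow> 'g set" where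
  "coset K x = (+) x ` K"

lemma mem_coset: "y \<in> coset K x \<longleftrightarrow> y - x \<in> K"
  unfolding coset_def by (metis add_diff_cancel_left' diff_add_cancel add.commute image_iff)

lemma coset_self: "subspace K \<Longrightarrow> x \<in> coset K x"
  by (simp add: mem_coset subspace_0)

lemma coset_eq_iff: "subspace K \<Longrightarrow> coset K x = coset K y \<longleftrightarrow> x - y \<in> K"
proof
  assume K: "subspace K"
  show "x - y \<in> K" if "coset K x = coset K y"
    using coset_self[OF K, of x] that by (simp add: mem_coset)
  show "coset K x = coset K y" if "x - y \<in> K"
  proof -
    have "z - x \<in> K \<longleftrightarrow> z - y \<in> K" for z
      using subspace_add[OF K, of "z - x" "x - y"] subspace_diff[OF K, of "z - y" "x - y"] that by auto
    then show ?thesis by (auto simp: mem_coset)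
  qed
qed

lemma coset_0: "coset K 0 = K"
  by (simp add: coset_def)

lemma ind1_eq:
  assumes "subspace K" "x \<in> X" "\<And>y. y \<in> X \<Longrightarrow> f y - f x \<in> K"
  shows "ind1 K f X = coset K (f x)"
proof -
  have "coset K (f y) = coset K (f x)" if "y \<in> X" for y
    using assms that by (simp add: coset_eq_iff)
  then show ?thesis using assms(2) unfolding ind1_def coset_def[symmetric] by blast
qed

lemma ind2_eq:
  assumes "subspace K" "x \<in> X" "y \<in> Y"
    and "\<And>x' y'. x' \<in> X \<Longrightarrow> y' \<in> Y \<Longrightarrow> f x' y' - f x y \<in> K"
  shows "ind2 K f X Y = coset K (f x y)"
proof -
  have "coset K (f x' y') = coset K (f x y)" if "x' \<in> X" "y' \<in> Y" for x' y'
    using assms that by (simp add: coset_eq_iff)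
  then show ?thesis using assms(2,3) unfolding ind2_def coset_def[symmetric] by blast
qed

lemma ind1_coset:
  assumes "subspace K" "linear f" "I \<subseteq> K" "subspace I" "\<And>k. k \<in> I \<Longrightarrow> f k \<in> K"
  shows "ind1 K f (coset I x) = coset K (f x)"
proof (rule ind1_eq[OF assms(1) coset_self[OF assms(4)]])
  interpret f: linear f by fact
  show "f y - f x \<in> K" if "y \<in> coset I x" for y
    using that assms(5)[of "y - x"] by (simp add: mem_coset f.diff)
qed

lemma cring_real_ring: "cring real_ring"
proof (rule cringI)
  show "abelian_group real_ring"
  proof (rule abelian_groupI)
    show "\<exists>y\<in>carrier real_ring. y \<oplus>\<^bsub>real_ring\<^esub> x = \<zero>\<^bsub>real_ring\<^esub>" for x
      by (intro bexI[of _ "- x"]) (auto simp: real_ring_def)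
  qed (auto simp: real_ring_def)
  show "comm_monoid real_ring"
    by (rule comm_monoidI) (auto simp: real_ring_def)
qed (auto simp: real_ring_def algebra_simps)

locale subspace_pair =
  fixes br :: "'g::real_vector \<Rightarrow> 'g \<Rightarrow> 'g" and J K :: "'g set"
  assumes subspace_J: "subspace J" and subspace_K: "subspace K" and K_subset_J: "K \<subseteq> J"
begin

abbreviation Q :: "'g set space" where
  "Q \<equiv> quot br J K"

lemma carrier_Q: "carrier Q = coset K ` J"
  by (simp add: quot_def coset_def[abs_def])

lemma zero_Q: "\<zero>\<^bsub>Q\<^esub> = coset K 0"
  by (simp add: quot_def coset_0)

lemma add_Q: "coset K x \<oplus>\<^bsub>Q\<^esub> coset K y = coset K (x + y)"
  unfolding quot_def
proof (simp, rule ind2_eq[OF subspace_K coset_self[OF subspace_K] coset_self[OF subspace_K]])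
  fix x' y' assume "x' \<in> coset K x" "y' \<in> coset K y"
  then have "(x' - x) + (y' - y) \<in> K" using subspace_add[OF subspace_K] by (simp add: mem_coset)
  then show "x' + y' - (x + y) \<in> K" by (simp add: algebra_simps)
qed

lemma smult_Q: "c \<odot>\<^bsub>Q\<^esub> coset K x = coset K (c *\<^sub>R x)"
  unfolding quot_def
  by (simp, rule ind1_coset[OF subspace_K _ order_refl subspace_K]) (auto intro: linearI subspace_scale subspace_K simp: algebra_simps)

lemma coset_K_in: "x \<in> J \<Longrightarrow> coset K x \<in> carrier Q"
  by (simp add: carrier_Q)

lemma coset_eq: "coset K x = coset K y \<longleftrightarrow> x - y \<in> K"
  by (rule coset_eq_iff[OF subspace_K])

lemma abelian_group_Q: "abelian_group Q"
proof (rule abelian_groupI)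
  show "\<exists>Y\<in>carrier Q. Y \<oplus>\<^bsub>Q\<^esub> X = \<zero>\<^bsub>Q\<^esub>" if X: "X \<in> carrier Q" for X
  proof -
    obtain x where x: "x \<in> J" "X = coset K x" using X by (auto simp: carrier_Q)
    then show ?thesis
      using subspace_neg[OF subspace_J] by (intro bexI[of _ "coset K (- x)"]) (simp_all add: add_Q zero_Q carrier_Q)
  qed
next
  fix X Y Z assume "X \<in> carrier Q" "Y \<in> carrier Q" "Z \<in> carrier Q"
  then show "X \<oplus>\<^bsub>Q\<^esub> Y \<oplus>\<^bsub>Q\<^esub> Z = X \<oplus>\<^bsub>Q\<^esub> (Y \<oplus>\<^bsub>Q\<^esub> Z)"
    unfolding carrier_Q by (elim imageE) (simp only: add_Q add.assoc)
next
  fix X Y assume "X \<in> carrier Q" "Y \<in> carrier Q"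
  then show "X \<oplus>\<^bsub>Q\<^esub> Y = Y \<oplus>\<^bsub>Q\<^esub> X" "X \<oplus>\<^bsub>Q\<^esub> Y \<in> carrier Q"
    unfolding carrier_Q using subspace_add[OF subspace_J]
    by (elim imageE; simp only: add_Q add.commute imageI)+
next
  fix X assume "X \<in> carrier Q"
  then show "\<zero>\<^bsub>Q\<^esub> \<oplus>\<^bsub>Q\<^esub> X = X"
    unfolding carrier_Q zero_Q by (elim imageE) (simp only: add_Q add_0)
next
  show "\<zero>\<^bsub>Q\<^esub> \<in> carrier Q" using subspace_0[OF subspace_J] by (simp only: zero_Q coset_K_in)
qed

lemma module_Q: "Module.module real_ring Q"
proof (rule moduleI[OF cring_real_ring abelian_group_Q])
  fix a b x assume "x \<in> carrier Q"
  then obtain v where v: "v \<in> J" "x = coset K v" by (auto simp: carrier_Q)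
  show "a \<odot>\<^bsub>Q\<^esub> x \<in> carrier Q"
    unfolding v(2) smult_Q using subspace_scale[OF subspace_J v(1)] by (rule coset_K_in)
  show "(a \<oplus>\<^bsub>real_ring\<^esub> b) \<odot>\<^bsub>Q\<^esub> x = a \<odot>\<^bsub>Q\<^esub> x \<oplus>\<^bsub>Q\<^esub> b \<odot>\<^bsub>Q\<^esub> x"
    unfolding v(2) smult_Q add_Q by (simp add: real_ring_def scaleR_left_distrib)
  show "(a \<otimes>\<^bsub>real_ring\<^esub> b) \<odot>\<^bsub>Q\<^esub> x = a \<odot>\<^bsub>Q\<^esub> (b \<odot>\<^bsub>Q\<^esub> x)"
    unfolding v(2) smult_Q by (simp add: real_ring_def)
  show "\<one>\<^bsub>real_ring\<^esub> \<odot>\<^bsub>Q\<^esub> x = x"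
    unfolding v(2) smult_Q by (simp add: real_ring_def)
  fix y assume "y \<in> carrier Q"
  then obtain w where w: "w \<in> J" "y = coset K w" by (auto simp: carrier_Q)
  show "a \<odot>\<^bsub>Q\<^esub> (x \<oplus>\<^bsub>Q\<^esub> y) = a \<odot>\<^bsub>Q\<^esub> x \<oplus>\<^bsub>Q\<^esub> a \<odot>\<^bsub>Q\<^esub> y"
    unfolding v(2) w(2) smult_Q add_Q by (simp only: scaleR_right_distrib)
qed

lemma finsum_Q:
  assumes "finite B" "\<And>b. b \<in> B \<Longrightarrow> g b \<in> J"
  shows "(\<Oplus>\<^bsub>Q\<^esub>b\<in>B. coset K (g b)) = coset K (\<Sum>b\<in>B. g b)"
  using assms
proof (induction B rule: finite_induct)
  case empty
  interpret abelian_group Q by (rule abelian_group_Q)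
  show ?case by (simp add: zero_Q)
next
  case (insert b B)
  interpret abelian_group Q by (rule abelian_group_Q)
  have "(\<Oplus>\<^bsub>Q\<^esub>b\<in>insert b B. coset K (g b)) = coset K (g b) \<oplus>\<^bsub>Q\<^esub> (\<Oplus>\<^bsub>Q\<^esub>b\<in>B. coset K (g b))"
    using insert by (intro finsum_insert) (auto intro: coset_K_in)
  also have "\<dots> = coset K (g b + (\<Sum>b\<in>B. g b))" using insert by (simp only: add_Q insert_iff simp_thms)
  finally show ?case using insert.hyps by simp
qed

lemma sum_in_J: "finite B \<Longrightarrow> (\<And>b. b \<in> B \<Longrightarrow> g b \<in> J) \<Longrightarrow> (\<Sum>b\<in>B. g b) \<in> J"
  by (rule subspace_sum[OF subspace_J])

text \<open>
  Distinct generators may have the same coset, so the coefficients of all generators in a coset are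
  added up.
\<close>

lemma fd_space_Q:
  assumes "finite B" "J = span B"
  shows "fd_space Q"
  unfolding fd_space_def
proof (intro conjI module_Q exI[of _ "coset K ` B"] ballI)
  have BJ: "b \<in> J" if "b \<in> B" for b using that assms by (simp add: span_base)
  then show "coset K ` B \<subseteq> carrier Q" by (auto intro: coset_K_in)
  show "finite (coset K ` B)" using assms by simp
  fix V assume "V \<in> carrier Q"
  then have "V \<in> coset K ` J" by (simp only: carrier_Q)
  then obtain v where "v \<in> J" and V: "V = coset K v" by blast
  then obtain u where u: "v = (\<Sum>b\<in>B. u b *\<^sub>R b)"
    unfolding assms(2) span_finite[OF assms(1)] by blast
  define c where "c \<beta> = (\<Sum>b | b \<in> B \<and> coset K b = \<beta>. u b)" for \<beta>
  define g where "g \<beta> = (\<Sum>b | b \<in> B \<and> coset K b = \<beta>. u b *\<^sub>R b)" for \<beta>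
  have gJ: "g \<beta> \<in> J" for \<beta>
    unfolding g_def using BJ assms(1) by (intro sum_in_J subspace_scale[OF subspace_J]) auto
  have cg: "c \<beta> \<odot>\<^bsub>Q\<^esub> \<beta> = coset K (g \<beta>)" if "\<beta> \<in> coset K ` B" for \<beta>
  proof -
    obtain b0 where b0: "b0 \<in> B" "\<beta> = coset K b0" using \<open>\<beta> \<in> _\<close> by auto
    have "c \<beta> *\<^sub>R b0 - g \<beta> = (\<Sum>b | b \<in> B \<and> coset K b = \<beta>. u b *\<^sub>R (b0 - b))"
      by (simp add: c_def g_def scaleR_sum_left scaleR_right_diff_distrib sum_subtractf)
    also have "\<dots> \<in> K"
    proof (intro subspace_sum[OF subspace_K] subspace_scale[OF subspace_K])
      fix b assume "b \<in> {b \<in> B. coset K b = \<beta>}"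
      then have "coset K b0 = coset K b" using b0(2) by blast
      then show "b0 - b \<in> K" by (simp only: coset_eq)
    qed
    finally show ?thesis unfolding b0(2) smult_Q coset_eq .
  qed
  interpret abelian_group Q by (rule abelian_group_Q)
  have "(\<Oplus>\<^bsub>Q\<^esub>\<beta>\<in>coset K ` B. c \<beta> \<odot>\<^bsub>Q\<^esub> \<beta>) = (\<Oplus>\<^bsub>Q\<^esub>\<beta>\<in>coset K ` B. coset K (g \<beta>))"
    using gJ cg by (intro finsum_cong') (auto intro: coset_K_in)
  also have "\<dots> = coset K (\<Sum>\<beta>\<in>coset K ` B. g \<beta>)"
    using gJ assms(1) by (intro finsum_Q) auto
  also have "(\<Sum>\<beta>\<in>coset K ` B. g \<beta>) = v"
    unfolding u g_def by (rule sum.image_gen[OF assms(1), symmetric])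
  finally show "\<exists>c. V = (\<Oplus>\<^bsub>Q\<^esub>\<beta>\<in>coset K ` B. c \<beta> \<odot>\<^bsub>Q\<^esub> \<beta>)" using V by metis
qed

subsection \<open>Submodules of a quotient\<close>

lemma submodule_coset_image:
  assumes W: "subspace W" "W \<subseteq> J"
  shows "submodule (coset K ` W) real_ring Q"
proof (rule module.submoduleI[OF module_Q])
  show "coset K ` W \<subseteq> carrier Q" using W by (auto intro: coset_K_in)
  show zero: "\<zero>\<^bsub>Q\<^esub> \<in> coset K ` W" unfolding zero_Q using subspace_0[OF W(1)] by (rule imageI)
  show add: "a \<oplus>\<^bsub>Q\<^esub> b \<in> coset K ` W" if "a \<in> coset K ` W" "b \<in> coset K ` W" for a b
    using that subspace_add[OF W(1)] by (elim imageE) (simp only: add_Q imageI)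
  show smult: "a \<odot>\<^bsub>Q\<^esub> x \<in> coset K ` W" if "x \<in> coset K ` W" for a x
    using that subspace_scale[OF W(1)] by (elim imageE) (simp only: smult_Q imageI)
  interpret abelian_group Q by (rule abelian_group_Q)
  show "\<ominus>\<^bsub>Q\<^esub> a \<in> coset K ` W" if "a \<in> coset K ` W" for a
  proof -
    obtain w where w: "w \<in> W" "a = coset K w" using \<open>a \<in> _\<close> by auto
    have "\<ominus>\<^bsub>Q\<^esub> a = coset K (- w)"
      using w W subspace_neg[OF W(1), of w]
      by (intro minus_equality) (auto simp only: add_Q zero_Q add.left_inverse intro: coset_K_in)
    then show ?thesis using subspace_neg[OF W(1) w(1)] by (simp only: imageI)
  qed
qed

lemma submodule_preimage:
  assumes "submodule M real_ring Q"
  shows "subspace {x \<in> J. coset K x \<in> M}" and "K \<subseteq> {x \<in> J. coset K x \<in> M}"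
    and "coset K ` {x \<in> J. coset K x \<in> M} = M"
proof -
  note E = module.submoduleE[OF module_Q assms]
  have zero: "coset K 0 \<in> M"
    using subgroup.one_closed[OF submodule.axioms(1)[OF assms]] by (simp add: zero_Q)
  show "subspace {x \<in> J. coset K x \<in> M}"
  proof (rule subspaceI)
    show "0 \<in> {x \<in> J. coset K x \<in> M}" using zero subspace_0[OF subspace_J] by blast
    show "x + y \<in> {x \<in> J. coset K x \<in> M}" if "x \<in> {x \<in> J. coset K x \<in> M}" "y \<in> {x \<in> J. coset K x \<in> M}" for x y
      using that E(5)[of "coset K x" "coset K y"] subspace_add[OF subspace_J] by (simp only: add_Q mem_Collect_eq simp_thms)
    show "c *\<^sub>R x \<in> {x \<in> J. coset K x \<in> M}" if "x \<in> {x \<in> J. coset K x \<in> M}" for c x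
      using that E(4)[of c "coset K x"] subspace_scale[OF subspace_J] by (simp only: smult_Q mem_Collect_eq simp_thms) (simp add: real_ring_def)
  qed
  show "K \<subseteq> {x \<in> J. coset K x \<in> M}"
  proof
    fix k assume "k \<in> K"
    then have "coset K k = coset K 0" unfolding coset_eq by simp
    then show "k \<in> {x \<in> J. coset K x \<in> M}" using zero \<open>k \<in> K\<close> K_subset_J by auto
  qed
  show "coset K ` {x \<in> J. coset K x \<in> M} = M" using E(1) by (auto simp: carrier_Q)
qed

lemma coset_image_eq_iff:
  assumes "subspace W" "K \<subseteq> W" "x \<in> J"
  shows "coset K x \<in> coset K ` W \<longleftrightarrow> x \<in> W"
proof
  assume "coset K x \<in> coset K ` W"
  then obtain w where w: "w \<in> W" "coset K x = coset K w" by blast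
  then have "x - w \<in> W" using assms(2) by (auto simp only: coset_eq)
  then show "x \<in> W" using w(1) subspace_add[OF assms(1), of "x - w" w] by simp
qed blast

lemma set_add_coset_image:
  "coset K ` V <+>\<^bsub>Q\<^esub> coset K ` W = coset K ` (V +\<^sub>s W)"
proof -
  have "coset K ` V <+>\<^bsub>Q\<^esub> coset K ` W = {coset K v \<oplus>\<^bsub>Q\<^esub> coset K w | v w. v \<in> V \<and> w \<in> W}"
    unfolding set_add_def' by blast
  also have "\<dots> = coset K ` (V +\<^sub>s W)" unfolding add_Q ssum_def by blast
  finally show ?thesis .
qed

end

context lie_algebra
begin

lemma subspace_pairI: "lie_ideal br J \<Longrightarrow> lie_ideal br K \<Longrightarrow> K \<subseteq> J \<Longrightarrow> subspace_pair J K"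
  by (simp add: subspace_pair_def ideal_subspace)

lemma ad_coset: "lie_ideal br K \<Longrightarrow> ind1 K (br x) (coset K v) = coset K (br x v)"
  using ideal_right[of K] by (intro ind1_coset linear_br_right ideal_subspace) auto

lemma invariant_submodule_quot_iff:
  assumes J: "lie_ideal br J" and K: "lie_ideal br K" "K \<subseteq> J"
  shows "invariant_submodule UNIV (\<lambda>x. ind1 K (br x)) (quot br J K) M \<longleftrightarrow>
    (\<exists>W. lie_ideal br W \<and> K \<subseteq> W \<and> W \<subseteq> J \<and> M = coset K ` W)"
proof
  interpret subspace_pair br J K using subspace_pairI[OF J K] .
  assume "invariant_submodule UNIV (\<lambda>x. ind1 K (br x)) Q M"
  then have M: "submodule M real_ring Q" and inv: "\<And>x V. V \<in> M \<Longrightarrow> ind1 K (br x) V \<in> M"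
    by (auto simp: invariant_submodule_def)
  let ?W = "{x \<in> J. coset K x \<in> M}"
  have "br x y \<in> ?W" if "y \<in> ?W" for x y
    using that inv[of "coset K y" x] ideal_right[OF J] by (simp add: ad_coset[OF K(1)])
  then have "lie_ideal br ?W" using submodule_preimage(1)[OF M] by (intro idealI)
  then show "\<exists>W. lie_ideal br W \<and> K \<subseteq> W \<and> W \<subseteq> J \<and> M = coset K ` W"
    using submodule_preimage(2,3)[OF M] by (intro exI[of _ ?W]) auto
next
  interpret subspace_pair br J K using subspace_pairI[OF J K] .
  assume "\<exists>W. lie_ideal br W \<and> K \<subseteq> W \<and> W \<subseteq> J \<and> M = coset K ` W"
  then obtain W where W: "lie_ideal br W" "W \<subseteq> J" "M = coset K ` W" by blast
  then show "invariant_submodule UNIV (\<lambda>x. ind1 K (br x)) Q M"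
    using submodule_coset_image[OF ideal_subspace[OF W(1)] W(2)] ideal_right[OF W(1)]
    by (auto simp: invariant_submodule_def ad_coset[OF K(1)])
qed

text \<open>
  The correspondence between the submodules of \<open>J / K\<close> and the ideals between \<open>K\<close> and \<open>J\<close> respects
  intersections and sums.
\<close>

lemma semisimple_quot_iff:
  assumes J: "lie_ideal br J" and K: "lie_ideal br K" "K \<subseteq> J"
  shows "semisimple_quot br J K \<longleftrightarrow> completely_reducible J K"
proof -
  interpret subspace_pair br J K using subspace_pairI[OF J K] .
  have zero: "{\<zero>\<^bsub>Q\<^esub>} = coset K ` K"
  proof -
    have "coset K k = coset K 0" if "k \<in> K" for k using that by (simp add: coset_eq)
    then show ?thesis
      using subspace_0[OF ideal_subspace[OF K(1)]] unfolding zero_Q by blast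
  qed
  have inj: "coset K ` V = coset K ` W \<longleftrightarrow> V = W"
    if "lie_ideal br V" "K \<subseteq> V" "V \<subseteq> J" "lie_ideal br W" "K \<subseteq> W" "W \<subseteq> J" for V W
  proof
    assume eq: "coset K ` V = coset K ` W"
    have "x \<in> V \<longleftrightarrow> x \<in> W" if "x \<in> J" for x
      using coset_image_eq_iff[OF ideal_subspace[OF \<open>lie_ideal br V\<close>] \<open>K \<subseteq> V\<close> that]
        coset_image_eq_iff[OF ideal_subspace[OF \<open>lie_ideal br W\<close>] \<open>K \<subseteq> W\<close> that] eq by blast
    then show "V = W" using \<open>V \<subseteq> J\<close> \<open>W \<subseteq> J\<close> by blast
  qed simp
  have Int: "coset K ` V \<inter> coset K ` W = coset K ` (V \<inter> W)"
    if "W \<subseteq> J" "lie_ideal br V" "K \<subseteq> V" for V W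
    using that coset_image_eq_iff[OF ideal_subspace[OF that(2)] that(3)] by blast
  have carrier: "carrier Q = coset K ` J" by (rule carrier_Q)
  have key: "coset K ` W \<inter> coset K ` W' = {\<zero>\<^bsub>Q\<^esub>} \<and> coset K ` W <+>\<^bsub>Q\<^esub> coset K ` W' = carrier Q
      \<longleftrightarrow> W \<inter> W' = K \<and> W +\<^sub>s W' = J"
    if W: "lie_ideal br W" "K \<subseteq> W" "W \<subseteq> J" and W': "lie_ideal br W'" "K \<subseteq> W'" "W' \<subseteq> J" for W W'
  proof -
    have s: "lie_ideal br (W +\<^sub>s W')" "K \<subseteq> W +\<^sub>s W'" "W +\<^sub>s W' \<subseteq> J"
      using ideal_ssum W W' ssum_left[OF ideal_subspace[OF W'(1)], of W] ssum_least[OF ideal_subspace[OF J]] by auto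
    have "coset K ` (W \<inter> W') = coset K ` K \<longleftrightarrow> W \<inter> W' = K"
      using W W' K by (intro inj ideal_Int) auto
    moreover have "coset K ` (W +\<^sub>s W') = coset K ` J \<longleftrightarrow> W +\<^sub>s W' = J"
      using s J K by (intro inj) auto
    ultimately show ?thesis
      by (simp add: zero Int[OF W'(3) W(1,2)] set_add_coset_image carrier)
  qed
  show ?thesis
    unfolding semisimple_quot_def semisimple_module_def invariant_submodule_quot_iff[OF J K]
      completely_reducible_def
  proof (intro iffI allI impI)
    fix W assume L: "\<forall>M. (\<exists>W. lie_ideal br W \<and> K \<subseteq> W \<and> W \<subseteq> J \<and> M = coset K ` W) \<longrightarrow>
      (\<exists>M'. (\<exists>W. lie_ideal br W \<and> K \<subseteq> W \<and> W \<subseteq> J \<and> M' = coset K ` W) \<and>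
        M \<inter> M' = {\<zero>\<^bsub>Q\<^esub>} \<and> M <+>\<^bsub>Q\<^esub> M' = carrier Q)"
      and W: "lie_ideal br W \<and> K \<subseteq> W \<and> W \<subseteq> J"
    have "\<exists>W0. lie_ideal br W0 \<and> K \<subseteq> W0 \<and> W0 \<subseteq> J \<and> coset K ` W = coset K ` W0"
      using W by (intro exI[of _ W]) simp
    from L[rule_format, OF this] obtain W' where W': "lie_ideal br W'" "K \<subseteq> W'" "W' \<subseteq> J"
      "coset K ` W \<inter> coset K ` W' = {\<zero>\<^bsub>Q\<^esub>} \<and> coset K ` W <+>\<^bsub>Q\<^esub> coset K ` W' = carrier Q"
      by (elim exE conjE) simp
    have "W \<inter> W' = K \<and> W +\<^sub>s W' = J"
      by (rule key[THEN iffD1, OF _ _ _ W'(1-4)]) (simp_all add: W)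
    then show "\<exists>W'. lie_ideal br W' \<and> K \<subseteq> W' \<and> W' \<subseteq> J \<and> W \<inter> W' = K \<and> W +\<^sub>s W' = J"
      using W' by (intro exI[of _ W']) simp
  next
    fix M assume R: "\<forall>W. lie_ideal br W \<and> K \<subseteq> W \<and> W \<subseteq> J \<longrightarrow>
      (\<exists>W'. lie_ideal br W' \<and> K \<subseteq> W' \<and> W' \<subseteq> J \<and> W \<inter> W' = K \<and> W +\<^sub>s W' = J)"
      and "\<exists>W. lie_ideal br W \<and> K \<subseteq> W \<and> W \<subseteq> J \<and> M = coset K ` W"
    then obtain W where W: "lie_ideal br W" "K \<subseteq> W" "W \<subseteq> J" "M = coset K ` W" by blast
    then obtain W' where W': "lie_ideal br W'" "K \<subseteq> W'" "W' \<subseteq> J" "W \<inter> W' = K \<and> W +\<^sub>s W' = J"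
      using R by blast
    show "\<exists>M'. (\<exists>W. lie_ideal br W \<and> K \<subseteq> W \<and> W \<subseteq> J \<and> M' = coset K ` W) \<and>
        M \<inter> M' = {\<zero>\<^bsub>Q\<^esub>} \<and> M <+>\<^bsub>Q\<^esub> M' = carrier Q"
    proof (intro exI conjI)
      show "lie_ideal br W'" "K \<subseteq> W'" "W' \<subseteq> J" by (fact W')+
      note k = key[THEN iffD2, OF W(1-3) W']
      show "M \<inter> coset K ` W' = {\<zero>\<^bsub>Q\<^esub>}" using k unfolding W(4) by (rule conjunct1)
      show "M <+>\<^bsub>Q\<^esub> coset K ` W' = carrier Q" using k unfolding W(4) by (rule conjunct2)
    qed (rule refl)
  qed
qed

subsection \<open>Solvable ideals in semi-simple quotients\<close>

text \<open>
  Modulo \<open>K\<close>, the ideal \<open>A\<close> is the direct sum of the ideal \<open>[A, A]\<close> and a complement \<open>Z\<close>. The brackets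
  of \<open>A\<close> with \<open>Z\<close> lie in both summands and vanish, so \<open>[A, A]\<close> is perfect modulo \<open>K\<close>. It is
  therefore contained, modulo \<open>K\<close>, in every term of the derived series.
\<close>

lemma solvable_in_completely_reducible:
  assumes K: "lie_ideal br K" and J: "lie_ideal br J" "K \<subseteq> J" and cr: "completely_reducible J K"
    and A: "lie_ideal br A" "A \<subseteq> J" and solv: "derived n A = {0}"
  shows "lie_prod br A A \<subseteq> K"
proof -
  note sub = ideal_subspace
  let ?A' = "lie_prod br A A"
  have A': "lie_ideal br ?A'" "?A' \<subseteq> A"
    using ideal_lie_prod[OF A(1) A(1)] derived_decreasing[OF A(1), of 0] by auto
  let ?W = "?A' +\<^sub>s K"
  have W: "lie_ideal br ?W" "K \<subseteq> ?W" "?W \<subseteq> J" "?A' \<subseteq> ?W"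
    using ideal_ssum[OF A'(1) K] ssum_right[OF sub[OF A'(1)], of K] A' A(2) J
      ssum_least[OF sub[OF J(1)], of ?A' K] ssum_left[OF sub[OF K], of ?A'] by auto
  obtain Z where Z: "lie_ideal br Z" "K \<subseteq> Z" "?W \<inter> Z = K" "?W +\<^sub>s Z = J"
    using completely_reducibleD[OF cr W(1-3)] by metis
  let ?B = "A +\<^sub>s K"
  have B: "lie_ideal br ?B" using A K by (intro ideal_ssum)
  have WB: "?W \<subseteq> ?B" using A'(2) by (intro ssum_mono) auto
  have brB: "br x y \<in> ?W" if xy: "x \<in> ?B" "y \<in> ?B" for x y
  proof -
    obtain a k b l where x: "x = a + k" "y = b + l" "a \<in> A" "b \<in> A" "k \<in> K" "l \<in> K"
      using xy unfolding ssum_def by blast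
    have "br x y = br a b + (br a l + br k y)" by (simp add: x br_simps)
    then show ?thesis
      using x ideal_left[OF K] ideal_right[OF K] subspace_add[OF sub[OF K]]
      by (simp add: ssum_mem lie_prod_base)
  qed
  have split: "\<exists>w z. a = w + z \<and> w \<in> ?W \<and> z \<in> Z \<and> z \<in> ?B" if a: "a \<in> A" for a
  proof -
    have "a \<in> ?W +\<^sub>s Z" using a A(2) Z(4) by blast
    then obtain w z where wz: "a = w + z" "w \<in> ?W" "z \<in> Z" unfolding ssum_def[of ?W Z] by blast
    have "a \<in> ?B" using a ssum_left[OF sub[OF K], of A] by blast
    then have "a - w \<in> ?B" using wz WB sub[OF B] by (intro subspace_diff) auto
    then show ?thesis using wz by auto
  qed
  have brZ: "br x y \<in> K" if "x \<in> ?B" "y \<in> ?B" "x \<in> Z \<or> y \<in> Z" for x y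
    using brB[OF that(1,2)] that(3) Z(3) ideal_left[OF Z(1), of x y] ideal_right[OF Z(1), of y x] by blast
  have "?A' \<subseteq> derived (Suc m) A +\<^sub>s K" for m
  proof (induction m)
    case 0
    then show ?case using W(4) by simp
  next
    case (Suc m)
    let ?D = "derived (Suc m) A"
    have D: "lie_ideal br ?D" by (rule ideal_derived[OF A(1)])
    have T: "subspace (derived (Suc (Suc m)) A +\<^sub>s K)"
      by (intro subspace_ssum sub K ideal_derived A)
    have DK: "?W \<subseteq> ?D +\<^sub>s K"
      using Suc.IH sub[OF D] sub[OF K] ssum_right[of ?D K] by (intro ssum_least subspace_ssum) auto
    show ?case
    proof (rule lie_prod_subsetI[OF T])
      fix a b assume ab: "a \<in> A" "b \<in> A"
      obtain w z where a: "a = w + z" "w \<in> ?W" "z \<in> Z" "z \<in> ?B" using split[OF ab(1)] by blast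
      obtain w' z' where b: "b = w' + z'" "w' \<in> ?W" "z' \<in> Z" "z' \<in> ?B" using split[OF ab(2)] by blast
      have "w \<in> ?D +\<^sub>s K" "w' \<in> ?D +\<^sub>s K" using a(2) b(2) DK by blast+
      then obtain d k d' k' where w: "w = d + k" "d \<in> ?D" "k \<in> K"
        and w': "w' = d' + k'" "d' \<in> ?D" "k' \<in> K"
        unfolding ssum_def by blast
      have bB: "b \<in> ?B" using ab(2) ssum_left[OF sub[OF K], of A] by blast
      have "br a b = br d d' + ((br d k' + br k w') + (br w z' + br z b))"
        by (simp add: a(1) b(1) w(1) w'(1) br_simps)
      moreover have "br d d' \<in> derived (Suc (Suc m)) A"
        using w(2) w'(2) unfolding derived_Suc[of "Suc m"] by (rule lie_prod_base)
      moreover have "(br d k' + br k w') + (br w z' + br z b) \<in> K"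
        using w w' a b WB bB brZ[of w z'] brZ[of z b] ideal_left[OF K] ideal_right[OF K]
        by (intro subspace_add[OF sub[OF K]]) auto
      ultimately show "br a b \<in> derived (Suc (Suc m)) A +\<^sub>s K" by (simp only: ssum_mem)
    qed
  qed
  from this[of n] have "?A' \<subseteq> lie_prod br {0} {0} +\<^sub>s K" using solv by simp
  moreover have "lie_prod br {0} {0} +\<^sub>s K \<subseteq> K"
    using subspace_0[OF sub[OF K]] by (intro ssum_least lie_prod_subsetI sub K) (auto simp: br_simps)
  ultimately show ?thesis by blast
qed

end

section \<open>The canonical ideal\<close>

declare S_ideal.simps(2) [simp del] R_ideal.simps(2) [simp del]

context metric_lie_algebra
begin

lemma socle_over_iff:
  assumes "lie_ideal br K"
  shows "lie_ideal br J \<and> K \<subseteq> J \<and> semisimple_quot br J K \<longleftrightarrow> socle_over K J"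
  using assms semisimple_quot_iff[of J K] by (auto simp: socle_over_def)

lemma S_ideal_step:
  assumes "lie_ideal br (S_ideal br k)"
  shows "socle_over (S_ideal br k) (S_ideal br (Suc k))"
    and "socle_over (S_ideal br k) J \<Longrightarrow> J \<subseteq> S_ideal br (Suc k)"
proof -
  obtain M where M: "socle_over (S_ideal br k) M" "\<And>J. socle_over (S_ideal br k) J \<Longrightarrow> J \<subseteq> M"
    using greatest_socle_over[OF assms] by metis
  have "S_ideal br (Suc k) = M"
    unfolding S_ideal.simps socle_over_iff[OF assms] using M by (intro Greatest_equality)
  then show "socle_over (S_ideal br k) (S_ideal br (Suc k))"
    and "socle_over (S_ideal br k) J \<Longrightarrow> J \<subseteq> S_ideal br (Suc k)"
    using M by auto
qed

lemma ideal_S: "lie_ideal br (S_ideal br k)"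
proof (induction k)
  case 0
  then show ?case by (auto intro: idealI simp: br_simps)
next
  case (Suc k)
  then show ?case using S_ideal_step(1)[OF Suc.IH] by (simp add: socle_over_def)
qed

lemma S_Suc: "socle_over (S_ideal br k) (S_ideal br (Suc k))"
  and S_greatest: "socle_over (S_ideal br k) J \<Longrightarrow> J \<subseteq> S_ideal br (Suc k)"
  using S_ideal_step[OF ideal_S] by blast+

lemma S_mono: "k \<le> l \<Longrightarrow> S_ideal br k \<subseteq> S_ideal br l"
proof (erule lift_Suc_mono_le[rotated])
  show "S_ideal br n \<subseteq> S_ideal br (Suc n)" for n using S_Suc[of n] by (simp add: socle_over_def)
qed

text \<open>
  Taking orthogonal complements exchanges the ideals \<open>J \<supseteq> S\<^sub>k\<close> with semi-simple \<open>J / S\<^sub>k\<close> and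
  the ideals \<open>J \<subseteq> S\<^sub>k\<^sup>\<bottom>\<close> with semi-simple \<open>S\<^sub>k\<^sup>\<bottom> / J\<close>.
\<close>

lemma R_eq_orth_S: "R_ideal br k = orth ip (S_ideal br k)"
proof (induction k)
  case 0
  then show ?case by (simp add: orth_zero)
next
  case (Suc k)
  let ?S = "S_ideal br k" and ?S' = "S_ideal br (Suc k)"
  have S': "lie_ideal br ?S'" "?S \<subseteq> ?S'" "completely_reducible ?S' ?S"
    using S_Suc by (auto simp: socle_over_def)
  have iff: "lie_ideal br J \<and> J \<subseteq> orth ip ?S \<and> semisimple_quot br (orth ip ?S) J
      \<longleftrightarrow> lie_ideal br J \<and> J \<subseteq> orth ip ?S \<and> completely_reducible (orth ip ?S) J" for J
    using semisimple_quot_iff[OF ideal_orth[OF ideal_S]] by blast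
  have "(LEAST J. lie_ideal br J \<and> J \<subseteq> orth ip ?S \<and> completely_reducible (orth ip ?S) J) = orth ip ?S'"
  proof (rule Least_equality)
    show "lie_ideal br (orth ip ?S') \<and> orth ip ?S' \<subseteq> orth ip ?S \<and> completely_reducible (orth ip ?S) (orth ip ?S')"
      using ideal_orth[OF S'(1)] orth_antimono[OF S'(2)] completely_reducible_orth[OF S'(1) ideal_S S'(3)]
      by blast
    fix J assume J: "lie_ideal br J \<and> J \<subseteq> orth ip ?S \<and> completely_reducible (orth ip ?S) J"
    have "socle_over ?S (orth ip J)"
      using J completely_reducible_orth[OF ideal_orth[OF ideal_S], of J k] ideal_orth[of J]
        orth_antimono[of J "orth ip ?S"] orth_orth[OF ideal_subspace[OF ideal_S[of k]]]
      by (simp add: socle_over_def)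
    then have "orth ip ?S' \<subseteq> orth ip (orth ip J)" by (intro orth_antimono S_greatest)
    then show "orth ip ?S' \<le> J" using J orth_orth[OF ideal_subspace] by simp
  qed
  then show ?case unfolding R_ideal.simps Suc.IH iff .
qed

lemma ideal_R: "lie_ideal br (R_ideal br k)"
  unfolding R_eq_orth_S by (rule ideal_orth[OF ideal_S])

lemma R_antimono: "k \<le> l \<Longrightarrow> R_ideal br l \<subseteq> R_ideal br k"
  unfolding R_eq_orth_S by (intro orth_antimono S_mono)

text \<open>
  An ideal of least dimension strictly above \<open>S\<^sub>k\<close> gives a simple quotient, so the chain grows
  strictly until it reaches the whole Lie algebra.
\<close>

lemma S_eq_UNIV: "\<exists>m. S_ideal br m = UNIV"
proof -
  have step: "S_ideal br k \<noteq> S_ideal br (Suc k)" if "S_ideal br k \<noteq> UNIV" for k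
  proof -
    let ?S = "S_ideal br k"
    let ?P = "\<lambda>J. lie_ideal br J \<and> ?S \<subseteq> J \<and> ?S \<noteq> J"
    have "?P UNIV" using that by (auto intro: idealI)
    then obtain J where J: "?P J" and min: "\<And>W. ?P W \<Longrightarrow> dim J \<le> dim W"
      using ex_has_least_nat[of ?P UNIV dim] by auto
    have "W = ?S \<or> W = J" if W: "lie_ideal br W" "?S \<subseteq> W" "W \<subseteq> J" for W
    proof (cases "W = ?S")
      case False
      then have "dim J \<le> dim W" using W min by blast
      then have "W = J" using fd.subspace_dim_equal[of W J] ideal_subspace W J by blast
      then show ?thesis ..
    qed simp
    then have "socle_over ?S J"
      using J completely_reducible_simple[OF ideal_S, of J k] by (auto simp: socle_over_def)
    then have "J \<subseteq> S_ideal br (Suc k)" by (rule S_greatest)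
    then show ?thesis using J by blast
  qed
  have "S_ideal br k = UNIV \<or> k \<le> dim (S_ideal br k)" for k
  proof (induction k)
    case (Suc k)
    let ?S = "S_ideal br k" and ?S' = "S_ideal br (Suc k)"
    have le: "?S \<subseteq> ?S'" by (rule S_mono) simp
    show ?case
    proof (cases "?S = UNIV")
      case True
      then show ?thesis using le by auto
    next
      case False
      then have "?S \<subset> ?S'" using step le by blast
      then have "dim ?S < dim ?S'"
        using fd.subspace_dim_equal[OF ideal_subspace[OF ideal_S] ideal_subspace[OF ideal_S] le] by fastforce
      then show ?thesis using Suc.IH False by simp
    qed
  qed simp
  from this[of "Suc (dim (UNIV :: 'g set))"] show ?thesis
    using fd.dim_subset[of "S_ideal br (Suc (dim (UNIV :: 'g set)))" UNIV] by (metis Suc_n_not_le_n le_trans subset_UNIV)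
qed

lemma minimal_ideal_subset_S1:
  assumes "minimal_ideal N"
  shows "N \<subseteq> S_ideal br 1"
proof -
  have N: "lie_ideal br N" "{0} \<subseteq> N"
    using assms by (auto simp: minimal_ideal_def intro: subspace_0 ideal_subspace)
  have "completely_reducible N {0}"
    using assms subspace_0[OF ideal_subspace]
    by (intro completely_reducible_simple N) (auto simp: minimal_ideal_def br_simps intro: idealI)
  then have "socle_over (S_ideal br 0) N" using N by (simp add: socle_over_def)
  then show ?thesis using S_greatest by (metis One_nat_def)
qed

subsection \<open>Solvability of the first radical\<close>

text \<open>
  Otherwise the \<open>\<kappa>\<close>-complement \<open>C\<close> of \<open>P\<close> is a proper ideal with \<open>\<gg> = P + C\<close>. A minimal ideal \<open>N\<close>
  orthogonal to \<open>C\<close> lies in \<open>S\<^sub>1\<close> and is thus orthogonal to \<open>P \<subseteq> R\<^sub>1\<close>, hence to everything.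
\<close>

lemma perfect_ideal_in_R1:
  assumes P: "lie_ideal br P" and perfect: "P \<subseteq> lie_prod br P P" and "P \<subseteq> R_ideal br 1"
  shows "P = {0}"
proof (rule ccontr)
  assume "P \<noteq> {0}"
  let ?C = "killing_perp P"
  have C: "lie_ideal br ?C" by (rule ideal_killing_perp[OF P])
  note c = perfect_ideal_killing_perp[OF P perfect \<open>P \<noteq> {0}\<close>]
  have "orth ip ?C \<noteq> {0}"
  proof
    assume "orth ip ?C = {0}"
    then have "?C = UNIV" using orth_orth[OF ideal_subspace[OF C]] orth_zero by simp
    then show False using c(1) by auto
  qed
  then obtain N where N: "minimal_ideal N" "N \<subseteq> orth ip ?C"
    using minimal_ideal_exists[OF ideal_orth[OF C]] by metis
  have "n = 0" if n: "n \<in> N" for n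
  proof (rule ip_nondegenerate)
    fix x
    obtain p where p: "p \<in> P" "x - p \<in> ?C" using c(2) by blast
    have "n \<in> S_ideal br 1" using n minimal_ideal_subset_S1[OF N(1)] by blast
    moreover have "p \<in> orth ip (S_ideal br 1)" using p(1) assms(3) R_eq_orth_S by blast
    ultimately have "ip p n = 0" by (rule orthD[rotated])
    moreover have "ip n (x - p) = 0" using n N(2) p(2) orthD by blast
    ultimately show "ip n x = 0" by (simp add: ip_simps ip_commute[of n p])
  qed
  then show False using N(1) by (auto simp: minimal_ideal_def intro: subspace_0 ideal_subspace)
qed

lemma R1_solvable: "\<exists>n. derived n (R_ideal br 1) = {0}"
proof -
  obtain n where n: "derived n (R_ideal br 1) \<subseteq> lie_prod br (derived n (R_ideal br 1)) (derived n (R_ideal br 1))"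
    using derived_stationary[OF ideal_R] by blast
  then have "derived n (R_ideal br 1) = {0}"
    by (intro perfect_ideal_in_R1 ideal_derived derived_subset ideal_R)
  then show ?thesis ..
qed

lemma derived_mono: "A \<subseteq> B \<Longrightarrow> derived n A \<subseteq> derived n B"
  by (induction n) (auto dest: lie_prod_mono[of _ _ _ _ br, rotated])

text \<open>
  If \<open>[S\<^sub>1, S\<^sub>1]\<close> is not zero, it contains a minimal ideal \<open>N\<close>, which is abelian. In a decomposition
  \<open>S\<^sub>1 = N \<oplus> Z\<close> into ideals, all brackets lie in \<open>Z\<close>, and so does \<open>N\<close>, which is absurd.
\<close>

lemma S1_abelian:
  assumes no_ss: "\<forall>J. lie_ideal br J \<and> semisimple_lie br J \<longrightarrow> J = {0}"
    and "x \<in> S_ideal br 1" "y \<in> S_ideal br 1"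
  shows "br x y = 0"
proof -
  let ?S = "S_ideal br 1"
  let ?P = "lie_prod br ?S ?S"
  note sub = ideal_subspace
  have P: "lie_ideal br ?P" by (intro ideal_lie_prod ideal_S)
  have "?P = {0}"
  proof (rule ccontr)
    assume "?P \<noteq> {0}"
    then obtain N where N: "minimal_ideal N" "N \<subseteq> ?P" using minimal_ideal_exists[OF P] by metis
    then have NI: "lie_ideal br N" "N \<noteq> {0}" by (auto simp: minimal_ideal_def)
    then have ab: "br a b = 0" if "a \<in> N" "b \<in> N" for a b
      using minimal_ideal_abelian_or_semisimple[OF N(1)] no_ss that by blast
    have NS: "N \<subseteq> ?S" by (rule minimal_ideal_subset_S1[OF N(1)])
    have "completely_reducible ?S {0}" using S_Suc[of 0] by (simp add: socle_over_def)
    moreover have "{0} \<subseteq> N" using subspace_0[OF sub[OF NI(1)]] by simp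
    ultimately obtain Z where Z: "lie_ideal br Z" "N \<inter> Z = {0}" "N +\<^sub>s Z = ?S"
      using completely_reducibleD[OF _ NI(1) _ NS] by metis
    have "?P \<subseteq> Z"
    proof (rule lie_prod_subsetI[OF sub[OF Z(1)]])
      fix a b assume "a \<in> ?S" "b \<in> ?S"
      then have "a \<in> N +\<^sub>s Z" "b \<in> N +\<^sub>s Z" using Z(3) by simp_all
      then obtain n z n' z' where w: "a = n + z" "b = n' + z'" "n \<in> N" "z \<in> Z" "n' \<in> N" "z' \<in> Z"
        unfolding ssum_def by blast
      have "br a b = br n n' + (br n z' + br z b)" by (simp add: w br_simps)
      moreover have "br n z' + br z b \<in> Z"
        using w ideal_left[OF Z(1)] ideal_right[OF Z(1)] by (intro subspace_add sub Z) auto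
      ultimately show "br a b \<in> Z" using ab w by simp
    qed
    then show False using N(2) Z(2) NI subspace_0[OF sub[OF NI(1)]] by blast
  qed
  then show ?thesis using lie_prod_base[OF assms(2,3), of br] by simp
qed

subsection \<open>The orthogonal complement of the canonical ideal\<close>

abbreviation can :: "'g set" where
  "can \<equiv> canonical_ideal br"

lemma can_base: "k \<ge> 1 \<Longrightarrow> x \<in> S_ideal br k \<Longrightarrow> x \<in> R_ideal br k \<Longrightarrow> x \<in> can"
  unfolding canonical_ideal_def by (intro span_base) auto

lemma ideal_can: "lie_ideal br can"
proof (rule idealI)
  show "subspace can" by (simp add: canonical_ideal_def)
  fix x y assume y: "y \<in> can"
  have "subspace {y. br x y \<in> can}"
    unfolding canonical_ideal_def
    by (intro subspaceI) (auto simp: br_simps span_zero span_add span_scale)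
  moreover have "br x y \<in> can" if "k \<ge> 1" "y \<in> S_ideal br k \<inter> R_ideal br k" for y k
    using that ideal_right[OF ideal_S] ideal_right[OF ideal_R] by (intro can_base[of k]) auto
  ultimately have "can \<subseteq> {y. br x y \<in> can}"
    unfolding canonical_ideal_def[of br] by (intro span_minimal) (auto simp: canonical_ideal_def)
  then show "br x y \<in> can" using y by blast
qed

lemma orth_can: "orth ip can = (\<Inter>k\<in>{1..}. S_ideal br k +\<^sub>s R_ideal br k)"
proof -
  have "orth ip (span X) = orth ip X" for X
  proof
    show "orth ip (span X) \<subseteq> orth ip X" by (intro orth_antimono span_superset)
    have "ip x w = 0" if "x \<in> orth ip X" "w \<in> span X" for x w
    proof -
      have "subspace {w. ip x w = 0}" by (intro subspaceI) (auto simp: ip_simps)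
      then have "span X \<subseteq> {w. ip x w = 0}" using that(1) by (intro span_minimal) (auto simp: orth_def)
      then show ?thesis using that(2) by blast
    qed
    then show "orth ip X \<subseteq> orth ip (span X)" by (auto simp: orth_def)
  qed
  then have "orth ip can = (\<Inter>k\<in>{1..}. orth ip (S_ideal br k \<inter> R_ideal br k))"
    unfolding canonical_ideal_def by (auto simp: orth_def)
  moreover have "orth ip (S_ideal br k \<inter> R_ideal br k) = S_ideal br k +\<^sub>s R_ideal br k" for k
  proof -
    have s: "subspace (S_ideal br k)" by (rule ideal_subspace[OF ideal_S])
    have "orth ip (S_ideal br k \<inter> R_ideal br k) = R_ideal br k +\<^sub>s S_ideal br k"
      unfolding R_eq_orth_S orth_Int[OF s subspace_orth] orth_orth[OF s] by (rule refl)
    then show ?thesis by (auto simp: ssum_def) (metis add.commute)+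
  qed
  ultimately show ?thesis by simp
qed

text \<open>
  For \<open>k \<le> l\<close> the inclusion \<open>R\<^sub>l \<subseteq> R\<^sub>k\<close> is used, for \<open>l < k\<close> the inclusion \<open>S\<^sub>l \<subseteq> S\<^sub>k\<close>.
\<close>

lemma can_isotropic: "can \<subseteq> orth ip can"
proof -
  have "S_ideal br l \<inter> R_ideal br l \<subseteq> S_ideal br k +\<^sub>s R_ideal br k" for k l
  proof (cases "k \<le> l")
    case True
    then show ?thesis using R_antimono ssum_right[OF ideal_subspace[OF ideal_S]] by blast
  next
    case False
    then show ?thesis using S_mono[of l k] ssum_left[OF ideal_subspace[OF ideal_R]] by auto
  qed
  then show ?thesis
    unfolding canonical_ideal_def[of br]
    by (intro span_minimal subspace_orth) (unfold canonical_ideal_def[symmetric] orth_can, blast)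
qed

definition layer :: "nat \<Rightarrow> 'g set" where
  "layer k = S_ideal br (Suc k) \<inter> R_ideal br k"

primrec layers :: "nat \<Rightarrow> 'g set" where
  "layers 0 = {0}"
| "layers (Suc m) = layers m +\<^sub>s layer m"

lemma ideal_layer: "lie_ideal br (layer k)"
  unfolding layer_def by (intro ideal_Int ideal_S ideal_R)

lemma layers_subset_S: "layers m \<subseteq> S_ideal br m"
proof (induction m)
  case (Suc m)
  show ?case
    using Suc.IH S_mono[of m "Suc m"] unfolding layers.simps layer_def
    by (intro ssum_least ideal_subspace ideal_S) auto
qed simp

text \<open>
  The modular law: \<open>R\<^sub>m \<inter> (S\<^bsub>m+1\<^esub> + R\<^bsub>m+1\<^esub>)\<close> is the sum of the layer \<open>S\<^bsub>m+1\<^esub> \<inter> R\<^sub>m\<close> and \<open>R\<^bsub>m+1\<^esub>\<close>.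
\<close>

lemma orth_can_subset_layers: "orth ip can \<subseteq> layers m +\<^sub>s R_ideal br m"
proof (induction m)
  case 0
  show ?case by (auto simp: ssum_def)
next
  case (Suc m)
  show ?case
  proof
    fix x assume x: "x \<in> orth ip can"
    then obtain a r where ar: "x = a + r" "a \<in> layers m" "r \<in> R_ideal br m"
      using Suc.IH by (auto simp: ssum_def)
    have "x \<in> S_ideal br (Suc m) +\<^sub>s R_ideal br (Suc m)" using x by (simp add: orth_can)
    then obtain s r' where s: "x = s + r'" "s \<in> S_ideal br (Suc m)" "r' \<in> R_ideal br (Suc m)"
      unfolding ssum_def by blast
    have "a \<in> S_ideal br (Suc m)" using ar(2) layers_subset_S S_mono[of m "Suc m"] by auto
    then have "s - a \<in> S_ideal br (Suc m)" using s(2) by (intro subspace_diff ideal_subspace ideal_S)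
    moreover have "r' \<in> R_ideal br m" using s(3) R_antimono[of m "Suc m"] by auto
    then have "r - r' \<in> R_ideal br m" using ar(3) by (intro subspace_diff ideal_subspace ideal_R)
    moreover have "s - a = r - r'" using ar(1) s(1) by (simp add: algebra_simps)
    ultimately have "s - a \<in> layer m" by (simp add: layer_def)
    then have "a + (s - a) \<in> layers (Suc m)" unfolding layers.simps by (rule ssum_mem[OF ar(2)])
    then show "x \<in> layers (Suc m) +\<^sub>s R_ideal br (Suc m)"
      using ssum_mem[OF _ s(3), of "a + (s - a)"] s(1) by simp
  qed
qed

lemma orth_can_eq_layers: "\<exists>m. orth ip can \<subseteq> layers m"
proof -
  obtain m where "S_ideal br m = UNIV" using S_eq_UNIV ..
  then have "R_ideal br m = {0}" by (simp add: R_eq_orth_S orth_UNIV)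
  then have "orth ip can \<subseteq> layers m" using orth_can_subset_layers[of m] by (auto simp: ssum_def)
  then show ?thesis ..
qed

lemma br_layers_in_can_aux:
  assumes "k < l" "x \<in> layer k" "y \<in> layer l"
  shows "br x y \<in> can"
proof (rule can_base[of "Suc k"])
  show "br x y \<in> S_ideal br (Suc k)" using assms ideal_left[OF ideal_S] by (simp add: layer_def)
  have "y \<in> R_ideal br (Suc k)" using assms R_antimono[of "Suc k" l] by (auto simp: layer_def)
  then show "br x y \<in> R_ideal br (Suc k)" by (rule ideal_right[OF ideal_R])
qed simp

lemma br_layers_in_can:
  assumes no_ss: "\<forall>J. lie_ideal br J \<and> semisimple_lie br J \<longrightarrow> J = {0}"
    and x: "x \<in> layer k" and y: "y \<in> layer l"
  shows "br x y \<in> can"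
proof -
  consider "k < l" | "l < k" | "k = l" "k = 0" | "k = l" "k \<ge> 1" by linarith
  then show ?thesis
  proof cases
    case 1
    then show ?thesis using br_layers_in_can_aux x y by blast
  next
    case 2
    then have "br y x \<in> can" using br_layers_in_can_aux x y by blast
    then show ?thesis using subspace_neg[OF ideal_subspace[OF ideal_can]] br_antisym[of x y] by metis
  next
    case 3
    then have "br x y = 0" using S1_abelian[OF no_ss, of x y] x y by (simp add: layer_def)
    then show ?thesis using subspace_0[OF ideal_subspace[OF ideal_can]] by simp
  next
    case 4
    have sub: "layer k \<subseteq> R_ideal br 1" using R_antimono[OF 4(2)] by (auto simp: layer_def)
    obtain n where "derived n (R_ideal br 1) = {0}" using R1_solvable ..
    then have "derived n (layer k) = {0}"
      using derived_mono[OF sub, of n] subspace_0[OF ideal_subspace[OF ideal_derived[OF ideal_layer]]] by blast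
    moreover have "lie_ideal br (S_ideal br (Suc k))" "S_ideal br k \<subseteq> S_ideal br (Suc k)"
      "completely_reducible (S_ideal br (Suc k)) (S_ideal br k)"
      using S_Suc[of k] by (auto simp: socle_over_def)
    ultimately have "lie_prod br (layer k) (layer k) \<subseteq> S_ideal br k"
      using ideal_layer by (intro solvable_in_completely_reducible[OF ideal_S]) (auto simp: layer_def)
    then have "br x y \<in> S_ideal br k" using x y 4 lie_prod_base by blast
    moreover have "br x y \<in> R_ideal br k" using x ideal_left[OF ideal_R] by (simp add: layer_def)
    ultimately show ?thesis using can_base 4 by blast
  qed
qed

theorem orth_can_abelian:
  assumes no_ss: "\<forall>J. lie_ideal br J \<and> semisimple_lie br J \<longrightarrow> J = {0}"
    and x: "x \<in> orth ip can" and y: "y \<in> orth ip can"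
  shows "br x y \<in> can"
proof -
  note sub = ideal_subspace[OF ideal_can]
  have 1: "br a b \<in> can" if "a \<in> layer k" "b \<in> layers m" for a b k m
    using that(2)
  proof (induction m arbitrary: b)
    case 0
    then show ?case using subspace_0[OF sub] by (simp add: br_simps)
  next
    case (Suc m)
    then obtain c d where "b = c + d" "c \<in> layers m" "d \<in> layer m" by (auto simp: ssum_def)
    then show ?case using Suc.IH br_layers_in_can[OF no_ss that(1)] by (simp add: br_simps subspace_add[OF sub])
  qed
  have 2: "br a b \<in> can" if "a \<in> layers m" "b \<in> layers n" for a b m n
    using that(1)
  proof (induction m arbitrary: a)
    case 0
    then show ?case using subspace_0[OF sub] by (simp add: br_simps)
  next
    case (Suc m)
    then obtain c d where "a = c + d" "c \<in> layers m" "d \<in> layer m" by (auto simp: ssum_def)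
    then show ?case using Suc.IH 1[OF _ that(2)] by (simp add: br_simps subspace_add[OF sub])
  qed
  obtain m where "orth ip can \<subseteq> layers m" using orth_can_eq_layers ..
  then show ?thesis using 2 x y by blast
qed

subsection \<open>Invariance under automorphisms\<close>

lemma orth_isometry:
  assumes "\<And>x. \<theta> (\<theta> x) = x" "\<And>x y. ip (\<theta> x) (\<theta> y) = ip x y"
    and "\<theta> ` W \<subseteq> W" "x \<in> orth ip W"
  shows "\<theta> x \<in> orth ip W"
  unfolding orth_def
proof (intro CollectI ballI)
  fix w assume "w \<in> W"
  then have "ip x (\<theta> w) = 0" using assms(3,4) orthD by blast
  then show "ip (\<theta> x) w = 0" using assms(2)[of x "\<theta> w"] by (simp add: assms(1))
qed

context
  fixes \<theta> :: "'g \<Rightarrow> 'g"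
  assumes lin: "linear \<theta>" and invol: "\<And>x. \<theta> (\<theta> x) = x"
    and hom: "\<And>x y. \<theta> (br x y) = br (\<theta> x) (\<theta> y)"
    and isom: "\<And>x y. ip (\<theta> x) (\<theta> y) = ip x y"
begin

lemma image_image_\<theta>: "\<theta> ` \<theta> ` X = X"
  by (simp add: image_image invol)

lemma inj_\<theta>: "inj \<theta>"
  by (metis injI invol)

lemma ideal_\<theta>: "lie_ideal br J \<Longrightarrow> lie_ideal br (\<theta> ` J)"
proof (rule idealI)
  assume J: "lie_ideal br J"
  show "subspace (\<theta> ` J)" using linear_subspace_image[OF lin] ideal_subspace[OF J] .
  fix x y assume "y \<in> \<theta> ` J"
  then obtain z where z: "z \<in> J" "y = \<theta> z" by blast
  have "br x y = \<theta> (br (\<theta> x) z)" by (simp add: hom invol z)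
  then show "br x y \<in> \<theta> ` J" using ideal_right[OF J z(1)] by simp
qed

lemma ssum_\<theta>: "\<theta> ` (V +\<^sub>s W) = \<theta> ` V +\<^sub>s \<theta> ` W"
  unfolding ssum_def using linear_add[OF lin] by (auto simp: image_iff) (metis+)

text \<open>
  The image of \<open>W\<close> under the involution is complemented, and the image of the complement
  complements \<open>W\<close>.
\<close>

lemma completely_reducible_\<theta>:
  assumes "completely_reducible J K"
  shows "completely_reducible (\<theta> ` J) (\<theta> ` K)"
  unfolding completely_reducible_def
proof (intro allI impI)
  fix W assume W: "lie_ideal br W \<and> \<theta> ` K \<subseteq> W \<and> W \<subseteq> \<theta> ` J"
  have "K \<subseteq> \<theta> ` W" "\<theta> ` W \<subseteq> J"
    using W image_mono[of "\<theta> ` K" W \<theta>] image_mono[of W "\<theta> ` J" \<theta>] by (simp_all add: image_image_\<theta>)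
  then obtain V where V: "lie_ideal br V" "K \<subseteq> V" "V \<subseteq> J" "\<theta> ` W \<inter> V = K" "\<theta> ` W +\<^sub>s V = J"
    using completely_reducibleD[OF assms ideal_\<theta>] W by metis
  have "W \<inter> \<theta> ` V = \<theta> ` K" using arg_cong[OF V(4), of "image \<theta>"]
    by (simp add: image_Int[OF inj_\<theta>] image_image_\<theta>)
  moreover have "W +\<^sub>s \<theta> ` V = \<theta> ` J" using arg_cong[OF V(5), of "image \<theta>"]
    by (simp add: ssum_\<theta> image_image_\<theta>)
  ultimately show "\<exists>W'. lie_ideal br W' \<and> \<theta> ` K \<subseteq> W' \<and> W' \<subseteq> \<theta> ` J \<and> W \<inter> W' = \<theta> ` K \<and> W +\<^sub>s W' = \<theta> ` J"
    using V ideal_\<theta> by (intro exI[of _ "\<theta> ` V"]) auto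
qed

lemma S_\<theta>: "\<theta> ` S_ideal br k = S_ideal br k"
proof (induction k)
  case 0
  then show ?case by (simp add: linear_0[OF lin])
next
  case (Suc k)
  have "socle_over (S_ideal br k) (\<theta> ` S_ideal br (Suc k))"
    using S_Suc[of k] completely_reducible_\<theta>[of "S_ideal br (Suc k)" "S_ideal br k"] Suc.IH ideal_\<theta>[OF ideal_S]
      image_mono[of "S_ideal br k" "S_ideal br (Suc k)" \<theta>]
    by (simp add: socle_over_def)
  then have le: "\<theta> ` S_ideal br (Suc k) \<subseteq> S_ideal br (Suc k)" by (rule S_greatest)
  then show ?case using image_mono[OF le, of \<theta>] by (simp add: image_image_\<theta>)
qed

lemma can_\<theta>: "\<theta> ` can \<subseteq> can"
proof -
  have "subspace {x. \<theta> x \<in> can}"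
    using ideal_subspace[OF ideal_can]
    by (intro subspaceI) (auto simp: linear_0[OF lin] linear_add[OF lin] linear_scale[OF lin]
        intro: subspace_0 subspace_add subspace_scale)
  moreover have "\<theta> x \<in> can" if "k \<ge> 1" "x \<in> S_ideal br k" "x \<in> R_ideal br k" for x k
  proof (rule can_base[OF that(1)])
    show "\<theta> x \<in> S_ideal br k" using S_\<theta> that(2) by blast
    show "\<theta> x \<in> R_ideal br k" using orth_isometry[OF invol isom, of "S_ideal br k"] S_\<theta> that(3) by (simp add: R_eq_orth_S)
  qed
  ultimately have "can \<subseteq> {x. \<theta> x \<in> can}"
    unfolding canonical_ideal_def[of br] by (intro span_minimal) (auto simp: canonical_ideal_def)
  then show ?thesis by blast
qed

end

end

section \<open>The canonical extension\<close>

lemma (in subspace_pair) minus_Q: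
  assumes "x \<in> J" "y \<in> J"
  shows "coset K x \<ominus>\<^bsub>Q\<^esub> coset K y = coset K (x - y)"
proof -
  interpret abelian_group Q by (rule abelian_group_Q)
  have "coset K (x - y) \<oplus>\<^bsub>Q\<^esub> coset K y = coset K x" by (simp add: add_Q)
  then show ?thesis
    using assms coset_K_in subspace_diff[OF subspace_J] by (metis a_minus_def add.inv_solve_right)
qed

lemma lin_maps_quotI:
  assumes JK: "subspace_pair J K" and JK': "subspace_pair J' K'" and f: "linear f"
    and fJ: "\<And>x. x \<in> J \<Longrightarrow> f x \<in> J'" and F: "\<And>x. x \<in> J \<Longrightarrow> F (coset K x) = coset K' (f x)"
  shows "F \<in> lin_maps (quot br J K) (quot br J' K')"
proof -
  interpret D: subspace_pair br J K by fact
  interpret R: subspace_pair br J' K' by fact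
  have "F (V \<oplus>\<^bsub>D.Q\<^esub> W) = F V \<oplus>\<^bsub>R.Q\<^esub> F W" if "V \<in> carrier D.Q" "W \<in> carrier D.Q" for V W
    using that F subspace_add[OF D.subspace_J]
    by (auto simp: D.carrier_Q D.add_Q R.add_Q linear_add[OF f])
  moreover have "F (c \<odot>\<^bsub>D.Q\<^esub> V) = c \<odot>\<^bsub>R.Q\<^esub> F V" if "V \<in> carrier D.Q" for c V
    using that F subspace_scale[OF D.subspace_J]
    by (auto simp: D.carrier_Q D.smult_Q R.smult_Q linear_scale[OF f])
  moreover have "F \<in> carrier D.Q \<rightarrow> carrier R.Q" using F fJ by (auto simp: D.carrier_Q R.carrier_Q)
  ultimately show ?thesis by (simp add: lin_maps_def)
qed

context lie_algebra
begin

lemma mult_quot: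
  assumes "lie_ideal br K"
  shows "coset K x \<otimes>\<^bsub>quot br J K\<^esub> coset K y = coset K (br x y)"
proof -
  note K = ideal_subspace[OF assms]
  have "ind2 K br (coset K x) (coset K y) = coset K (br x y)"
  proof (rule ind2_eq[OF K coset_self[OF K] coset_self[OF K]])
    fix x' y' assume "x' \<in> coset K x" "y' \<in> coset K y"
    then have "br (x' - x) y' + br x (y' - y) \<in> K"
      using ideal_left[OF assms] ideal_right[OF assms] by (intro subspace_add K) (auto simp: mem_coset)
    then show "br x' y' - br x y \<in> K" by (simp add: br_simps)
  qed
  then show ?thesis by (simp add: quot_def)
qed

lemma lie_alg_quot:
  assumes J: "lie_ideal br J" and K: "lie_ideal br K" "K \<subseteq> J"
  shows "lie_alg (quot br J K)"
proof -
  interpret subspace_pair br J K by (rule subspace_pairI[OF J K])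
  have pair: "subspace_pair J K" by unfold_locales
  obtain B where B: "B \<subseteq> J" "independent B" "J \<subseteq> span B" using maximal_independent_subset by metis
  have "J = span B" using B span_minimal[OF B(1) subspace_J] by blast
  then have fd: "fd_space Q" by (rule fd_space_Q[OF fd.finiteI_independent[OF B(2)]])
  have right: "(\<lambda>W. V \<otimes>\<^bsub>Q\<^esub> W) \<in> lin_maps Q Q" and left: "(\<lambda>W. W \<otimes>\<^bsub>Q\<^esub> V) \<in> lin_maps Q Q"
    if V: "V \<in> carrier Q" for V
  proof -
    obtain v where v: "v \<in> J" "V = coset K v" using V by (auto simp: carrier_Q)
    show "(\<lambda>W. V \<otimes>\<^bsub>Q\<^esub> W) \<in> lin_maps Q Q"
      using ideal_right[OF J] by (intro lin_maps_quotI[OF pair pair linear_br_right[of v]]) (auto simp: v(2) mult_quot[OF K(1)])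
    show "(\<lambda>W. W \<otimes>\<^bsub>Q\<^esub> V) \<in> lin_maps Q Q"
      using ideal_left[OF J] by (intro lin_maps_quotI[OF pair pair linear_br_left[of v]]) (auto simp: v(2) mult_quot[OF K(1)])
  qed
  have self: "V \<otimes>\<^bsub>Q\<^esub> V = \<zero>\<^bsub>Q\<^esub>" if "V \<in> carrier Q" for V
    using that by (auto simp: carrier_Q mult_quot[OF K(1)] br_self zero_Q)
  have jacobi: "U \<otimes>\<^bsub>Q\<^esub> (V \<otimes>\<^bsub>Q\<^esub> W) \<oplus>\<^bsub>Q\<^esub> V \<otimes>\<^bsub>Q\<^esub> (W \<otimes>\<^bsub>Q\<^esub> U) \<oplus>\<^bsub>Q\<^esub> W \<otimes>\<^bsub>Q\<^esub> (U \<otimes>\<^bsub>Q\<^esub> V) = \<zero>\<^bsub>Q\<^esub>"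
    if UVW: "U \<in> carrier Q" "V \<in> carrier Q" "W \<in> carrier Q" for U V W
  proof -
    obtain u v w where "U = coset K u" "V = coset K v" "W = coset K w"
      using UVW unfolding carrier_Q by blast
    moreover have "br u (br v w) + br v (br w u) + br w (br u v) = 0"
      using lie by (simp add: lie_bracket_def)
    ultimately show ?thesis by (simp add: mult_quot[OF K(1)] add_Q zero_Q)
  qed
  show ?thesis unfolding lie_alg_def using fd right left self jacobi by blast
qed

lemma lie_homs_quotI:
  assumes J: "lie_ideal br J" and K: "lie_ideal br K" "K \<subseteq> J"
    and J': "lie_ideal br J'" and K': "lie_ideal br K'" "K' \<subseteq> J'" and f: "linear f"
    and fJ: "\<And>x. x \<in> J \<Longrightarrow> f x \<in> J'" and F: "\<And>x. x \<in> J \<Longrightarrow> F (coset K x) = coset K' (f x)"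
    and hom: "\<And>x y. f (br x y) = br (f x) (f y)"
  shows "F \<in> lie_homs (quot br J K) (quot br J' K')"
proof -
  interpret D: subspace_pair br J K by (rule subspace_pairI[OF J K])
  have "F (V \<otimes>\<^bsub>D.Q\<^esub> W) = F V \<otimes>\<^bsub>quot br J' K'\<^esub> F W" if "V \<in> carrier D.Q" "W \<in> carrier D.Q" for V W
    using that F ideal_right[OF J]
    by (auto simp: D.carrier_Q mult_quot[OF K(1)] mult_quot[OF K'(1)] hom)
  then show ?thesis
    using lin_maps_quotI[OF subspace_pairI[OF J K] subspace_pairI[OF J' K'] f fJ F]
    by (simp add: lie_homs_def)
qed

end

context metric_lie_algebra
begin

text \<open>
  Each induced map is computed on the coset of a representative. The action of \<open>\<gg> / I\<^sup>\<bottom>\<close> on \<open>I\<^sup>\<bottom> / I\<close> is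
  well-defined because \<open>I\<^sup>\<bottom> / I\<close> is abelian, and the induced form is non-degenerate because the double
  orthogonal complement of \<open>I\<close> is \<open>I\<close>.
\<close>

theorem canonical_extension:
  assumes metric: "metric_lie_alg_with_involution br \<theta> ip"
    and I: "lie_ideal br I" and iso: "I \<subseteq> orth ip I" and \<theta>I: "\<theta> ` I \<subseteq> I"
    and abelian: "\<And>x y. x \<in> orth ip I \<Longrightarrow> y \<in> orth ip I \<Longrightarrow> br x y \<in> I"
  shows "quadratic_extension
       (quot br UNIV (orth ip I)) (ind1 (orth ip I) \<theta>)
       (ind2 I br) (quot br (orth ip I) I) (ind_form ip) (ind1 I \<theta>)
       br \<theta> ip
       I (\<lambda>X. X) (ind1 (orth ip I) (\<lambda>x. x))"
proof -
  let ?K = "orth ip I"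
  have lin: "linear \<theta>" and invol: "\<And>x. \<theta> (\<theta> x) = x"
    and hom: "\<And>x y. \<theta> (br x y) = br (\<theta> x) (\<theta> y)" and isom: "\<And>x y. ip (\<theta> x) (\<theta> y) = ip x y"
    using metric by (auto simp: metric_lie_alg_with_involution_def)
  note sI = ideal_subspace[OF I]
  have K: "lie_ideal br ?K" by (rule ideal_orth[OF I])
  note sK = ideal_subspace[OF K]
  have U: "lie_ideal br UNIV" by (auto intro: idealI)
  have \<theta>K: "\<theta> x \<in> ?K" if "x \<in> ?K" for x
    by (rule orth_isometry[OF invol isom \<theta>I that])
  interpret L: subspace_pair br UNIV ?K by (rule subspace_pairI[OF U K]) simp
  interpret A: subspace_pair br ?K I by (rule subspace_pairI[OF K I iso])
  interpret G: subspace_pair br UNIV I by (rule subspace_pairI[OF U I]) simp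
  let ?L = "quot br UNIV ?K" and ?A = "quot br ?K I" and ?G = "quot br UNIV I"
  have \<theta>_coset_K: "ind1 ?K \<theta> (coset ?K x) = coset ?K (\<theta> x)" for x
    using \<theta>K by (intro ind1_coset sK lin order_refl)
  have \<theta>_coset_I: "ind1 I \<theta> (coset I x) = coset I (\<theta> x)" for x
    using \<theta>I by (intro ind1_coset sI lin order_refl) auto
  have p_coset: "ind1 ?K (\<lambda>x. x) (coset I x) = coset ?K x" for x
    using iso by (intro ind1_coset sK sI linear_ident) auto
  have \<rho>_coset: "ind2 I br (coset ?K x) (coset I a) = coset I (br x a)" if a: "a \<in> ?K" for x a
  proof (rule ind2_eq[OF sI coset_self[OF sK] coset_self[OF sI]])
    fix x' a' assume "x' \<in> coset ?K x" "a' \<in> coset I a"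
    then have x': "x' - x \<in> ?K" and a': "a' - a \<in> I" by (auto simp: mem_coset)
    have "br x' (a' - a) + br (x' - x) a \<in> I"
      using ideal_right[OF I a'] abelian[OF x' a] by (rule subspace_add[OF sI])
    then show "br x' a' - br x a \<in> I" by (simp add: br_simps)
  qed
  have form: "ind_form ip (coset I x) (coset I y) = ip x y" if "x \<in> ?K" "y \<in> ?K" for x y
  proof -
    have "ip x' y' = ip x y" if "x' \<in> coset I x" "y' \<in> coset I y" for x' y'
    proof -
      have i: "x' - x \<in> I" and j: "y' - y \<in> I" using that by (auto simp: mem_coset)
      have "x' = (x' - x) + x" by simp
      then have "x' \<in> ?K" using i iso \<open>x \<in> ?K\<close> subspace_add[OF sK] by (metis subsetD)
      then have "ip x' (y' - y) = 0" using j by (rule orthD)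
      moreover have "ip y (x' - x) = 0" using \<open>y \<in> ?K\<close> i by (rule orthD)
      ultimately show ?thesis by (simp add: ip_simps ip_commute[of y])
    qed
    then have "{ip x' y' | x' y'. x' \<in> coset I x \<and> y' \<in> coset I y} = {ip x y}"
      using coset_self[OF sI] by blast
    then show ?thesis by (simp add: ind_form_def)
  qed
  have lie_L: "lie_alg ?L" and lie_A: "lie_alg ?A"
    by (intro lie_alg_quot U K I iso subset_UNIV)+
  have L_inv: "lie_alg_with_involution ?L (ind1 ?K \<theta>)"
  proof -
    have "ind1 ?K \<theta> \<in> lie_homs ?L ?L"
      by (rule lie_homs_quotI[OF U K _ U K _ lin _ _ hom]) (auto simp: \<theta>_coset_K)
    then show ?thesis
      using lie_L
      by (auto simp: lie_alg_with_involution_def involutive_on_def L.carrier_Q \<theta>_coset_K invol)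
  qed
  have fd_A: "fd_space ?A" using lie_A by (simp add: lie_alg_def)
  have sp_A: "scalar_product_on ?A (ind_form ip)"
    unfolding scalar_product_on_def
  proof (intro conjI ballI allI impI)
    fix X Y assume "X \<in> carrier ?A" "Y \<in> carrier ?A"
    then obtain x y where xy: "x \<in> ?K" "X = coset I x" "y \<in> ?K" "Y = coset I y" by (auto simp: A.carrier_Q)
    show "ind_form ip X Y = ind_form ip Y X" using xy by (simp add: form ip_commute)
    show "ind_form ip (c \<odot>\<^bsub>?A\<^esub> X) Y = c * ind_form ip X Y" for c
      using xy by (simp add: A.smult_Q form subspace_scale[OF sK] ip_simps)
    fix Z assume "Z \<in> carrier ?A"
    then obtain z where z: "z \<in> ?K" "Z = coset I z" by (auto simp: A.carrier_Q)
    show "ind_form ip (X \<oplus>\<^bsub>?A\<^esub> Y) Z = ind_form ip X Z + ind_form ip Y Z"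
      using xy z by (simp add: A.add_Q form subspace_add[OF sK] ip_simps)
  next
    fix X assume X: "X \<in> carrier ?A" and zero: "\<forall>Y\<in>carrier ?A. ind_form ip X Y = 0"
    obtain x where x: "x \<in> ?K" "X = coset I x" using X by (auto simp: A.carrier_Q)
    have "ip x y = 0" if "y \<in> ?K" for y
      using zero A.coset_K_in[OF that] form[OF x(1) that] x(2) by auto
    then have "x \<in> orth ip ?K" by (simp add: orth_def)
    then show "X = \<zero>\<^bsub>?A\<^esub>" using x(2) orth_orth[OF sI] by (simp add: A.zero_Q A.coset_eq)
  qed
  have rep: "representation_on ?L (ind2 I br) ?A"
    unfolding representation_on_def
  proof (intro conjI ballI)
    show "ind2 I br X \<in> lin_maps ?A ?A" if X: "X \<in> carrier ?L" for X
    proof -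
      obtain x where x: "X = coset ?K x" using X by (auto simp: L.carrier_Q)
      show ?thesis
        using ideal_right[OF K]
        by (intro lin_maps_quotI[OF A.subspace_pair_axioms A.subspace_pair_axioms linear_br_right[of x]])
          (auto simp: x \<rho>_coset)
    qed
    show "(\<lambda>X. ind2 I br X V) \<in> lin_maps ?L ?A" if V: "V \<in> carrier ?A" for V
    proof -
      obtain v where v: "v \<in> ?K" "V = coset I v" using V by (auto simp: A.carrier_Q)
      show ?thesis
        using ideal_right[OF K v(1)]
        by (intro lin_maps_quotI[OF L.subspace_pair_axioms A.subspace_pair_axioms linear_br_left[of v]])
          (auto simp: v \<rho>_coset)
    qed
    fix X Y V assume XYV: "X \<in> carrier ?L" "Y \<in> carrier ?L" "V \<in> carrier ?A"
    then obtain x y where xy: "X = coset ?K x" "Y = coset ?K y" by (auto simp: L.carrier_Q)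
    obtain v where v: "v \<in> ?K" "V = coset I v" using XYV(3) by (auto simp: A.carrier_Q)
    have "ind2 I br (X \<otimes>\<^bsub>?L\<^esub> Y) V = coset I (br (br x y) v)"
      by (simp add: xy v mult_quot[OF K] \<rho>_coset)
    also have "\<dots> = coset I (br x (br y v)) \<ominus>\<^bsub>?A\<^esub> coset I (br y (br x v))"
      using ideal_right[OF K] v(1) by (simp add: A.minus_Q br_br)
    finally show "ind2 I br (X \<otimes>\<^bsub>?L\<^esub> Y) V
        = ind2 I br X (ind2 I br Y V) \<ominus>\<^bsub>?A\<^esub> ind2 I br Y (ind2 I br X V)"
      using ideal_right[OF K] v(1) by (simp add: xy v \<rho>_coset)
  qed
  have \<theta>_A: "ind1 I \<theta> \<in> lin_maps ?A ?A"
    using \<theta>K by (intro lin_maps_quotI[OF A.subspace_pair_axioms A.subspace_pair_axioms lin]) (auto simp: \<theta>_coset_I)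
  have orthmod: "orthogonal_module ?L (ind1 ?K \<theta>) (ind2 I br) ?A (ind_form ip) (ind1 I \<theta>)"
    unfolding orthogonal_module_def
  proof (intro conjI ballI fd_A sp_A rep \<theta>_A)
    show "involutive_on (carrier ?A) (ind1 I \<theta>)"
      using \<theta>K by (auto simp: involutive_on_def A.carrier_Q \<theta>_coset_I invol)
    show "ind_form ip (ind1 I \<theta> V) (ind1 I \<theta> W) = ind_form ip V W"
      if "V \<in> carrier ?A" "W \<in> carrier ?A" for V W
      using that \<theta>K by (auto simp: A.carrier_Q \<theta>_coset_I form isom)
    fix X V assume X: "X \<in> carrier ?L" and V: "V \<in> carrier ?A"
    obtain x where x: "X = coset ?K x" using X by (auto simp: L.carrier_Q)
    obtain v where v: "v \<in> ?K" "V = coset I v" using V by (auto simp: A.carrier_Q)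
    show "ind1 I \<theta> (ind2 I br (ind1 ?K \<theta> X) V) = ind2 I br X (ind1 I \<theta> V)"
      using v \<theta>K by (simp add: x \<theta>_coset_K \<theta>_coset_I \<rho>_coset hom invol)
    show "ind_form ip (ind2 I br X V) W = - ind_form ip V (ind2 I br X W)" if "W \<in> carrier ?A" for W
      using that v ideal_right[OF K] by (auto simp: A.carrier_Q x \<rho>_coset form invariant)
  qed
  have abelian_A: "abelian_lie_alg ?A"
    using lie_A abelian
    by (auto simp: abelian_lie_alg_def A.carrier_Q mult_quot[OF I] A.zero_Q A.coset_eq)
  have incl: "(\<lambda>X. X) \<in> lie_inv_homs ?A (ind1 I \<theta>) ?G (ind1 I \<theta>)"
    unfolding lie_inv_homs_def
    using lie_homs_quotI[OF K I iso U I subset_UNIV linear_ident, of "\<lambda>X. X"] by simp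
  have proj: "ind1 ?K (\<lambda>x. x) \<in> lie_inv_homs ?G (ind1 I \<theta>) ?L (ind1 ?K \<theta>)"
    unfolding lie_inv_homs_def
    using lie_homs_quotI[OF U I subset_UNIV U K subset_UNIV linear_ident, of "ind1 ?K (\<lambda>x. x)"]
    by (auto simp: p_coset G.carrier_Q \<theta>_coset_I \<theta>_coset_K)
  have exact: "carrier ?A = {X \<in> carrier ?G. ind1 ?K (\<lambda>x. x) X = \<zero>\<^bsub>?L\<^esub>}"
  proof (rule subset_antisym; rule subsetI)
    fix X assume "X \<in> carrier ?A"
    then obtain x where "x \<in> ?K" "X = coset I x" by (auto simp: A.carrier_Q)
    then show "X \<in> {X \<in> carrier ?G. ind1 ?K (\<lambda>x. x) X = \<zero>\<^bsub>?L\<^esub>}"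
      by (simp add: G.carrier_Q p_coset L.zero_Q L.coset_eq)
  next
    fix X assume X: "X \<in> {X \<in> carrier ?G. ind1 ?K (\<lambda>x. x) X = \<zero>\<^bsub>?L\<^esub>}"
    then obtain x where x: "X = coset I x" by (auto simp: G.carrier_Q)
    have "coset ?K x = coset ?K 0" using X by (simp add: x p_coset L.zero_Q)
    then show "X \<in> carrier ?A" by (simp add: x L.coset_eq A.coset_K_in)
  qed
  have surj: "ind1 ?K (\<lambda>x. x) ` carrier ?G = carrier ?L"
    by (simp add: G.carrier_Q L.carrier_Q image_image p_coset)
  have action: "ind2 I br (ind1 ?K (\<lambda>x. x) X) a = X \<otimes>\<^bsub>?G\<^esub> a"
    if "X \<in> carrier ?G" "a \<in> carrier ?A" for X a
    using that by (auto simp: G.carrier_Q A.carrier_Q p_coset \<rho>_coset mult_quot[OF I])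
  show ?thesis
    unfolding quadratic_extension_def
    using L_inv orthmod abelian_A metric I \<theta>I iso incl proj exact surj action by simp
qed

end

theorem proposition5p1:
  fixes br :: "'g::real_vector \<Rightarrow> 'g \<Rightarrow> 'g"
    and \<theta> :: "'g \<Rightarrow> 'g"
    and ip :: "'g \<Rightarrow> 'g \<Rightarrow> real"
  assumes "symmetric_triple br \<theta> ip"
    and "\<forall>J. lie_ideal br J \<and> semisimple_lie br J \<longrightarrow> J = {0}"
  shows "let I = canonical_ideal br; K = orth ip I in
     balanced_quadratic_extension
       (quot br UNIV K) (ind1 K \<theta>)
       (ind2 I br) (quot br K I) (ind_form ip) (ind1 I \<theta>)
       br \<theta> ip
       I (\<lambda>X. X) (ind1 K (\<lambda>x. x)) \<and>
     admissible_quadratic_extension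
       (quot br UNIV K) (ind1 K \<theta>)
       (ind2 I br) (quot br K I) (ind_form ip) (ind1 I \<theta>)
       br \<theta> ip
       I (\<lambda>X. X) (ind1 K (\<lambda>x. x))"
proof -
  have metric: "metric_lie_alg_with_involution br \<theta> ip"
    using assms(1) by (simp add: symmetric_triple_def)
  then obtain B :: "'g set" where B: "finite B" "span B = UNIV"
    by (auto simp: metric_lie_alg_with_involution_def)
  obtain E where E: "E \<subseteq> B" "independent E" "B \<subseteq> span E"
    using maximal_independent_subset by metis
  have "span E = UNIV" using B(2) span_minimal[OF E(3) subspace_span] by auto
  then interpret metric_lie_algebra E br ip
    using metric E finite_subset[OF E(1) B(1)]
    by unfold_locales (auto simp: metric_lie_alg_with_involution_def)
  have "canonical_ideal br \<subseteq> orth ip (canonical_ideal br)" by (rule can_isotropic)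
  moreover have "\<theta> ` canonical_ideal br \<subseteq> canonical_ideal br"
    using metric by (intro can_\<theta>) (auto simp: metric_lie_alg_with_involution_def)
  ultimately show ?thesis
    using canonical_extension[OF metric ideal_can _ _ orth_can_abelian[OF assms(2)]] assms(1)
    by (simp add: Let_def balanced_quadratic_extension_def admissible_quadratic_extension_def)
qed

end
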